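(* Let $p>2$, $\alpha>1-\frac1p$ and $0\le h_1<h_2\le1$. Then for every $r>0$, $$\mathbb{P}\left(\frac{\|\mathcal{S}^{B,p}_{h_2}-\mathcal{S}^{B,p}_{h_1}\|_p}{d_2(p)\,(h_2-h_1)^{\frac12-\frac1p}}-d_1(\alpha,p)\ge r\right)\le\frac{1}{\sqrt{2\pi}}\,\frac1r\exp\left(-\frac{r^2}{2}\right),$$ where $d_1(\alpha,p)=\dfrac{d(\alpha,p)^{1/p}}{d_p}$ and $d_2(p)=2d_p$, with $$d_p=2^{\frac1p+\frac12}\left(1+2^{\frac p2}\right)^{\frac1p},\qquad d(\alpha,p)=2^{\frac p2}\left(4+2^{\frac{p-1}{p}}\right)^p c(\alpha,p)^p\sqrt{\frac{2^p}{\pi}}\;\Gamma\left(\frac{p+1}{2}\right)\sum_{n=0}^\infty (n+1)^{\alpha p}2^{n(1-\frac p2)},$$ $$c(\alpha,p)=\left(\sum_{n=1}^\infty n^{-\alpha\frac{p}{p-1}}\right)^{\frac{p-1}{p}}.$$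
   Context: $C_0([-1,1])$ is the space of continuous $f:[-1,1]\to\mathbb{R}$ with $f(-1)=0$, with the sup-norm, equipped with the $\mathbb{P}$-completed Borel $\sigma$-algebra, where $\mathbb{P}$ is Wiener measure (under which the coordinate process $B_t(f)=f(t)$, $t\in[-1,1]$, is a Brownian motion started from $0$ at time $-1$). For a continuous $f:[a,b]\to\mathbb{R}$, $\mathcal{V}_p(f):=\sup_D\big(\sum_{D}|f(t_{i+1})-f(t_i)|^p\big)^{1/p}$, the supremum over all finite dissections $D=\{a=t_0<\dots<t_n=b\}$. $C([a,b])_p$ is the space of continuous $f$ on $[a,b]$ with $\mathcal{V}_p(f)<\infty$, $C_0([a,b])_p$ the subspace of those vanishing at $a$; $\|f\|_p:=\mathcal{V}_p(f)+\|f\|_\infty$. For $h\in[0,1]$, $\mathcal{T}^f_h(u):=f(h-1+u)$, $u\in[0,1]$. For $p>2$, $\mathcal{T}^{B,p}_h(f):=\mathcal{T}^f_h$ if $f\in C_0([-1,1])_p$ (a set of full $\mathbb{P}$-measure) and $0$ otherwise. $\mathcal{S}^{B,p}$ denotes the continuous modification of the process $(\mathcal{T}^{B,p}_h)_{h\in[0,1]}$ with values in $(C([0,1])_p,\|\cdot\|_p)$. $\Gamma$ is the Gamma function. *)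

theory Defs
  imports "HOL-Probability.Probability"
begin

text \<open>A path on \<open>[a,b]\<close> is a function \<open>real \<Rightarrow> real\<close> that is extensional on \<open>{a..b}\<close>,
  i.e. takes the fixed value \<open>undefined\<close> outside, so that equality in \<open>cpaths a b\<close> is equality
  of functions on \<open>[a,b]\<close>.\<close>

definition cpaths :: "real \<Rightarrow> real \<Rightarrow> (real \<Rightarrow> real) set" where
  "cpaths a b = {f \<in> extensional {a..b}. continuous_on {a..b} f}"

text \<open>A dissection \<open>a = t 0 < \<dots> < t n = b\<close> is encoded as the pair \<open>(n, t)\<close>; the values of
  \<open>t\<close> beyond \<open>n\<close> are irrelevant.\<close>

definition dissections :: "real \<Rightarrow> real \<Rightarrow> (nat \<times> (nat \<Rightarrow> real)) set" where
  "dissections a b = {(n, t). t 0 = a \<and> t n = b \<and> (\<forall>i<n. t i < t (Suc i))}"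

definition p_variation :: "real \<Rightarrow> real \<Rightarrow> real \<Rightarrow> (real \<Rightarrow> real) \<Rightarrow> ereal" where
  "p_variation p a b f =
     (SUP (n, t)\<in>dissections a b. ereal ((\<Sum>i<n. \<bar>f (t (Suc i)) - f (t i)\<bar> powr p) powr (1 / p)))"

definition cpaths_p :: "real \<Rightarrow> real \<Rightarrow> real \<Rightarrow> (real \<Rightarrow> real) set" where
  "cpaths_p p a b = {f \<in> cpaths a b. p_variation p a b f < \<infinity>}"

definition cpaths0_p :: "real \<Rightarrow> real \<Rightarrow> real \<Rightarrow> (real \<Rightarrow> real) set" where
  "cpaths0_p p a b = {f \<in> cpaths_p p a b. f a = 0}"

text \<open>Only meaningful for continuous functions of finite \<open>p\<close>-variation; it depends only on the
  values on \<open>[a,b]\<close>, so differences of paths need not be made extensional again.\<close>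

definition p_norm :: "real \<Rightarrow> real \<Rightarrow> real \<Rightarrow> (real \<Rightarrow> real) \<Rightarrow> real" where
  "p_norm p a b f = real_of_ereal (p_variation p a b f) + (SUP t\<in>{a..b}. \<bar>f t\<bar>)"

definition C0_metric :: "(real \<Rightarrow> real) metric" where
  "C0_metric = submetric (cfunspace (top_of_set {-1..1}) euclidean_metric) {f. f (-1) = 0}"

lemma mspace_C0_metric: "mspace C0_metric = {f \<in> cpaths (-1) 1. f (-1) = 0}"
proof -
  have "bounded (f ` {-1..1})" if "continuous_on {-1..1} f" for f :: "real \<Rightarrow> real"
    using that by (intro compact_imp_bounded compact_continuous_image) auto
  then show ?thesis
    by (auto simp: C0_metric_def cpaths_def)
qed

lemma mdist_C0_metric:
  assumes "f \<in> mspace C0_metric" "g \<in> mspace C0_metric"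
  shows "mdist C0_metric f g = (SUP t\<in>{-1..1}. \<bar>f t - g t\<bar>)"
  using assms
  by (auto simp: C0_metric_def mdist_cfunspace_eq_mdist_funspace Met_TC.fdist_def Met_TC.fspace_def dist_real_def)

definition C0_borel :: "(real \<Rightarrow> real) measure" where
  "C0_borel = sigma (mspace C0_metric) {U. openin (mtopology_of C0_metric) U}"

definition brownian_motion_on ::
  "'a measure \<Rightarrow> real \<Rightarrow> real \<Rightarrow> (real \<Rightarrow> 'a \<Rightarrow> real) \<Rightarrow> bool" where
  "brownian_motion_on M a b X \<longleftrightarrow>
     (\<forall>\<omega>\<in>space M. X a \<omega> = 0) \<and>
     (\<forall>\<omega>\<in>space M. continuous_on {a..b} (\<lambda>t. X t \<omega>)) \<and>
     (\<forall>s t. a \<le> s \<and> s < t \<and> t \<le> b \<longrightarrow>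
        distributed M lborel (\<lambda>\<omega>. X t \<omega> - X s \<omega>) (normal_density 0 (sqrt (t - s)))) \<and>
     (\<forall>n t. a \<le> t 0 \<and> t n \<le> b \<and> (\<forall>i<n. t i < t (Suc i)) \<longrightarrow>
        prob_space.indep_vars M (\<lambda>_. borel) (\<lambda>i \<omega>. X (t (Suc i)) \<omega> - X (t i) \<omega>) {..<n})"

text \<open>This determines \<open>W\<close> uniquely: the Borel sets are generated by the coordinate maps.\<close>

definition wiener_measure :: "(real \<Rightarrow> real) measure \<Rightarrow> bool" where
  "wiener_measure W \<longleftrightarrow>
     prob_space W \<and> space W = space C0_borel \<and> sets W = sets C0_borel \<and>
     brownian_motion_on W (-1) 1 (\<lambda>t f. f t)"

definition shift_path :: "real \<Rightarrow> (real \<Rightarrow> real) \<Rightarrow> (real \<Rightarrow> real)" where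
  "shift_path h f = restrict (\<lambda>u. f (h - 1 + u)) {0..1}"

definition shift_B :: "real \<Rightarrow> real \<Rightarrow> (real \<Rightarrow> real) \<Rightarrow> (real \<Rightarrow> real)" where
  "shift_B p h f = (if f \<in> cpaths0_p p (-1) 1 then shift_path h f else restrict (\<lambda>_. 0) {0..1})"

text \<open>\<open>S\<close> is a continuous modification over \<open>h \<in> [0,1]\<close> of the process \<open>T\<close>, with values in
  \<open>(cpaths_p p 0 1, p_norm p 0 1)\<close>.\<close>

definition continuous_modification ::
  "(real \<Rightarrow> real) measure \<Rightarrow> real \<Rightarrow> (real \<Rightarrow> (real \<Rightarrow> real) \<Rightarrow> (real \<Rightarrow> real))
     \<Rightarrow> (real \<Rightarrow> (real \<Rightarrow> real) \<Rightarrow> (real \<Rightarrow> real)) \<Rightarrow> bool" where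
  "continuous_modification P p T S \<longleftrightarrow>
     (\<forall>h\<in>{0..1}. \<forall>f\<in>space P. S h f \<in> cpaths_p p 0 1) \<and>
     (\<forall>f\<in>space P. \<forall>h\<in>{0..1}.
        ((\<lambda>k. p_norm p 0 1 (\<lambda>u. S k f u - S h f u)) \<longlongrightarrow> 0) (at h within {0..1})) \<and>
     (\<forall>h\<in>{0..1}. AE f in P. S h f = T h f)"

definition c_const :: "real \<Rightarrow> real \<Rightarrow> real" where
  "c_const \<alpha> p = (\<Sum>n. real (Suc n) powr (- \<alpha> * (p / (p - 1)))) powr ((p - 1) / p)"

definition d_const :: "real \<Rightarrow> real \<Rightarrow> real" where
  "d_const \<alpha> p =
     2 powr (p / 2) * (4 + 2 powr ((p - 1) / p)) powr p * c_const \<alpha> p powr p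
     * sqrt (2 powr p / pi) * Gamma ((p + 1) / 2)
     * (\<Sum>n. real (n + 1) powr (\<alpha> * p) * 2 powr (real n * (1 - p / 2)))"

definition dp_const :: "real \<Rightarrow> real" where
  "dp_const p = 2 powr (1 / p + 1 / 2) * (1 + 2 powr (p / 2)) powr (1 / p)"

definition d1_const :: "real \<Rightarrow> real \<Rightarrow> real" where
  "d1_const \<alpha> p = d_const \<alpha> p powr (1 / p) / dp_const p"

definition d2_const :: "real \<Rightarrow> real" where
  "d2_const p = 2 * dp_const p"

end

theory Submission
  imports Defs "HOL-Real_Asymp.Real_Asymp"
begin

text \<open>Write \<open>\<delta> = h2 - h1\<close> and \<open>\<theta> = 1/2 - 1/p\<close>. Almost surely \<open>S h2 f - S h1 f\<close> is the path
\<open>g u = f (h2 - 1 + u) - f (h1 - 1 + u)\<close>, so the claim is a tail bound for the norm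
\<open>F = V + sup\<close> of the Gaussian process \<open>g\<close>, where \<open>V\<close> is the \<open>p\<close>-variation. Such a norm
concentrates about its mean at the scale of its Lipschitz constant on the Cameron--Martin space, and
the proof consists of three estimates that leave enough room for the stated constants.

\<^item> Concentration: a nonnegative \<open>\<sigma>\<close>-Lipschitz function of finitely many independent standard normals
exceeds its mean by \<open>t\<close> with probability at most \<open>exp (- t\<^sup>2 / (2 \<sigma>\<^sup>2))\<close>
(\<open>gauss_concentration\<close>). This comes from a Prekopa--Leindler inequality for Gaussian measure,
which is proved on the line from the Brunn--Minkowski inequality and passes to products because its
quadratic error term is additive in the coordinates.

\<^item> Lipschitz constant: if the path \<open>f\<close> has energy \<open>E = \<integral> f'\<^sup>2\<close>, then \<open>F \<le> 3 sqrt (\<delta> E)\<close>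
(\<open>norm_le_energy\<close>). Increments of \<open>g\<close> over both short and long intervals have squares bounded by
\<open>2 \<delta>\<close> times a quantity that telescopes, so even the quadratic variation of \<open>g\<close> is at most
\<open>4 \<delta> E\<close>.

\<^item> Mean: \<open>g\<close> on a dyadic grid is the sum of step functions, one for each dyadic level. A step function has
norm at most three times the \<open>\<ell>\<^sup>p\<close>-norm of its values (\<open>norm_step_function\<close>), because each value
is left at most once and entered at most once along a dissection. If the coarsest level has mesh
comparable to \<open>\<delta>\<close>, summing the Gaussian moments over the levels gives
a mean of at most \<open>10.5 m Q \<delta> powr \<theta>\<close>, where \<open>m\<close> is the \<open>L\<^sup>p\<close>-norm of a standard normal and \<open>Q\<close>
is the product of \<open>c_const \<alpha> p\<close> and the root of the series in \<open>d_const\<close>; \<open>Q\<close> enters only through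
the Hoelder bound \<open>(\<Sum>k. 2 powr (- k \<theta>)) \<le> Q\<close>.

Since \<open>d1_const * d2_const \<ge> 14 m Q\<close>, \<open>d2_const \<ge> 4\<close> and \<open>sqrt \<delta> \<le> \<delta> powr \<theta>\<close>, the threshold
in the theorem exceeds the mean by more than \<open>\<sigma> (r + 1)\<close> with \<open>\<sigma> = 3 sqrt \<delta>\<close>. So the probability is at most \<open>exp (- (r + 1)\<^sup>2 / 2)\<close>, and
the extra \<open>1\<close> pays for the factor \<open>1 / (r sqrt (2 \<pi>))\<close>. Concentration and mean are both
applied to the norm restricted to dyadic grids, which depends on finitely many increments and increases
to \<open>F\<close> by continuity.\<close>

section \<open>The Prekopa--Leindler inequality on the line\<close>

lemma emeasure_lborel_translate:
  fixes A :: "real set"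
  assumes [measurable]: "A \<in> sets borel"
  shows "emeasure lborel {x. c + x \<in> A} = emeasure lborel A"
proof -
  have "emeasure lborel A = (\<integral>\<^sup>+x. indicator A x \<partial>lborel)" by simp
  also have "\<dots> = (\<integral>\<^sup>+x. indicator A (c + 1 * x) \<partial>lborel)"
    by (subst nn_integral_real_affine[of _ 1 c]) simp_all
  also have "\<dots> = (\<integral>\<^sup>+x. indicator {x. c + x \<in> A} x \<partial>lborel)"
    by (intro nn_integral_cong) (simp add: indicator_def)
  also have "\<dots> = emeasure lborel {x. c + x \<in> A}"
    by (subst nn_integral_indicator) auto
  finally show ?thesis by simp
qed

lemma emeasure_lborel_dilate:
  fixes A :: "real set"
  assumes [measurable]: "A \<in> sets borel" and s: "s > 0"
  shows "emeasure lborel {x. x / s \<in> A} = ennreal s * emeasure lborel A"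
proof -
  have "emeasure lborel {x. x / s \<in> A} = (\<integral>\<^sup>+x. indicator {x. x / s \<in> A} x \<partial>lborel)"
    by (subst nn_integral_indicator) auto
  also have "\<dots> = ennreal s * (\<integral>\<^sup>+x. indicator {x. x / s \<in> A} (0 + s * x) \<partial>lborel)"
    using s by (subst nn_integral_real_affine[of _ s 0]) auto
  also have "(\<integral>\<^sup>+x. indicator {x. x / s \<in> A} (0 + s * x) \<partial>lborel) = (\<integral>\<^sup>+x. indicator A x \<partial>lborel)"
    using s by (intro nn_integral_cong) (auto simp: indicator_def)
  finally show ?thesis by simp
qed

text \<open>Translate \<open>A\<close> by the minimum \<open>b\<close> of \<open>B\<close> and \<open>B\<close> by the maximum \<open>a\<close> of \<open>A\<close>. Both
translates lie in the sum set, and they meet in the single point \<open>a + b\<close> at most.\<close>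
lemma brunn_minkowski_compact:
  fixes A B C :: "real set"
  assumes cpt: "compact A" "compact B" and ne: "A \<noteq> {}" "B \<noteq> {}" and C: "C \<in> sets borel"
    and sub: "\<And>x y. x \<in> A \<Longrightarrow> y \<in> B \<Longrightarrow> x + y \<in> C"
  shows "emeasure lborel A + emeasure lborel B \<le> emeasure lborel C"
proof -
  obtain a where a: "a \<in> A" "\<And>x. x \<in> A \<Longrightarrow> x \<le> a"
    using compact_attains_sup[OF cpt(1) ne(1)] by blast
  obtain b where b: "b \<in> B" "\<And>y. y \<in> B \<Longrightarrow> b \<le> y"
    using compact_attains_inf[OF cpt(2) ne(2)] by blast
  have [measurable]: "A \<in> sets borel" "B \<in> sets borel"
    using cpt by (auto intro: borel_compact)
  define A' where "A' = {x. - b + x \<in> A}"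
  define B' where "B' = {x. - a + x \<in> B}"
  have m[measurable]: "A' \<in> sets borel" "B' \<in> sets borel"
    unfolding A'_def B'_def by measurable
  have "A' \<inter> B' \<subseteq> {a + b}"
    using a b by (force simp: A'_def B'_def)
  then have null: "emeasure lborel (A' \<inter> B') = 0"
    by (metis emeasure_lborel_singleton emeasure_mono finite.emptyI finite.insertI
        finite_imp_closed borel_closed le_zero_eq sets_lborel)
  have "A' \<union> B' \<subseteq> C"
  proof
    fix x assume "x \<in> A' \<union> B'"
    then show "x \<in> C"
    proof
      assume "x \<in> A'"
      then have "(- b + x) + b \<in> C" unfolding A'_def using b by (intro sub) auto
      then show ?thesis by simp
    next
      assume "x \<in> B'"
      then have "a + (- a + x) \<in> C" unfolding B'_def using a by (intro sub) auto
      then show ?thesis by simp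
    qed
  qed
  have "emeasure lborel A' = emeasure lborel A" "emeasure lborel B' = emeasure lborel B"
    unfolding A'_def B'_def by (rule emeasure_lborel_translate, simp)+
  then have "emeasure lborel A + emeasure lborel B = emeasure lborel A' + emeasure lborel B'"
    by simp
  also have "\<dots> = emeasure lborel (A' \<union> B')"
    using emeasure_Un_Int[of A' lborel B'] null by simp
  also have "\<dots> \<le> emeasure lborel C"
    using \<open>A' \<union> B' \<subseteq> C\<close> C by (intro emeasure_mono) auto
  finally show ?thesis .
qed

lemma compact_inner_approx:
  fixes A :: "real set"
  assumes A: "A \<in> sets borel" "A \<noteq> {}" and y: "y < emeasure lborel A"
  shows "\<exists>K. compact K \<and> K \<noteq> {} \<and> K \<subseteq> A \<and> y < emeasure lborel K"
proof -
  obtain x0 where x0: "x0 \<in> A" using A by auto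
  have "(SUP n. emeasure lborel (A \<inter> {-real n..real n})) = emeasure lborel (\<Union>n. A \<inter> {-real n..real n})"
    using A by (intro SUP_emeasure_incseq) (auto simp: incseq_def)
  also have "(\<Union>n. A \<inter> {-real n..real n}) = A"
  proof -
    have "\<exists>n. - real n \<le> x \<and> x \<le> real n" for x :: real
    proof -
      obtain n where "\<bar>x\<bar> \<le> real n" using real_arch_simple by blast
      then have "- real n \<le> x \<and> x \<le> real n" by linarith
      then show ?thesis by blast
    qed
    then show ?thesis by fastforce
  qed
  finally obtain n where n: "y < emeasure lborel (A \<inter> {-real n..real n})"
    using y by (metis (no_types, lifting) less_SUP_iff)
  let ?A = "A \<inter> {-real n..real n}"
  have Am: "?A \<in> sets borel" using A by auto
  have fin: "emeasure lborel ?A < \<infinity>"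
    by (intro emeasure_bounded_finite) (auto intro: bounded_subset[of "{-real n..real n}"])
  obtain e where e: "e > 0" "y + ennreal e \<le> emeasure lborel ?A"
  proof -
    from n fin obtain r where r: "emeasure lborel ?A = ennreal r" "r \<ge> 0"
      by (cases "emeasure lborel ?A") auto
    from n fin obtain q where q: "y = ennreal q" "q \<ge> 0"
      by (cases y) auto
    have "q < r" using n r q by (simp add: ennreal_less_iff)
    then show ?thesis using that[of "r - q"] r q by (auto simp flip: ennreal_plus)
  qed
  have "?A \<in> sets lebesgue" using Am by auto
  then obtain T where T: "closed T" "T \<subseteq> ?A" "emeasure lebesgue (?A - T) < ennreal e"
    using sets_lebesgue_inner_closed[OF _ e(1)] by metis
  have Tm: "T \<in> sets borel" using T by auto
  have "compact T"
    using T by (intro compact_eq_bounded_closed[THEN iffD2])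
      (auto intro: bounded_subset[of "{-real n..real n}"])
  have "emeasure lborel (T \<union> (?A - T)) \<le> emeasure lborel T + emeasure lborel (?A - T)"
    using Tm Am by (intro emeasure_subadditive) auto
  moreover have "T \<union> (?A - T) = ?A" using T by auto
  ultimately have sub: "emeasure lborel ?A \<le> emeasure lborel T + emeasure lborel (?A - T)" by simp
  have small: "emeasure lborel (?A - T) < ennreal e"
    using T(3) emeasure_completion[of "?A - T" lborel] Tm Am by simp
  have "y < emeasure lborel T"
  proof (rule ccontr)
    assume "\<not> ?thesis"
    then have "emeasure lborel T \<le> y" by simp
    then have "y + ennreal e \<le> y + emeasure lborel (?A - T)"
      using e(2) sub by (meson add_right_mono order_trans)
    also have "\<dots> < y + ennreal e"
      using small n fin by (subst ennreal_add_left_cancel_less) auto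
    finally show False by simp
  qed
  moreover have "T \<noteq> {}" using calculation by auto
  ultimately show ?thesis using T \<open>compact T\<close> by blast
qed

text \<open>Nonemptiness is essential: with \<open>B\<close> empty the inequality would compare \<open>A\<close> with an arbitrary \<open>C\<close>.
The measurable case follows by exhausting both sets by compact subsets.\<close>
lemma brunn_minkowski_real:
  fixes A B C :: "real set"
  assumes A: "A \<in> sets borel" "A \<noteq> {}" and B: "B \<in> sets borel" "B \<noteq> {}" and C: "C \<in> sets borel"
    and sub: "\<And>x y. x \<in> A \<Longrightarrow> y \<in> B \<Longrightarrow> x + y \<in> C"
  shows "emeasure lborel A + emeasure lborel B \<le> emeasure lborel C"
proof -
  have le: "emeasure lborel K + emeasure lborel L \<le> emeasure lborel C"
    if "compact K" "K \<noteq> {}" "K \<subseteq> A" "compact L" "L \<noteq> {}" "L \<subseteq> B" for K L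
    using that sub C by (intro brunn_minkowski_compact) auto
  define KS where "KS X = {K. compact K \<and> K \<noteq> {} \<and> K \<subseteq> X}" for X :: "real set"
  have sup: "emeasure lborel X \<le> (SUP K\<in>KS X. emeasure lborel K)"
    if "X \<in> sets borel" "X \<noteq> {}" for X
  proof (rule ccontr)
    assume "\<not> ?thesis"
    then have "(SUP K\<in>KS X. emeasure lborel K) < emeasure lborel X" by simp
    from compact_inner_approx[OF that this] obtain K where
      "K \<in> KS X" "(SUP K\<in>KS X. emeasure lborel K) < emeasure lborel K" by (auto simp: KS_def)
    then show False by (meson SUP_upper leD)
  qed
  have ne: "KS A \<noteq> {}" "KS B \<noteq> {}"
    using A B by (auto simp: KS_def)
  have "emeasure lborel A + emeasure lborel B
      \<le> (SUP K\<in>KS A. emeasure lborel K) + (SUP L\<in>KS B. emeasure lborel L)"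
    using sup[OF A] sup[OF B] by (rule add_mono)
  also have "\<dots> = (SUP K\<in>KS A. SUP L\<in>KS B. emeasure lborel K + emeasure lborel L)"
    by (simp add: ennreal_SUP_add_left ennreal_SUP_add_right[symmetric] ne)
  also have "\<dots> \<le> emeasure lborel C"
    by (intro SUP_least le) (auto simp: KS_def)
  finally show ?thesis .
qed

lemma nn_integral_layer_cake:
  fixes f :: "real \<Rightarrow> real"
  assumes [measurable]: "f \<in> borel_measurable borel" and nn: "\<And>x. 0 \<le> f x"
  shows "(\<integral>\<^sup>+x. ennreal (f x) \<partial>lborel)
    = (\<integral>\<^sup>+t. indicator {0<..} t * emeasure lborel {x. t < f x} \<partial>lborel)"
proof -
  have "ennreal (f x) = (\<integral>\<^sup>+t. indicator {0<..<f x} t \<partial>lborel)" for x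
    using nn[of x] by simp
  then have "(\<integral>\<^sup>+x. ennreal (f x) \<partial>lborel) = (\<integral>\<^sup>+x. \<integral>\<^sup>+t. indicator {0<..<f x} t \<partial>lborel \<partial>lborel)"
    by simp
  also have "\<dots> = (\<integral>\<^sup>+x. \<integral>\<^sup>+t. indicator {0<..} t * indicator {x. t < f x} x \<partial>lborel \<partial>lborel)"
    by (intro nn_integral_cong) (auto simp: indicator_def)
  also have "\<dots> = (\<integral>\<^sup>+t. \<integral>\<^sup>+x. indicator {0<..} t * indicator {x. t < f x} x \<partial>lborel \<partial>lborel)"
    by (rule lborel_pair.Fubini') (auto simp: case_prod_beta indicator_def)
  also have "\<dots> = (\<integral>\<^sup>+t. indicator {0<..} t * emeasure lborel {x. t < f x} \<partial>lborel)"
    by (simp add: nn_integral_cmult)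
  finally show ?thesis .
qed

text \<open>For \<open>0 < t < 1\<close> the superlevel set of \<open>w\<close> at \<open>t\<close> contains the weighted sum of those of \<open>U\<close> and \<open>V\<close>;
Brunn--Minkowski and integration over \<open>t\<close> give the claim. Equal suprema make both superlevel sets
nonempty for the same range of \<open>t\<close>, which is why \<open>U\<close> and \<open>V\<close> are normalized.\<close>
lemma prekopa_leindler_normalized:
  fixes U V w :: "real \<Rightarrow> real"
  assumes [measurable]: "U \<in> borel_measurable borel" "V \<in> borel_measurable borel" "w \<in> borel_measurable borel"
    and nn: "\<And>x. 0 \<le> U x" "\<And>x. 0 \<le> V x" "\<And>x. 0 \<le> w x"
    and le1: "\<And>x. U x \<le> 1" "\<And>x. V x \<le> 1"
    and sup1: "\<And>t. t < 1 \<Longrightarrow> \<exists>x. t < U x" "\<And>t. t < 1 \<Longrightarrow> \<exists>x. t < V x"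
    and s: "0 < s" "s < 1"
    and le: "\<And>x y. U x powr s * V y powr (1 - s) \<le> w (s * x + (1 - s) * y)"
  shows "ennreal s * (\<integral>\<^sup>+x. U x \<partial>lborel) + ennreal (1 - s) * (\<integral>\<^sup>+x. V x \<partial>lborel) \<le> (\<integral>\<^sup>+x. w x \<partial>lborel)"
proof -
  have level: "ennreal s * emeasure lborel {x. t < U x} + ennreal (1 - s) * emeasure lborel {x. t < V x}
      \<le> emeasure lborel {x. t < w x}" if "0 < t" for t
  proof (cases "t < 1")
    case True
    have "emeasure lborel {x. x / s \<in> {x. t < U x}} + emeasure lborel {x. x / (1 - s) \<in> {x. t < V x}}
      \<le> emeasure lborel {x. t < w x}"
    proof (rule brunn_minkowski_real)
      obtain x y where "t < U x" "t < V y" using sup1 True by blast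
      then have "s * x \<in> {x. x / s \<in> {x. t < U x}}" "(1 - s) * y \<in> {x. x / (1 - s) \<in> {x. t < V x}}"
        using s by auto
      then show "{x. x / s \<in> {x. t < U x}} \<noteq> {}" "{x. x / (1 - s) \<in> {x. t < V x}} \<noteq> {}" by blast+
      show "x + y \<in> {x. t < w x}" if "x \<in> {x. x / s \<in> {x. t < U x}}" "y \<in> {x. x / (1 - s) \<in> {x. t < V x}}" for x y
      proof -
        have "t = t powr s * t powr (1 - s)"
          using \<open>0 < t\<close> by (simp flip: powr_add)
        also have "\<dots> < U (x / s) powr s * V (y / (1 - s)) powr (1 - s)"
          using that \<open>0 < t\<close> s nn by (intro mult_strict_mono powr_less_mono2) auto
        also have "\<dots> \<le> w (s * (x / s) + (1 - s) * (y / (1 - s)))" by (rule le)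
        also have "s * (x / s) + (1 - s) * (y / (1 - s)) = x + y" using s by simp
        finally show ?thesis by simp
      qed
    qed (use s in measurable)
    then show ?thesis
      using s by (subst (asm) (1 2) emeasure_lborel_dilate) auto
  next
    case False
    then have "{x. t < U x} = {}" "{x. t < V x} = {}"
      using le1 by (auto simp: not_less) (meson order_trans not_less)+
    then show ?thesis by simp
  qed
  have "ennreal s * (\<integral>\<^sup>+x. U x \<partial>lborel) + ennreal (1 - s) * (\<integral>\<^sup>+x. V x \<partial>lborel)
     = (\<integral>\<^sup>+t. ennreal s * (indicator {0<..} t * emeasure lborel {x. t < U x})
             + ennreal (1 - s) * (indicator {0<..} t * emeasure lborel {x. t < V x}) \<partial>lborel)"
    using nn by (simp add: nn_integral_layer_cake nn_integral_add nn_integral_cmult)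
  also have "\<dots> \<le> (\<integral>\<^sup>+t. indicator {0<..} t * emeasure lborel {x. t < w x} \<partial>lborel)"
    using level by (intro nn_integral_mono) (auto simp: indicator_def)
  also have "\<dots> = (\<integral>\<^sup>+x. w x \<partial>lborel)"
    using nn by (simp add: nn_integral_layer_cake)
  finally show ?thesis .
qed

section \<open>Concentration of Lipschitz functions of Gaussian vectors\<close>

definition std_gauss :: "real measure" where
  "std_gauss = density lborel (\<lambda>x. ennreal (std_normal_density x))"

lemma sets_std_gauss[measurable_cong]: "sets std_gauss = sets borel"
  and space_std_gauss[simp]: "space std_gauss = UNIV"
  by (simp_all add: std_gauss_def)

lemma prob_space_std_gauss: "prob_space std_gauss"
  unfolding std_gauss_def by (rule prob_space_normal_density) simp

lemma integral_std_gauss: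
  fixes f :: "real \<Rightarrow> real"
  assumes [measurable]: "f \<in> borel_measurable borel"
  shows "integral\<^sup>L std_gauss f = (\<integral>x. std_normal_density x * f x \<partial>lborel)"
  unfolding std_gauss_def by (subst integral_density) auto

text \<open>Strong log-concavity of the Gaussian density, as an identity: the exponential is the exact defect in
concavity of \<open>- x\<^sup>2 / 2\<close>.\<close>
lemma std_normal_density_combination:
  fixes s :: real
  shows "std_normal_density x powr s * std_normal_density y powr (1 - s) * exp (s * (1 - s) / 2 * (x - y)\<^sup>2)
    = std_normal_density (s * x + (1 - s) * y)"
proof -
  have 1: "(1 / sqrt (2 * pi)) powr s * (1 / sqrt (2 * pi)) powr (1 - s) = 1 / sqrt (2 * pi)"
    by (simp flip: powr_add)
  have 2: "exp (- x\<^sup>2 / 2) powr s * exp (- y\<^sup>2 / 2) powr (1 - s) * exp (s * (1 - s) / 2 * (x - y)\<^sup>2)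
     = exp (- (s * x + (1 - s) * y)\<^sup>2 / 2)"
    by (simp add: powr_def exp_add[symmetric] del: exp_add) (simp add: field_simps power2_eq_square)
  have "(k * a) powr s * (k * b) powr (1 - s) * e = (k powr s * k powr (1 - s)) * (a powr s * b powr (1 - s) * e)"
    if "k \<ge> 0" "a \<ge> 0" "b \<ge> 0" for k a b e :: real
    using that by (simp add: powr_mult)
  note combine = this[of "1 / sqrt (2 * pi)" "exp (- x\<^sup>2 / 2)" "exp (- y\<^sup>2 / 2)" "exp (s * (1 - s) / 2 * (x - y)\<^sup>2)"]
  show ?thesis
    unfolding std_normal_density_def by (subst combine, simp, simp, simp, simp only: 1 2)
qed

text \<open>Apply the Prekopa--Leindler inequality to the densities \<open>u \<phi>\<close> and \<open>v \<phi>\<close>, divided by their suprema,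
and a multiple of \<open>\<phi>\<close>; the weighted arithmetic-geometric mean inequality turns the resulting sum into a
product and removes the suprema again. The factor \<open>C\<close> carries the contribution of the other coordinates
when the inequality is extended to products. Boundedness by \<open>K\<close> keeps all integrals and suprema finite.\<close>
lemma gauss_prekopa_1d:
  fixes u v :: "real \<Rightarrow> real"
  assumes [measurable]: "u \<in> borel_measurable borel" "v \<in> borel_measurable borel"
    and u: "\<And>x. 0 \<le> u x" "\<And>x. u x \<le> K" and v: "\<And>x. 0 \<le> v x" "\<And>x. v x \<le> K"
    and s: "0 < s" "s < 1" and C: "0 < C"
    and le: "\<And>x y. u x powr s * v y powr (1 - s) \<le> C * exp (s * (1 - s) / 2 * (x - y)\<^sup>2)"
  shows "(\<integral>x. u x \<partial>std_gauss) powr s * (\<integral>x. v x \<partial>std_gauss) powr (1 - s) \<le> C"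
proof -
  let ?n = std_normal_density
  define I where "I f = (\<integral>x. f x \<partial>std_gauss)" for f :: "real \<Rightarrow> real"
  have n_le: "?n x \<le> 1" for x
  proof -
    have "1 \<le> sqrt (2 * pi)" using pi_ge_two by simp
    then have "1 / sqrt (2 * pi) * exp (- x\<^sup>2 / 2) \<le> 1 * 1"
      by (intro mult_mono) auto
    then show ?thesis by (simp add: std_normal_density_def)
  qed
  have K: "0 \<le> K" using u order_trans by blast
  have nf: "0 \<le> ?n x * f x" "?n x * f x \<le> K" if "f x \<ge> 0" "f x \<le> K" for f :: "real \<Rightarrow> real" and x
    using that n_le[of x] K mult_mono[of "?n x" 1 "f x" K] by auto
  have facts: "I f \<ge> 0 \<and> (\<forall>x. ?n x * f x \<le> (SUP x. ?n x * f x)) \<and> (SUP x. ?n x * f x) \<ge> 0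
      \<and> ((SUP x. ?n x * f x) = 0 \<longrightarrow> I f = 0)
      \<and> ((SUP x. ?n x * f x) > 0 \<longrightarrow>
          (\<integral>\<^sup>+x. ennreal (?n x * f x / (SUP x. ?n x * f x)) \<partial>lborel) = ennreal (I f / (SUP x. ?n x * f x)))"
    if [measurable]: "f \<in> borel_measurable borel" and f: "\<And>x. 0 \<le> f x" "\<And>x. f x \<le> K" for f
  proof -
    let ?M = "SUP x. ?n x * f x"
    have bdd: "bdd_above (range (\<lambda>x. ?n x * f x))"
      using nf(2)[of f] f by (intro bdd_aboveI[of _ K]) auto
    have 1: "?n x * f x \<le> ?M" for x by (rule cSUP_upper[OF _ bdd]) simp
    have 2: "?M \<ge> 0" using 1[of 0] nf(1)[of f 0] f by (meson order_trans)
    have If: "I f = (\<integral>x. ?n x * f x \<partial>lborel)" unfolding I_def by (rule integral_std_gauss) simp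
    have int: "integrable lborel (\<lambda>x. ?n x * f x)"
    proof (rule Bochner_Integration.integrable_bound)
      show "integrable lborel (\<lambda>x. ?n x * K)" by simp
      show "AE x in lborel. norm (?n x * f x) \<le> norm (?n x * K)"
        using f K by (auto simp: abs_mult intro!: AE_I2 mult_left_mono)
    qed simp
    have 3: "I f \<ge> 0" unfolding I_def using f by simp
    have 4: "I f = 0" if "?M = 0"
    proof -
      have "?n x * f x = 0" for x using 1[of x] that nf(1)[of f x] f by (metis antisym)
      then have "(\<lambda>x. ?n x * f x) = (\<lambda>x. 0)" by (rule ext)
      then show ?thesis unfolding If by (metis integral_zero)
    qed
    have 5: "(\<integral>\<^sup>+x. ennreal (?n x * f x / ?M) \<partial>lborel) = ennreal (I f / ?M)" if "?M > 0"
      using int f that by (subst nn_integral_eq_integral) (auto simp: If intro!: AE_I2 divide_nonneg_nonneg mult_nonneg_nonneg)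
    show ?thesis using 1 2 3 4 5 by blast
  qed
  define M1 where "M1 = (SUP x. ?n x * u x)"
  define M2 where "M2 = (SUP x. ?n x * v x)"
  have fu: "I u \<ge> 0" "\<And>x. ?n x * u x \<le> M1" "M1 \<ge> 0" "M1 = 0 \<Longrightarrow> I u = 0"
     "M1 > 0 \<Longrightarrow> (\<integral>\<^sup>+x. ennreal (?n x * u x / M1) \<partial>lborel) = ennreal (I u / M1)"
    using facts[of u] u unfolding M1_def by auto
  have fv: "I v \<ge> 0" "\<And>x. ?n x * v x \<le> M2" "M2 \<ge> 0" "M2 = 0 \<Longrightarrow> I v = 0"
     "M2 > 0 \<Longrightarrow> (\<integral>\<^sup>+x. ennreal (?n x * v x / M2) \<partial>lborel) = ennreal (I v / M2)"
    using facts[of v] v unfolding M2_def by auto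
  show ?thesis
  proof (cases "I u = 0 \<or> I v = 0")
    case True
    then show ?thesis using C unfolding I_def by auto
  next
    case False
    then have pos: "M1 > 0" "M2 > 0" "I u > 0" "I v > 0" using fu fv by (auto simp: less_le)
    define R where "R = C / (M1 powr s * M2 powr (1 - s))"
    have R: "R > 0" using pos C by (simp add: R_def)
    have sup: "\<exists>x. t < ?n x * f x / M" if "t < 1" "M = (SUP x. ?n x * f x)" "M > 0" for f M t
    proof (rule ccontr)
      assume "\<not> ?thesis"
      then have "?n x * f x \<le> t * M" for x using that(3) by (auto simp: not_less field_simps)
      then have "M \<le> t * M" unfolding that(2) by (intro cSUP_least) auto
      then show False using that by auto
    qed
    have "ennreal s * (\<integral>\<^sup>+x. ennreal (?n x * u x / M1) \<partial>lborel) + ennreal (1 - s) * (\<integral>\<^sup>+x. ennreal (?n x * v x / M2) \<partial>lborel)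
      \<le> (\<integral>\<^sup>+x. ennreal (R * ?n x) \<partial>lborel)"
    proof (rule prekopa_leindler_normalized)
      show "t < 1 \<Longrightarrow> \<exists>x. t < ?n x * u x / M1" for t using sup[OF _ M1_def] pos by simp
      show "t < 1 \<Longrightarrow> \<exists>x. t < ?n x * v x / M2" for t using sup[OF _ M2_def] pos by simp
      fix x y
      have "(?n x * u x / M1) powr s * (?n y * v y / M2) powr (1 - s)
         = (?n x powr s * ?n y powr (1 - s)) * (u x powr s * v y powr (1 - s)) / (M1 powr s * M2 powr (1 - s))"
        using pos u v by (simp add: powr_mult powr_divide mult_ac)
      also have "\<dots> \<le> (?n x powr s * ?n y powr (1 - s)) * (C * exp (s * (1 - s) / 2 * (x - y)\<^sup>2)) / (M1 powr s * M2 powr (1 - s))"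
        by (intro divide_right_mono mult_left_mono le) auto
      also have "\<dots> = R * (?n x powr s * ?n y powr (1 - s) * exp (s * (1 - s) / 2 * (x - y)\<^sup>2))"
        by (simp add: R_def)
      also have "\<dots> = R * ?n (s * x + (1 - s) * y)" by (simp only: std_normal_density_combination)
      finally show "(?n x * u x / M1) powr s * (?n y * v y / M2) powr (1 - s) \<le> R * ?n (s * x + (1 - s) * y)" .
    qed (use pos s u v fu fv R in \<open>auto simp: divide_le_eq\<close>)
    also have "(\<integral>\<^sup>+x. ennreal (R * ?n x) \<partial>lborel) = ennreal R"
      using R by (subst nn_integral_eq_integral) auto
    moreover have lin: "ennreal (s * a + (1 - s) * b) = ennreal s * ennreal a + ennreal (1 - s) * ennreal b"
      if "0 \<le> a" "0 \<le> b" for a b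
      using that s by (simp add: ennreal_mult ennreal_plus)
    ultimately have "ennreal (s * (I u / M1) + (1 - s) * (I v / M2)) \<le> ennreal R"
      using fu(5)[OF pos(1)] fv(5)[OF pos(2)] lin[of "I u / M1" "I v / M2"] pos by simp
    then have "s * (I u / M1) + (1 - s) * (I v / M2) \<le> R" using R by (simp add: ennreal_le_iff)
    moreover have "(I u / M1) powr s * (I v / M2) powr (1 - s) \<le> s * (I u / M1) + (1 - s) * (I v / M2)"
      using pos s by (intro Youngs_inequality_0) auto
    ultimately have "(I u / M1) powr s * (I v / M2) powr (1 - s) \<le> R" by simp
    then have "I u powr s * I v powr (1 - s) \<le> C"
      using pos by (simp add: powr_divide R_def divide_le_cancel)
    then show ?thesis unfolding I_def .
  qed
qed

lemma product_sigma_finite_std_gauss: "product_sigma_finite (\<lambda>_. std_gauss)"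
  by (intro product_sigma_finite.intro prob_space_imp_sigma_finite prob_space_std_gauss)

abbreviation gauss :: "nat set \<Rightarrow> (nat \<Rightarrow> real) measure" where
  "gauss I \<equiv> PiM I (\<lambda>_. std_gauss)"

lemma prob_space_gauss: "prob_space (gauss I)"
  by (intro prob_space_PiM prob_space_std_gauss)

text \<open>The condition tensorizes: after one coordinate is integrated out with the one-dimensional case, the
marginals satisfy it in the remaining coordinates, since the squared distance is additive.\<close>
lemma gauss_prekopa:
  fixes u v :: "(nat \<Rightarrow> real) \<Rightarrow> real"
  assumes "finite I" and s: "0 < s" "s < 1"
  assumes "u \<in> borel_measurable (gauss I)" "v \<in> borel_measurable (gauss I)"
    and "\<And>x. x \<in> space (gauss I) \<Longrightarrow> 0 \<le> u x \<and> u x \<le> K" and "\<And>x. x \<in> space (gauss I) \<Longrightarrow> 0 \<le> v x \<and> v x \<le> K"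
    and "\<And>x y. x \<in> space (gauss I) \<Longrightarrow> y \<in> space (gauss I) \<Longrightarrow>
        u x powr s * v y powr (1 - s) \<le> exp (s * (1 - s) / 2 * (\<Sum>i\<in>I. (x i - y i)\<^sup>2))"
  shows "(\<integral>x. u x \<partial>gauss I) powr s * (\<integral>x. v x \<partial>gauss I) powr (1 - s) \<le> 1"
proof -
  interpret gauss_prod: product_sigma_finite "\<lambda>_::nat. std_gauss"
    by (rule product_sigma_finite_std_gauss)
  show ?thesis
    using assms(1,4-)
  proof (induction I arbitrary: u v rule: finite_induct)
    case empty
    then show ?case
      using empty.prems(5)[of "\<lambda>_. undefined" "\<lambda>_. undefined"]
      by (simp add: PiM_empty space_PiM lebesgue_integral_count_space_finite)
  next
    case (insert i I)
    note [measurable] = insert.prems(1,2)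
    interpret G: prob_space std_gauss by (rule prob_space_std_gauss)
    have upd: "x(i := t) \<in> space (gauss (insert i I))" if "x \<in> space (gauss I)" for x t
      using that by (auto simp: space_PiM PiE_def extensional_def)
    have int: "integrable (gauss (insert i I)) f"
      if [measurable]: "f \<in> borel_measurable (gauss (insert i I))"
        and "\<And>x. x \<in> space (gauss (insert i I)) \<Longrightarrow> 0 \<le> f x \<and> f x \<le> K" for f :: "_ \<Rightarrow> real"
    proof -
      interpret GI: prob_space "gauss (insert i I)" by (rule prob_space_gauss)
      show ?thesis
        by (rule GI.integrable_const_bound[where B = K]) (use that in auto)
    qed
    have fold: "(\<integral>x. f x \<partial>gauss (insert i I)) = (\<integral>x. (\<integral>t. f (x(i := t)) \<partial>std_gauss) \<partial>gauss I)"
      if "f \<in> borel_measurable (gauss (insert i I))"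
        and "\<And>x. x \<in> space (gauss (insert i I)) \<Longrightarrow> 0 \<le> f x \<and> f x \<le> K" for f :: "_ \<Rightarrow> real"
      using insert.hyps int[OF that] by (intro gauss_prod.product_integral_insert) auto
    have meas1: "(\<lambda>t. f (x(i := t))) \<in> borel_measurable borel"
      if [measurable]: "f \<in> borel_measurable (gauss (insert i I))" and x: "x \<in> space (gauss I)" for f :: "_ \<Rightarrow> real" and x
    proof -
      have "(\<lambda>t. x(i := t)) \<in> measurable borel (gauss (insert i I))"
        using x by (intro measurable_fun_upd[where J = I]) (auto intro: measurable_ident_sets sets_std_gauss[symmetric])
      then show ?thesis by (rule measurable_compose) fact
    qed
    have bd: "0 \<le> (\<integral>t. f (x(i := t)) \<partial>std_gauss) \<and> (\<integral>t. f (x(i := t)) \<partial>std_gauss) \<le> K"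
      if [measurable]: "f \<in> borel_measurable (gauss (insert i I))"
        and f: "\<And>x. x \<in> space (gauss (insert i I)) \<Longrightarrow> 0 \<le> f x \<and> f x \<le> K" and x: "x \<in> space (gauss I)" for f :: "_ \<Rightarrow> real" and x
    proof
      show "0 \<le> (\<integral>t. f (x(i := t)) \<partial>std_gauss)" using f upd[OF x] by simp
      have "integrable std_gauss (\<lambda>t. f (x(i := t)))"
        using meas1[OF that(1) x] f upd[OF x]
        by (intro G.integrable_const_bound[where B = K]) (auto simp: sets_std_gauss cong: measurable_cong_sets)
      then show "(\<integral>t. f (x(i := t)) \<partial>std_gauss) \<le> K"
        using f upd[OF x] G.integral_le_const[of "\<lambda>t. f (x(i := t))" K] by auto
    qed
    have meas2: "(\<lambda>x. \<integral>t. f (x(i := t)) \<partial>std_gauss) \<in> borel_measurable (gauss I)"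
      if [measurable]: "f \<in> borel_measurable (gauss (insert i I))" for f :: "_ \<Rightarrow> real"
      by measurable
    have fold_uv: "(\<integral>x. u x \<partial>gauss (insert i I)) = (\<integral>x. (\<integral>t. u (x(i := t)) \<partial>std_gauss) \<partial>gauss I)"
      "(\<integral>x. v x \<partial>gauss (insert i I)) = (\<integral>x. (\<integral>t. v (x(i := t)) \<partial>std_gauss) \<partial>gauss I)"
      by (rule fold, use insert.prems in auto)+
    show ?case
      unfolding fold_uv
    proof (rule insert.IH)
      fix x y assume x: "x \<in> space (gauss I)" and y: "y \<in> space (gauss I)"
      show "(\<integral>t. u (x(i := t)) \<partial>std_gauss) powr s * (\<integral>t. v (y(i := t)) \<partial>std_gauss) powr (1 - s)
        \<le> exp (s * (1 - s) / 2 * (\<Sum>i\<in>I. (x i - y i)\<^sup>2))"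
      proof (rule gauss_prekopa_1d[where K = K])
        fix t r
        have "(\<Sum>j\<in>insert i I. ((x(i := t)) j - (y(i := r)) j)\<^sup>2) = (t - r)\<^sup>2 + (\<Sum>j\<in>I. (x j - y j)\<^sup>2)"
          using insert.hyps by (simp add: sum.insert) (intro sum.cong, auto)
        then show "u (x(i := t)) powr s * v (y(i := r)) powr (1 - s)
           \<le> exp (s * (1 - s) / 2 * (\<Sum>i\<in>I. (x i - y i)\<^sup>2)) * exp (s * (1 - s) / 2 * (t - r)\<^sup>2)"
          using insert.prems(5)[OF upd[OF x, of t] upd[OF y, of r]]
          by (simp only: exp_add[symmetric] distrib_left) (simp only: add.commute)
      qed (use s in \<open>auto intro!: meas1 insert.prems(1,2) x y insert.prems(3,4)[THEN conjunct1] insert.prems(3,4)[THEN conjunct2] upd\<close>)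
    next
      show "0 \<le> (\<integral>t. u (x(i := t)) \<partial>std_gauss) \<and> (\<integral>t. u (x(i := t)) \<partial>std_gauss) \<le> K"
        if "x \<in> space (gauss I)" for x
        by (rule bd[OF insert.prems(1) _ that]) (rule insert.prems(3))
      show "0 \<le> (\<integral>t. v (x(i := t)) \<partial>std_gauss) \<and> (\<integral>t. v (x(i := t)) \<partial>std_gauss) \<le> K"
        if "x \<in> space (gauss I)" for x
        by (rule bd[OF insert.prems(2) _ that]) (rule insert.prems(4))
    qed (rule meas2, rule insert.prems)+
  qed
qed

text \<open>Truncate \<open>F\<close> at the level \<open>\<mu> + t\<close>, which does not change the event, and call the result \<open>f\<close>.
For every \<open>l > 0\<close> the functions \<open>u = exp (l f - q)\<close> and \<open>v = exp (- s l f / (1 - s))\<close> satisfy the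
hypothesis of \<open>gauss_prekopa\<close> if \<open>q = l\<^sup>2 \<sigma>\<^sup>2 / (2 (1 - s))\<close>, because \<open>f\<close> is
\<open>\<sigma>\<close>-Lipschitz. Bounding the integral of \<open>u\<close> from below by the event and that of \<open>v\<close> by
Jensen's inequality gives a Chernoff bound, which becomes sharp as the weight \<open>s\<close> tends to \<open>0\<close>.\<close>
theorem gauss_concentration:
  fixes F :: "(nat \<Rightarrow> real) \<Rightarrow> real"
  assumes I: "finite I" and F[measurable]: "F \<in> borel_measurable (gauss I)"
    and nn: "\<And>x. x \<in> space (gauss I) \<Longrightarrow> 0 \<le> F x"
    and lip: "\<And>x y. x \<in> space (gauss I) \<Longrightarrow> y \<in> space (gauss I) \<Longrightarrow> \<bar>F x - F y\<bar> \<le> \<sigma> * sqrt (\<Sum>i\<in>I. (x i - y i)\<^sup>2)"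
    and int: "integrable (gauss I) F" and mean: "(\<integral>x. F x \<partial>gauss I) \<le> \<mu>"
    and \<sigma>: "0 < \<sigma>" and t: "0 < t"
  shows "measure (gauss I) {x \<in> space (gauss I). \<mu> + t \<le> F x} \<le> exp (- (t\<^sup>2 / (2 * \<sigma>\<^sup>2)))"
proof -
  interpret G: prob_space "gauss I" by (rule prob_space_gauss)
  have "0 \<le> (\<integral>x. F x \<partial>gauss I)" by (rule integral_nonneg_AE) (use nn in auto)
  then have mu: "0 \<le> \<mu>" using mean by simp
  define c where "c = \<mu> + t"
  define f where "f x = min (F x) c" for x
  have fm[measurable]: "f \<in> borel_measurable (gauss I)" unfolding f_def by measurable
  have c: "c > 0" using mu t by (simp add: c_def)
  have f_bd: "0 \<le> f x" "f x \<le> c" if "x \<in> space (gauss I)" for x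
    using nn[OF that] c by (auto simp: f_def)
  have f_lip: "f x - f y \<le> \<sigma> * sqrt (\<Sum>i\<in>I. (x i - y i)\<^sup>2)" if "x \<in> space (gauss I)" "y \<in> space (gauss I)" for x y
    using lip[OF that] unfolding f_def by linarith
  have f_int: "integrable (gauss I) f"
    by (rule G.integrable_const_bound[where B = c]) (use f_bd in auto)
  have f_mean: "(\<integral>x. f x \<partial>gauss I) \<le> \<mu>"
  proof -
    have "(\<integral>x. f x \<partial>gauss I) \<le> (\<integral>x. F x \<partial>gauss I)"
      by (intro integral_mono f_int int) (simp add: f_def)
    then show ?thesis using mean by simp
  qed
  define P where "P = measure (gauss I) {x \<in> space (gauss I). \<mu> + t \<le> F x}"
  have bound: "P \<le> exp (- (t\<^sup>2 / (2 * \<sigma>\<^sup>2)) * (1 - s))" if s: "0 < s" "s < 1" for s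
  proof (cases "P = 0")
    case False
    then have P: "P > 0" by (simp add: P_def less_le)
    \<comment> \<open>The minimizer of the exponent \<open>l\<^sup>2 \<sigma>\<^sup>2 / (2 (1 - s)) - l t\<close> obtained below.\<close>
    define l where "l = t * (1 - s) / \<sigma>\<^sup>2"
    have l: "l > 0" using t s \<sigma> by (simp add: l_def)
    define q where "q = l\<^sup>2 * \<sigma>\<^sup>2 / (2 * (1 - s))"
    define \<kappa> where "\<kappa> = s / (1 - s) * l"
    have \<kappa>: "\<kappa> > 0" using s l by (simp add: \<kappa>_def)
    define u where "u x = exp (l * f x - q)" for x
    define v where "v x = exp (- \<kappa> * f x)" for x
    have um[measurable]: "u \<in> borel_measurable (gauss I)" "v \<in> borel_measurable (gauss I)"
      unfolding u_def v_def by measurable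
    have ub: "u x \<le> exp (l * c)" and vb: "v x \<le> 1" if "x \<in> space (gauss I)" for x
    proof -
      have "q \<ge> 0" using s by (simp add: q_def)
      moreover have "l * f x \<le> l * c" using f_bd[OF that] l by simp
      ultimately show "u x \<le> exp (l * c)" by (simp add: u_def)
      show "v x \<le> 1" using f_bd[OF that] \<kappa> by (simp add: v_def)
    qed
    have uint: "integrable (gauss I) u" "integrable (gauss I) v"
      by (rule G.integrable_const_bound[where B = "exp (l * c)"], use ub in \<open>auto simp: u_def\<close>)
        (rule G.integrable_const_bound[where B = 1], use vb in \<open>auto simp: v_def\<close>)
    have main: "(\<integral>x. u x \<partial>gauss I) powr s * (\<integral>x. v x \<partial>gauss I) powr (1 - s) \<le> 1"
    proof (rule gauss_prekopa[OF I s, where K = "exp (l * c) + 1"])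
      show "0 \<le> u x \<and> u x \<le> exp (l * c) + 1" "0 \<le> v x \<and> v x \<le> exp (l * c) + 1" if "x \<in> space (gauss I)" for x
      proof -
        have "0 \<le> u x" "0 \<le> v x" by (simp_all add: u_def v_def)
        then show "0 \<le> u x \<and> u x \<le> exp (l * c) + 1" "0 \<le> v x \<and> v x \<le> exp (l * c) + 1"
          using ub[OF that] vb[OF that] exp_gt_zero[of "l * c"] by linarith+
      qed
      fix x y assume xy: "x \<in> space (gauss I)" "y \<in> space (gauss I)"
      define D where "D = sqrt (\<Sum>i\<in>I. (x i - y i)\<^sup>2)"
      have D2: "(\<Sum>i\<in>I. (x i - y i)\<^sup>2) = D\<^sup>2" unfolding D_def by (simp add: sum_nonneg)
      have "u x powr s * v y powr (1 - s) = exp (s * (l * (f x - f y)) - s * q)"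
        using s by (simp add: u_def v_def \<kappa>_def powr_def exp_add[symmetric] del: exp_add) (simp add: field_simps)
      also have "\<dots> \<le> exp (s * (l * (\<sigma> * D)) - s * q)"
        using f_lip[OF xy] s l unfolding D_def by simp
      also have "s * (l * (\<sigma> * D)) - s * q \<le> s * (1 - s) / 2 * D\<^sup>2"
      proof -
        have "s * (1 - s) / 2 * D\<^sup>2 - (s * (l * (\<sigma> * D)) - s * q) = s / (2 * (1 - s)) * ((1 - s) * D - l * \<sigma>)\<^sup>2"
          using s by (simp add: q_def field_simps power2_eq_square)
        also have "\<dots> \<ge> 0" using s by simp
        finally show ?thesis by simp
      qed
      finally show "u x powr s * v y powr (1 - s) \<le> exp (s * (1 - s) / 2 * (\<Sum>i\<in>I. (x i - y i)\<^sup>2))"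
        unfolding D2 by simp
    qed auto
    have u_ge: "exp (l * c - q) * P \<le> (\<integral>x. u x \<partial>gauss I)"
    proof -
      have "exp (l * c - q) * P = (\<integral>x. exp (l * c - q) * indicator {x \<in> space (gauss I). c \<le> F x} x \<partial>gauss I)"
        unfolding P_def c_def by simp
      also have "\<dots> \<le> (\<integral>x. u x \<partial>gauss I)"
      proof (intro integral_mono uint)
        show "integrable (gauss I) (\<lambda>x. exp (l * c - q) * indicator {x \<in> space (gauss I). c \<le> F x} x)"
          by (rule G.integrable_const_bound[where B = "exp (l * c - q)"]) (auto simp: indicator_def)
      qed (auto simp: u_def f_def indicator_def)
      finally show ?thesis .
    qed
    \<comment> \<open>Jensen's inequality, through the tangent of the exponential at \<open>- \<kappa> \<mu>\<close>.\<close>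
    have v_ge: "exp (- \<kappa> * \<mu>) \<le> (\<integral>x. v x \<partial>gauss I)"
    proof -
      have "exp (- \<kappa> * \<mu>) \<le> exp (- \<kappa> * \<mu>) * (1 + (- \<kappa>) * ((\<integral>x. f x \<partial>gauss I) - \<mu>))"
        using f_mean \<kappa> by (simp add: mult_nonneg_nonpos)
      also have "\<dots> = (\<integral>x. exp (- \<kappa> * \<mu>) * (1 + (- \<kappa>) * (f x - \<mu>)) \<partial>gauss I)"
        using f_int by (simp add: G.prob_space algebra_simps)
      also have "\<dots> \<le> (\<integral>x. v x \<partial>gauss I)"
      proof (intro integral_mono uint)
        show "integrable (gauss I) (\<lambda>x. exp (- \<kappa> * \<mu>) * (1 + (- \<kappa>) * (f x - \<mu>)))"
          using f_int by simp
        fix x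
        have "exp (- \<kappa> * \<mu>) * (1 + (- \<kappa>) * (f x - \<mu>)) \<le> exp (- \<kappa> * \<mu>) * exp ((- \<kappa>) * (f x - \<mu>))"
          by (intro mult_left_mono exp_ge_add_one_self) auto
        also have "\<dots> = v x" by (simp add: v_def exp_add[symmetric] algebra_simps del: exp_add)
        finally show "exp (- \<kappa> * \<mu>) * (1 + (- \<kappa>) * (f x - \<mu>)) \<le> v x" .
      qed
      finally show ?thesis .
    qed
    have "(exp (l * c - q) * P) powr s * exp (- \<kappa> * \<mu>) powr (1 - s) \<le> 1"
    proof -
      have "(exp (l * c - q) * P) powr s * exp (- \<kappa> * \<mu>) powr (1 - s)
        \<le> (\<integral>x. u x \<partial>gauss I) powr s * (\<integral>x. v x \<partial>gauss I) powr (1 - s)"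
        using u_ge v_ge P s by (intro mult_mono powr_mono2) auto
      then show ?thesis using main by simp
    qed
    also have "(exp (l * c - q) * P) powr s * exp (- \<kappa> * \<mu>) powr (1 - s)
        = exp (s * (l * c - q + ln P) - (1 - s) * (\<kappa> * \<mu>))"
      using P by (simp add: powr_def exp_add[symmetric] ln_mult algebra_simps del: exp_add)
    also have "(1 - s) * (\<kappa> * \<mu>) = s * (l * \<mu>)" using s by (simp add: \<kappa>_def)
    finally have "s * (l * c - q + ln P - l * \<mu>) \<le> 0" by (simp add: algebra_simps)
    then have "l * c - q + ln P - l * \<mu> \<le> 0" using s by (simp add: mult_le_0_iff)
    then have "ln P \<le> q - l * t" by (simp add: c_def algebra_simps)
    also have "q - l * t = - (t\<^sup>2 / (2 * \<sigma>\<^sup>2)) * (1 - s)"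
      using s \<sigma> by (simp add: q_def l_def field_simps power2_eq_square)
    finally show ?thesis using P by (metis exp_le_cancel_iff exp_ln)
  qed simp
  have "((\<lambda>s. exp (- (t\<^sup>2 / (2 * \<sigma>\<^sup>2)) * (1 - s))) \<longlongrightarrow> exp (- (t\<^sup>2 / (2 * \<sigma>\<^sup>2)) * (1 - 0))) (at_right (0::real))"
    by (intro tendsto_intros)
  moreover have "\<forall>\<^sub>F s in at_right (0::real). P \<le> exp (- (t\<^sup>2 / (2 * \<sigma>\<^sup>2)) * (1 - s))"
    using bound by (auto simp: eventually_at_right_field intro!: exI[of _ 1])
  ultimately have "P \<le> exp (- (t\<^sup>2 / (2 * \<sigma>\<^sup>2)) * (1 - 0))"
    by (intro tendsto_lowerbound) auto
  then show ?thesis by (simp add: P_def)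
qed

section \<open>The variation norm on a finite grid\<close>

lemma powr_convex_nonneg:
  fixes x y :: real
  assumes p: "p \<ge> 1" and x: "0 \<le> x" and y: "0 \<le> y" and l: "0 \<le> l" "l \<le> 1"
  shows "(l * x + (1 - l) * y) powr p \<le> l * x powr p + (1 - l) * y powr p"
proof -
  have scale: "(c * z) powr p \<le> c * z powr p" if "0 \<le> c" "c \<le> 1" "0 \<le> z" for c z :: real
  proof -
    have "c powr p \<le> c"
      using that p powr_mono'[of 1 p c] by auto
    then show ?thesis using that by (simp add: powr_mult mult_right_mono)
  qed
  show ?thesis
  proof (cases "x = 0 \<or> y = 0")
    case True
    then show ?thesis using scale[of l x] scale[of "1 - l" y] x y l p by auto
  next
    case False
    then show ?thesis
      using convex_onD[OF powr_convex[OF p], of "1 - l" x y] x y l by auto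
  qed
qed

lemma powr_diff_le:
  fixes x y :: real
  assumes "p \<ge> 1"
  shows "\<bar>x - y\<bar> powr p \<le> 2 powr (p - 1) * (\<bar>x\<bar> powr p + \<bar>y\<bar> powr p)"
proof -
  have "\<bar>x - y\<bar> powr p \<le> (2 * (1/2 * \<bar>x\<bar> + (1 - 1/2) * \<bar>y\<bar>)) powr p"
    using assms by (intro powr_mono2) auto
  also have "\<dots> = 2 powr p * (1/2 * \<bar>x\<bar> + (1 - 1/2) * \<bar>y\<bar>) powr p"
    by (rule powr_mult)
  also have "\<dots> \<le> 2 powr p * (1/2 * \<bar>x\<bar> powr p + (1 - 1/2) * \<bar>y\<bar> powr p)"
    using assms by (intro mult_left_mono powr_convex_nonneg) auto
  finally show ?thesis by (simp add: powr_diff field_simps)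
qed

text \<open>After division by \<open>A + B\<close>, the sum is a convex combination of two vectors of norm one, so the claim is
convexity of the \<open>p\<close>-th power.\<close>
lemma minkowski_sum:
  fixes a b :: "'i \<Rightarrow> real"
  assumes p: "p \<ge> 1" and fin: "finite I"
  shows "(\<Sum>i\<in>I. \<bar>a i + b i\<bar> powr p) powr (1/p)
    \<le> (\<Sum>i\<in>I. \<bar>a i\<bar> powr p) powr (1/p) + (\<Sum>i\<in>I. \<bar>b i\<bar> powr p) powr (1/p)"
proof -
  define A where "A = (\<Sum>i\<in>I. \<bar>a i\<bar> powr p) powr (1/p)"
  define B where "B = (\<Sum>i\<in>I. \<bar>b i\<bar> powr p) powr (1/p)"
  have Ap: "A powr p = (\<Sum>i\<in>I. \<bar>a i\<bar> powr p)" and Bp: "B powr p = (\<Sum>i\<in>I. \<bar>b i\<bar> powr p)"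
    using p by (auto simp: A_def B_def powr_powr sum_nonneg)
  have zero: "\<forall>i\<in>I. z i = 0" if "(\<Sum>i\<in>I. \<bar>z i\<bar> powr p) powr (1/p) = 0" for z :: "'i \<Rightarrow> real"
    using that fin by (simp add: sum_nonneg_eq_0_iff)
  show ?thesis
  proof (cases "A = 0 \<or> B = 0")
    case True
    then consider "\<forall>i\<in>I. a i = 0" | "\<forall>i\<in>I. b i = 0"
      using zero[of a] zero[of b] unfolding A_def B_def by blast
    then show ?thesis by cases auto
  next
    case False
    then have pos: "A > 0" "B > 0" by (auto simp: A_def B_def less_le)
    define l where "l = A / (A + B)"
    have l: "0 \<le> l" "l \<le> 1" "1 - l = B / (A + B)" using pos by (auto simp: l_def field_simps)
    have le: "\<bar>a i + b i\<bar> powr p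
       \<le> (A + B) powr p * (l * (\<bar>a i\<bar> powr p / A powr p) + (1 - l) * (\<bar>b i\<bar> powr p / B powr p))" for i
    proof -
      have eq: "(A + B) * (l * (\<bar>a i\<bar> / A) + (1 - l) * (\<bar>b i\<bar> / B)) = \<bar>a i\<bar> + \<bar>b i\<bar>"
        unfolding l(3) unfolding l_def using pos by (simp add: distrib_left)
      have "\<bar>a i + b i\<bar> powr p \<le> ((A + B) * (l * (\<bar>a i\<bar> / A) + (1 - l) * (\<bar>b i\<bar> / B))) powr p"
        unfolding eq using p by (intro powr_mono2) auto
      also have "\<dots> = (A + B) powr p * (l * (\<bar>a i\<bar> / A) + (1 - l) * (\<bar>b i\<bar> / B)) powr p"
        by (rule powr_mult)
      also have "\<dots> \<le> (A + B) powr p * (l * (\<bar>a i\<bar> / A) powr p + (1 - l) * (\<bar>b i\<bar> / B) powr p)"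
        using pos l p by (intro mult_left_mono powr_convex_nonneg) auto
      finally show ?thesis using pos by (simp add: powr_divide)
    qed
    have "(\<Sum>i\<in>I. \<bar>a i + b i\<bar> powr p)
        \<le> (\<Sum>i\<in>I. (A + B) powr p * (l * (\<bar>a i\<bar> powr p / A powr p) + (1 - l) * (\<bar>b i\<bar> powr p / B powr p)))"
      by (intro sum_mono le)
    also have "\<dots> = (A + B) powr p * (l * ((\<Sum>i\<in>I. \<bar>a i\<bar> powr p) / A powr p) + (1 - l) * ((\<Sum>i\<in>I. \<bar>b i\<bar> powr p) / B powr p))"
      by (simp only: sum_distrib_left[symmetric] sum.distrib sum_divide_distrib[symmetric])
    also have "\<dots> = (A + B) powr p" using pos by (simp flip: Ap Bp)
    finally have "(\<Sum>i\<in>I. \<bar>a i + b i\<bar> powr p) powr (1/p) \<le> ((A + B) powr p) powr (1/p)"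
      using p by (intro powr_mono2) (auto intro: sum_nonneg)
    then show ?thesis using pos p by (simp add: powr_powr A_def B_def)
  qed
qed

lemma sum_powr_le_sum_squares:
  fixes z :: "nat \<Rightarrow> real"
  assumes p: "p \<ge> 2"
  shows "(\<Sum>i<n. \<bar>z i\<bar> powr p) powr (1 / p) \<le> sqrt (\<Sum>i<n. (z i)\<^sup>2)"
proof -
  let ?S = "\<Sum>i<n. (z i)\<^sup>2"
  have S0: "0 \<le> ?S" by (intro sum_nonneg) auto
  have "(\<Sum>i<n. \<bar>z i\<bar> powr p) \<le> (\<Sum>i<n. (z i)\<^sup>2 * ?S powr (p / 2 - 1))"
  proof (intro sum_mono)
    fix i assume i: "i \<in> {..<n}"
    have "(z i)\<^sup>2 \<le> ?S" using i by (intro member_le_sum) auto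
    then have le: "((z i)\<^sup>2) powr (p / 2 - 1) \<le> ?S powr (p / 2 - 1)" using p by (intro powr_mono2) auto
    have "\<bar>z i\<bar> powr p = (z i)\<^sup>2 * ((z i)\<^sup>2) powr (p / 2 - 1)"
    proof (cases "z i = 0")
      case False
      then have sq: "(z i)\<^sup>2 = \<bar>z i\<bar> powr 2" by simp
      have "\<bar>z i\<bar> powr p = \<bar>z i\<bar> powr (2 + 2 * (p / 2 - 1))" by simp
      also have "\<dots> = \<bar>z i\<bar> powr 2 * (\<bar>z i\<bar> powr 2) powr (p / 2 - 1)"
        by (simp only: powr_add powr_powr)
      finally show ?thesis by (simp only: sq)
    qed (use p in simp)
    then show "\<bar>z i\<bar> powr p \<le> (z i)\<^sup>2 * ?S powr (p / 2 - 1)"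
      using le by (simp add: mult_left_mono)
  qed
  also have "\<dots> = ?S * ?S powr (p / 2 - 1)" by (simp add: sum_distrib_right)
  also have "\<dots> = ?S powr (p / 2)"
    using S0 by (cases "?S = 0") (auto simp: powr_diff)
  finally have "(\<Sum>i<n. \<bar>z i\<bar> powr p) powr (1 / p) \<le> (?S powr (p / 2)) powr (1 / p)"
    using p by (intro powr_mono2) (auto intro: sum_nonneg)
  also have "\<dots> = sqrt ?S" using p S0 by (simp add: powr_powr powr_half_sqrt)
  finally show ?thesis .
qed

definition var_sum :: "real \<Rightarrow> (real \<Rightarrow> real) \<Rightarrow> nat \<times> (nat \<Rightarrow> real) \<Rightarrow> real" where
  "var_sum p g = (\<lambda>(n, t). \<Sum>i<n. \<bar>g (t (Suc i)) - g (t i)\<bar> powr p)"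

text \<open>Extensionality outside \<open>{..n}\<close> makes the set of dissections with points in a finite grid finite, so that
suprema over it are attained and measurable.\<close>
definition grid_dissections :: "real \<Rightarrow> real \<Rightarrow> real set \<Rightarrow> (nat \<times> (nat \<Rightarrow> real)) set" where
  "grid_dissections a b D = {(n, t) \<in> dissections a b. t \<in> {..n} \<rightarrow>\<^sub>E D}"

definition grid_variation :: "real \<Rightarrow> real \<Rightarrow> real \<Rightarrow> real set \<Rightarrow> (real \<Rightarrow> real) \<Rightarrow> real" where
  "grid_variation p a b D g = (SUP d\<in>grid_dissections a b D. var_sum p g d powr (1 / p))"

definition grid_norm :: "real \<Rightarrow> real \<Rightarrow> real \<Rightarrow> real set \<Rightarrow> (real \<Rightarrow> real) \<Rightarrow> real" where
  "grid_norm p a b D g = grid_variation p a b D g + (SUP u\<in>D. \<bar>g u\<bar>)"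

lemma dissection_less:
  assumes "(n, t) \<in> dissections a b" "i < j" "j \<le> n"
  shows "t i < t j"
  using assms(2,3)
proof (induction j)
  case (Suc j)
  have "t j < t (Suc j)" using assms(1) Suc.prems by (auto simp: dissections_def)
  then show ?case using Suc by (cases "i = j") auto
qed simp

lemma dissection_mem:
  assumes "(n, t) \<in> dissections a b" "i \<le> n"
  shows "a \<le> t i" "t i \<le> b"
proof -
  have "t 0 = a" "t n = b" using assms(1) by (auto simp: dissections_def)
  then show "a \<le> t i" "t i \<le> b"
    using dissection_less[OF assms(1), of 0 i] dissection_less[OF assms(1), of i n] assms(2)
    by (cases "i = 0"; cases "i = n"; force)+
qed

lemma grid_dissections_D:
  assumes "(n, t) \<in> grid_dissections a b D"
  shows "(n, t) \<in> dissections a b" "\<And>i. i \<le> n \<Longrightarrow> t i \<in> D" "\<And>i. i < n \<Longrightarrow> t i < t (Suc i)"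
  using assms by (auto simp: grid_dissections_def dissections_def)

lemma finite_grid_dissections:
  assumes "finite D"
  shows "finite (grid_dissections a b D)"
proof (rule finite_subset)
  show "finite (SIGMA n:{..card D}. {..n} \<rightarrow>\<^sub>E D)" using assms by (auto intro!: finite_SigmaI finite_PiE)
  show "grid_dissections a b D \<subseteq> (SIGMA n:{..card D}. {..n} \<rightarrow>\<^sub>E D)"
  proof
    fix d assume "d \<in> grid_dissections a b D"
    then obtain n t where d: "d = (n, t)" and nt: "(n, t) \<in> grid_dissections a b D" by (cases d) auto
    have "inj_on t {..n}"
      by (rule linorder_inj_onI) (use dissection_less[OF grid_dissections_D(1)[OF nt]] in force)+
    then have "card {..n} \<le> card D"
      using grid_dissections_D(2)[OF nt] assms by (intro card_inj_on_le[of t]) auto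
    then show "d \<in> (SIGMA n:{..card D}. {..n} \<rightarrow>\<^sub>E D)" using nt by (auto simp: d grid_dissections_def)
  qed
qed

lemma grid_dissections_nonempty:
  assumes "a < b" "a \<in> D" "b \<in> D"
  shows "grid_dissections a b D \<noteq> {}"
proof -
  have "(1, \<lambda>i. if i = 0 then a else if i = 1 then b else undefined) \<in> grid_dissections a b D"
    using assms by (auto simp: grid_dissections_def dissections_def PiE_def extensional_def)
  then show ?thesis by blast
qed

lemma var_sum_nonneg: "0 \<le> var_sum p g d"
  by (auto simp: var_sum_def intro: sum_nonneg split: prod.split)

locale grid =
  fixes a b :: real and D :: "real set"
  assumes fin: "finite D" and ab: "a < b" and ends: "a \<in> D" "b \<in> D"
begin

lemma variation_le:
  assumes "\<And>n t. (n, t) \<in> grid_dissections a b D \<Longrightarrow> var_sum p g (n, t) powr (1 / p) \<le> A"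
  shows "grid_variation p a b D g \<le> A"
  unfolding grid_variation_def using assms grid_dissections_nonempty[OF ab ends]
  by (intro cSUP_least) auto

lemma variation_ge:
  assumes "(n, t) \<in> grid_dissections a b D"
  shows "var_sum p g (n, t) powr (1 / p) \<le> grid_variation p a b D g"
  unfolding grid_variation_def using assms finite_grid_dissections[OF fin]
  by (intro cSUP_upper) auto

lemma norm_le:
  assumes "\<And>n t. (n, t) \<in> grid_dissections a b D \<Longrightarrow> var_sum p g (n, t) powr (1 / p) \<le> A"
    and "\<And>u. u \<in> D \<Longrightarrow> \<bar>g u\<bar> \<le> B"
  shows "grid_norm p a b D g \<le> A + B"
  unfolding grid_norm_def
  using variation_le[of p g A] assms ends by (intro add_mono cSUP_least) auto

lemma abs_le_Sup:
  fixes g :: "real \<Rightarrow> real"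
  shows "u \<in> D \<Longrightarrow> \<bar>g u\<bar> \<le> (SUP u\<in>D. \<bar>g u\<bar>)"
  using fin by (intro cSUP_upper) auto

lemma variation_nonneg: "0 \<le> grid_variation p a b D g"
proof -
  obtain n t where nt: "(n, t) \<in> grid_dissections a b D"
    using grid_dissections_nonempty[OF ab ends] by auto
  show ?thesis using variation_ge[OF nt, of p g] by (meson order_trans powr_ge_zero)
qed

lemma norm_nonneg: "0 \<le> grid_norm p a b D g"
  unfolding grid_norm_def
  using variation_nonneg[of p g] abs_le_Sup[OF ends(1), of g] by linarith

lemma variation_triangle:
  assumes p: "p \<ge> 1"
  shows "grid_variation p a b D (\<lambda>u. g u + h u) \<le> grid_variation p a b D g + grid_variation p a b D h"
proof (rule variation_le)
  fix n t assume nt: "(n, t) \<in> grid_dissections a b D"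
  have "var_sum p (\<lambda>u. g u + h u) (n, t) powr (1 / p)
     = (\<Sum>i<n. \<bar>(g (t (Suc i)) - g (t i)) + (h (t (Suc i)) - h (t i))\<bar> powr p) powr (1 / p)"
    by (simp add: var_sum_def algebra_simps)
  also have "\<dots> \<le> var_sum p g (n, t) powr (1 / p) + var_sum p h (n, t) powr (1 / p)"
    unfolding var_sum_def prod.case using p by (intro minkowski_sum) auto
  also have "\<dots> \<le> grid_variation p a b D g + grid_variation p a b D h"
    by (intro add_mono variation_ge nt)
  finally show "var_sum p (\<lambda>u. g u + h u) (n, t) powr (1 / p)
    \<le> grid_variation p a b D g + grid_variation p a b D h" .
qed

lemma variation_minus: "grid_variation p a b D (\<lambda>u. - g u) = grid_variation p a b D g"
proof -
  have "var_sum p (\<lambda>u. - g u) d = var_sum p g d" for d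
    by (cases d) (simp add: var_sum_def abs_minus_commute)
  then show ?thesis by (simp add: grid_variation_def)
qed

lemma norm_triangle:
  assumes p: "p \<ge> 1"
  shows "grid_norm p a b D (\<lambda>u. g u + h u) \<le> grid_norm p a b D g + grid_norm p a b D h"
proof -
  have "(SUP u\<in>D. \<bar>g u + h u\<bar>) \<le> (SUP u\<in>D. \<bar>g u\<bar>) + (SUP u\<in>D. \<bar>h u\<bar>)"
  proof (rule cSUP_least)
    fix u assume "u \<in> D"
    then show "\<bar>g u + h u\<bar> \<le> (SUP u\<in>D. \<bar>g u\<bar>) + (SUP u\<in>D. \<bar>h u\<bar>)"
      using abs_le_Sup[of u g] abs_le_Sup[of u h] by linarith
  qed (use ends in auto)
  then show ?thesis using variation_triangle[OF p, of g h] by (simp add: grid_norm_def)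
qed

lemma norm_cong:
  assumes "\<And>u. u \<in> D \<Longrightarrow> g u = h u"
  shows "grid_norm p a b D g = grid_norm p a b D h"
proof -
  have "var_sum p g d = var_sum p h d" if "d \<in> grid_dissections a b D" for d
    using that assms grid_dissections_D(2) by (cases d) (force simp: var_sum_def intro!: sum.cong)
  then have "grid_variation p a b D g = grid_variation p a b D h"
    unfolding grid_variation_def by (intro SUP_cong) auto
  moreover have "(SUP u\<in>D. \<bar>g u\<bar>) = (SUP u\<in>D. \<bar>h u\<bar>)" using assms by (intro SUP_cong) auto
  ultimately show ?thesis by (simp add: grid_norm_def)
qed

lemma norm_minus: "grid_norm p a b D (\<lambda>u. - g u) = grid_norm p a b D g"
  by (simp add: grid_norm_def variation_minus)

lemma norm_diff_le:
  assumes p: "p \<ge> 1"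
  shows "\<bar>grid_norm p a b D g - grid_norm p a b D h\<bar> \<le> grid_norm p a b D (\<lambda>u. g u - h u)"
proof -
  have "grid_norm p a b D g \<le> grid_norm p a b D h + grid_norm p a b D (\<lambda>u. g u - h u)"
    using norm_triangle[OF p, of h "\<lambda>u. g u - h u"] by simp
  moreover have "grid_norm p a b D h \<le> grid_norm p a b D g + grid_norm p a b D (\<lambda>u. g u - h u)"
    using norm_triangle[OF p, of g "\<lambda>u. - (g u - h u)"] norm_minus[of p "\<lambda>u. g u - h u"] by simp
  ultimately show ?thesis by linarith
qed

text \<open>The values \<open>v k\<close> are taken on consecutive blocks of the grid. Along a dissection each block is left at most once
and entered at most once, so after the jumps are split each \<open>\<bar>v k\<bar> powr p\<close> is used at most twice. This
bounds the variation by twice the \<open>\<ell>\<^sup>p\<close>-norm; the supremum adds one more.\<close>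
lemma norm_step_function:
  fixes q :: "real \<Rightarrow> nat" and v :: "nat \<Rightarrow> real"
  assumes p: "p \<ge> 1" and mono: "\<And>x y. x \<in> D \<Longrightarrow> y \<in> D \<Longrightarrow> x \<le> y \<Longrightarrow> q x \<le> q y"
    and qM: "\<And>x. x \<in> D \<Longrightarrow> q x \<le> M"
  shows "grid_norm p a b D (\<lambda>u. v (q u)) \<le> 3 * (\<Sum>k\<le>M. \<bar>v k\<bar> powr p) powr (1 / p)"
proof -
  let ?S = "\<Sum>k\<le>M. \<bar>v k\<bar> powr p"
  have S0: "0 \<le> ?S" by (intro sum_nonneg) auto
  have "grid_norm p a b D (\<lambda>u. v (q u)) \<le> 2 * ?S powr (1 / p) + ?S powr (1 / p)"
  proof (rule norm_le)
    fix n t assume nt: "(n, t) \<in> grid_dissections a b D"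
    note t = grid_dissections_D[OF nt]
    have q_mono: "q (t i) \<le> q (t j)" if "i \<le> j" "j \<le> n" for i j
    proof (cases "i = j")
      case False
      then show ?thesis using that t(2) dissection_less[OF t(1), of i j]
        by (intro mono) auto
    qed simp
    define J where "J = {i\<in>{..<n}. q (t i) < q (t (Suc i))}"
    have J: "finite J" by (simp add: J_def)
    have inj1: "inj_on (\<lambda>i. q (t i)) J"
    proof (rule linorder_inj_onI)
      fix i j assume "i < j" "i \<in> J" "j \<in> J"
      then have "q (t i) < q (t (Suc i))" "q (t (Suc i)) \<le> q (t j)"
        using q_mono[of "Suc i" j] by (auto simp: J_def)
      then show "q (t i) \<noteq> q (t j)" by simp
    qed auto
    have inj2: "inj_on (\<lambda>i. q (t (Suc i))) J"
    proof (rule linorder_inj_onI)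
      fix i j assume "i < j" "i \<in> J" "j \<in> J"
      then have "q (t (Suc i)) \<le> q (t j)" "q (t j) < q (t (Suc j))"
        using q_mono[of "Suc i" j] by (auto simp: J_def)
      then show "q (t (Suc i)) \<noteq> q (t (Suc j))" by simp
    qed auto
    have sums: "(\<Sum>i\<in>J. \<bar>v (q (t i))\<bar> powr p) \<le> ?S" "(\<Sum>i\<in>J. \<bar>v (q (t (Suc i)))\<bar> powr p) \<le> ?S"
    proof -
      have "(\<Sum>i\<in>J. \<bar>v (q (t i))\<bar> powr p) = (\<Sum>k\<in>(\<lambda>i. q (t i)) ` J. \<bar>v k\<bar> powr p)"
        by (simp add: sum.reindex[OF inj1])
      also have "\<dots> \<le> ?S" using t(2) qM by (intro sum_mono2) (auto simp: J_def)
      finally show "(\<Sum>i\<in>J. \<bar>v (q (t i))\<bar> powr p) \<le> ?S" .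
      have "(\<Sum>i\<in>J. \<bar>v (q (t (Suc i)))\<bar> powr p) = (\<Sum>k\<in>(\<lambda>i. q (t (Suc i))) ` J. \<bar>v k\<bar> powr p)"
        by (simp add: sum.reindex[OF inj2])
      also have "\<dots> \<le> ?S" using t(2) qM by (intro sum_mono2) (auto simp: J_def)
      finally show "(\<Sum>i\<in>J. \<bar>v (q (t (Suc i)))\<bar> powr p) \<le> ?S" .
    qed
    have "var_sum p (\<lambda>u. v (q u)) (n, t) = (\<Sum>i\<in>J. \<bar>v (q (t (Suc i))) - v (q (t i))\<bar> powr p)"
      unfolding var_sum_def prod.case
    proof (rule sum.mono_neutral_right)
      show "\<forall>i\<in>{..<n} - J. \<bar>v (q (t (Suc i))) - v (q (t i))\<bar> powr p = 0"
      proof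
        fix i assume i: "i \<in> {..<n} - J"
        then have "q (t (Suc i)) = q (t i)" using q_mono[of i "Suc i"] by (auto simp: J_def)
        then show "\<bar>v (q (t (Suc i))) - v (q (t i))\<bar> powr p = 0" by simp
      qed
    qed (auto simp: J_def)
    also have "\<dots> \<le> (\<Sum>i\<in>J. 2 powr (p - 1) * (\<bar>v (q (t (Suc i)))\<bar> powr p + \<bar>v (q (t i))\<bar> powr p))"
      by (intro sum_mono powr_diff_le p)
    also have "\<dots> = 2 powr (p - 1) * ((\<Sum>i\<in>J. \<bar>v (q (t (Suc i)))\<bar> powr p) + (\<Sum>i\<in>J. \<bar>v (q (t i))\<bar> powr p))"
      by (simp only: sum_distrib_left[symmetric] sum.distrib)
    also have "\<dots> \<le> 2 powr (p - 1) * (?S + ?S)"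
      using sums by (intro mult_left_mono add_mono) auto
    also have "\<dots> = 2 powr p * ?S" by (simp add: powr_diff)
    finally have "var_sum p (\<lambda>u. v (q u)) (n, t) powr (1 / p) \<le> (2 powr p * ?S) powr (1 / p)"
      using p by (intro powr_mono2 var_sum_nonneg) auto
    also have "\<dots> = 2 * ?S powr (1 / p)" using p S0 by (simp add: powr_mult powr_powr)
    finally show "var_sum p (\<lambda>u. v (q u)) (n, t) powr (1 / p) \<le> 2 * ?S powr (1 / p)" .
  next
    fix u assume "u \<in> D"
    then have "\<bar>v (q u)\<bar> powr p \<le> ?S"
      using qM by (intro member_le_sum) auto
    then have "(\<bar>v (q u)\<bar> powr p) powr (1 / p) \<le> ?S powr (1 / p)"
      using p by (intro powr_mono2) auto
    then show "\<bar>v (q u)\<bar> \<le> ?S powr (1 / p)" using p by (simp add: powr_powr)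
  qed
  then show ?thesis by simp
qed

text \<open>The function \<open>W\<close> is a discrete version of \<open>t \<mapsto> \<integral> f'\<^sup>2\<close> up to \<open>t\<close>, and its second property is the
Cauchy--Schwarz inequality. It bounds the Lipschitz constant of the norm of the \<open>\<delta>\<close>-difference process
with respect to the Cameron--Martin norm, independently of \<open>p\<close> and of the grid.\<close>
lemma norm_le_energy:
  fixes f W :: "real \<Rightarrow> real"
  assumes p: "p \<ge> 2" and \<delta>: "\<delta> > 0"
    and W: "\<And>s t. s \<in> T \<Longrightarrow> t \<in> T \<Longrightarrow> s \<le> t \<Longrightarrow> W s \<le> W t \<and> (f t - f s)\<^sup>2 \<le> (t - s) * (W t - W s)"
    and WE: "\<And>t. t \<in> T \<Longrightarrow> 0 \<le> W t \<and> W t \<le> E"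
    and T: "\<And>u. u \<in> D \<Longrightarrow> c + u \<in> T \<and> c + \<delta> + u \<in> T"
  shows "grid_norm p a b D (\<lambda>u. f (c + \<delta> + u) - f (c + u)) \<le> 3 * (sqrt \<delta> * sqrt E)"
proof -
  define g where "g u = f (c + \<delta> + u) - f (c + u)" for u
  have E: "0 \<le> E" using WE T ends by (meson order_trans)
  have sq2: "(x - y)\<^sup>2 \<le> 2 * (x\<^sup>2 + y\<^sup>2)" for x y :: real
    using sum_squares_ge_zero[of "x + y" 0] by (simp add: power2_eq_square algebra_simps)
  have g_sq: "(g u)\<^sup>2 \<le> \<delta> * (W (c + \<delta> + u) - W (c + u))" if "u \<in> D" for u
    using W[of "c + u" "c + \<delta> + u"] T[OF that] \<delta> by (simp add: g_def)
  \<comment> \<open>The right-hand side telescopes. For \<open>v - u \<le> \<delta>\<close> the two shifted intervals of length \<open>v - u\<close> are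
    compared; for \<open>v - u > \<delta>\<close> the intervals of length \<open>\<delta>\<close> at \<open>u\<close> and at \<open>v\<close> are disjoint, and each value
    of \<open>g\<close> is estimated on its own.\<close>
  have incr: "(g v - g u)\<^sup>2 \<le> 2 * \<delta> * ((W (c + \<delta> + v) + W (c + v)) - (W (c + \<delta> + u) + W (c + u)))"
    if u: "u \<in> D" and v: "v \<in> D" and uv: "u < v" for u v
  proof (cases "v - u \<le> \<delta>")
    case True
    have Wm: "W (c + u) \<le> W (c + v)" "W (c + \<delta> + u) \<le> W (c + \<delta> + v)"
      "(f (c + v) - f (c + u))\<^sup>2 \<le> (v - u) * (W (c + v) - W (c + u))"
      "(f (c + \<delta> + v) - f (c + \<delta> + u))\<^sup>2 \<le> (v - u) * (W (c + \<delta> + v) - W (c + \<delta> + u))"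
      using W[of "c + u" "c + v"] W[of "c + \<delta> + u" "c + \<delta> + v"] T[OF u] T[OF v] uv by auto
    have "(g v - g u)\<^sup>2 = ((f (c + \<delta> + v) - f (c + \<delta> + u)) - (f (c + v) - f (c + u)))\<^sup>2"
      by (simp add: g_def algebra_simps)
    also have "\<dots> \<le> 2 * ((f (c + \<delta> + v) - f (c + \<delta> + u))\<^sup>2 + (f (c + v) - f (c + u))\<^sup>2)" by (rule sq2)
    also have "\<dots> \<le> 2 * ((v - u) * (W (c + \<delta> + v) - W (c + \<delta> + u)) + (v - u) * (W (c + v) - W (c + u)))"
      using Wm by simp
    also have "\<dots> \<le> 2 * (\<delta> * (W (c + \<delta> + v) - W (c + \<delta> + u)) + \<delta> * (W (c + v) - W (c + u)))"
      using Wm True by (intro mult_left_mono add_mono mult_right_mono) auto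
    finally show ?thesis by (simp add: algebra_simps)
  next
    case False
    have Wm: "W (c + \<delta> + u) \<le> W (c + v)"
      using W[of "c + \<delta> + u" "c + v"] T[OF u] T[OF v] False by auto
    have "(g v - g u)\<^sup>2 \<le> 2 * ((g v)\<^sup>2 + (g u)\<^sup>2)" by (rule sq2)
    also have "\<dots> \<le> 2 * (\<delta> * (W (c + \<delta> + v) - W (c + v)) + \<delta> * (W (c + \<delta> + u) - W (c + u)))"
      using g_sq[OF u] g_sq[OF v] by simp
    also have "\<dots> = 2 * \<delta> * ((W (c + \<delta> + v) - W (c + v)) + (W (c + \<delta> + u) - W (c + u)))"
      by (simp add: algebra_simps)
    also have "\<dots> \<le> 2 * \<delta> * ((W (c + \<delta> + v) + W (c + v)) - (W (c + \<delta> + u) + W (c + u)))"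
      using Wm \<delta> by (intro mult_left_mono) auto
    finally show ?thesis .
  qed
  have "grid_norm p a b D g \<le> 2 * (sqrt \<delta> * sqrt E) + sqrt \<delta> * sqrt E"
  proof (rule norm_le)
    fix n t assume nt: "(n, t) \<in> grid_dissections a b D"
    note t = grid_dissections_D[OF nt]
    let ?W = "\<lambda>u. W (c + \<delta> + u) + W (c + u)"
    have "(\<Sum>i<n. (g (t (Suc i)) - g (t i))\<^sup>2) \<le> (\<Sum>i<n. 2 * \<delta> * (?W (t (Suc i)) - ?W (t i)))"
      using t by (intro sum_mono incr) auto
    also have "\<dots> = 2 * \<delta> * (?W (t n) - ?W (t 0))"
      unfolding sum_distrib_left[symmetric] by (subst sum_lessThan_telescope) simp
    also have "\<dots> \<le> 2 * \<delta> * (2 * E)"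
      using WE T[OF t(2)[of n]] T[OF t(2)[of 0]] \<delta> by (intro mult_left_mono) (smt (verit) le0 order_refl)+
    finally have le: "(\<Sum>i<n. (g (t (Suc i)) - g (t i))\<^sup>2) \<le> 2\<^sup>2 * (\<delta> * E)" by simp
    have "var_sum p g (n, t) powr (1 / p) \<le> sqrt (\<Sum>i<n. (g (t (Suc i)) - g (t i))\<^sup>2)"
      unfolding var_sum_def prod.case by (rule sum_powr_le_sum_squares[OF p])
    also have "\<dots> \<le> sqrt (2\<^sup>2 * (\<delta> * E))" using le by (rule real_sqrt_le_mono)
    finally show "var_sum p g (n, t) powr (1 / p) \<le> 2 * (sqrt \<delta> * sqrt E)"
      by (simp add: real_sqrt_mult)
  next
    fix u assume u: "u \<in> D"
    have "(g u)\<^sup>2 \<le> \<delta> * E"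
      using g_sq[OF u] WE[of "c + u"] WE[of "c + \<delta> + u"] T[OF u] \<delta>
      by (smt (verit) mult_left_mono)
    then show "\<bar>g u\<bar> \<le> sqrt \<delta> * sqrt E"
      by (metis real_sqrt_abs real_sqrt_le_mono real_sqrt_mult)
  qed
  then show ?thesis unfolding g_def by (simp add: mult.commute)
qed

end

section \<open>Dyadic grids and chaining\<close>

definition dyadic_grid :: "real \<Rightarrow> real \<Rightarrow> nat \<Rightarrow> real set" where
  "dyadic_grid a b N = (\<lambda>k. a + (b - a) * (real k / 2 ^ N)) ` {..2 ^ N}"

definition dyadic_floor :: "nat \<Rightarrow> real \<Rightarrow> nat" where
  "dyadic_floor N x = nat \<lfloor>x * 2 ^ N\<rfloor>"

definition dyadic_round :: "real \<Rightarrow> real \<Rightarrow> nat \<Rightarrow> real \<Rightarrow> real" where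
  "dyadic_round a b N x = a + (b - a) * (real (dyadic_floor N ((x - a) / (b - a))) / 2 ^ N)"

lemma dyadic_floor_bounds:
  assumes "0 \<le> x"
  shows "real (dyadic_floor N x) \<le> x * 2 ^ N" "x * 2 ^ N < real (dyadic_floor N x) + 1"
proof -
  have "0 \<le> \<lfloor>x * 2 ^ N\<rfloor>" using assms by simp
  then have "real (dyadic_floor N x) = of_int \<lfloor>x * 2 ^ N\<rfloor>" by (simp add: dyadic_floor_def)
  then show "real (dyadic_floor N x) \<le> x * 2 ^ N" "x * 2 ^ N < real (dyadic_floor N x) + 1" by linarith+
qed

lemma dyadic_floor_mono: "x \<le> y \<Longrightarrow> dyadic_floor N x \<le> dyadic_floor N y"
  unfolding dyadic_floor_def by (intro nat_mono floor_mono) simp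

lemma dyadic_floor_le:
  assumes "x \<le> 1"
  shows "dyadic_floor N x \<le> 2 ^ N"
  using dyadic_floor_mono[OF assms, of N] by (simp add: dyadic_floor_def nat_power_eq)

lemma dyadic_floor_div2:
  assumes "0 \<le> x"
  shows "dyadic_floor (Suc N) x div 2 = dyadic_floor N x"
proof -
  let ?k = "dyadic_floor N x"
  define y where "y = x * 2 ^ N"
  have "real ?k \<le> y" "y < real ?k + 1"
    using dyadic_floor_bounds[OF assms, of N] by (auto simp: y_def)
  moreover have "real (dyadic_floor (Suc N) x) \<le> 2 * y" "2 * y < real (dyadic_floor (Suc N) x) + 1"
    using dyadic_floor_bounds[OF assms, of "Suc N"] by (auto simp: y_def mult_ac)
  ultimately have "real (dyadic_floor (Suc N) x) < real (2 * (?k + 1))" "real (2 * ?k) < real (dyadic_floor (Suc N) x + 1)"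
    by auto
  then have "dyadic_floor (Suc N) x < 2 * (?k + 1)" "2 * ?k < dyadic_floor (Suc N) x + 1"
    by (simp_all only: of_nat_less_iff)
  then show ?thesis by (intro div_nat_eqI) auto
qed

lemma grid_dyadic: "a < b \<Longrightarrow> grid a b (dyadic_grid a b N)"
  by unfold_locales (auto simp: dyadic_grid_def intro: image_eqI[of _ _ 0] image_eqI[of _ _ "2 ^ N"])

lemma dyadic_grid_subset:
  assumes "a \<le> b"
  shows "dyadic_grid a b N \<subseteq> {a..b}"
proof
  fix x assume "x \<in> dyadic_grid a b N"
  then obtain k :: nat where k: "k \<le> 2 ^ N" "x = a + (b - a) * (real k / 2 ^ N)" by (auto simp: dyadic_grid_def)
  have "real k \<le> 2 ^ N" using k(1) by (metis of_nat_le_iff of_nat_numeral of_nat_power)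
  then have "real k / 2 ^ N \<le> 1" by simp
  then have "(b - a) * (real k / 2 ^ N) \<le> (b - a) * 1" using assms by (intro mult_left_mono) auto
  moreover have "0 \<le> (b - a) * (real k / 2 ^ N)" using assms by simp
  ultimately show "x \<in> {a..b}" using k(2) by simp
qed

lemma dyadic_grid_mono: "M \<le> N \<Longrightarrow> dyadic_grid a b M \<subseteq> dyadic_grid a b N"
proof
  fix x assume MN: "M \<le> N" and "x \<in> dyadic_grid a b M"
  then obtain k where k: "k \<le> 2 ^ M" "x = a + (b - a) * (real k / 2 ^ M)" by (auto simp: dyadic_grid_def)
  have "real (k * 2 ^ (N - M)) / 2 ^ N = real k / 2 ^ M"
  proof -
    have "(2::real) ^ N = 2 ^ M * 2 ^ (N - M)" using MN by (metis le_add_diff_inverse power_add)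
    then show ?thesis by simp
  qed
  moreover have "k * 2 ^ (N - M) \<le> 2 ^ N"
    using k(1) MN by (metis le_add_diff_inverse mult_le_mono1 power_add)
  ultimately show "x \<in> dyadic_grid a b N"
    unfolding dyadic_grid_def k(2) by (intro image_eqI[of _ _ "k * 2 ^ (N - M)"]) simp_all
qed

lemma dyadic_round_in_grid:
  assumes "a < b" "x \<in> {a..b}"
  shows "dyadic_round a b N x \<in> dyadic_grid a b N"
  unfolding dyadic_round_def dyadic_grid_def using assms
  by (intro image_eqI[OF refl]) (auto intro!: dyadic_floor_le)

lemma dyadic_round_ends:
  assumes "a < b"
  shows "dyadic_round a b N a = a" "dyadic_round a b N b = b"
  using assms by (auto simp: dyadic_round_def dyadic_floor_def nat_power_eq)

lemma dyadic_round_close: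
  assumes "a < b" "x \<in> {a..b}"
  shows "\<bar>dyadic_round a b N x - x\<bar> \<le> (b - a) * (1 / 2 ^ N)"
proof -
  define y where "y = (x - a) / (b - a)"
  have y: "0 \<le> y" "x = a + (b - a) * y" using assms by (auto simp: y_def)
  have "\<bar>real (dyadic_floor N y) - y * 2 ^ N\<bar> \<le> 1"
    using dyadic_floor_bounds[OF y(1), of N] by linarith
  then have "\<bar>real (dyadic_floor N y) - y * 2 ^ N\<bar> / 2 ^ N \<le> 1 / 2 ^ N"
    by (intro divide_right_mono) auto
  moreover have "\<bar>real (dyadic_floor N y) / 2 ^ N - y\<bar> = \<bar>(real (dyadic_floor N y) - y * 2 ^ N) / 2 ^ N\<bar>"
    by (simp add: diff_divide_distrib)
  then have "\<bar>real (dyadic_floor N y) - y * 2 ^ N\<bar> / 2 ^ N = \<bar>real (dyadic_floor N y) / 2 ^ N - y\<bar>"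
    by (simp add: abs_divide)
  ultimately have le: "\<bar>real (dyadic_floor N y) / 2 ^ N - y\<bar> \<le> 1 / 2 ^ N" by simp
  have "dyadic_round a b N x - x = (b - a) * (real (dyadic_floor N y) / 2 ^ N - y)"
    using y(2) by (simp add: dyadic_round_def y_def[symmetric] right_diff_distrib)
  then have "\<bar>dyadic_round a b N x - x\<bar> = (b - a) * \<bar>real (dyadic_floor N y) / 2 ^ N - y\<bar>"
    using assms by (simp add: abs_mult)
  also have "\<dots> \<le> (b - a) * (1 / 2 ^ N)" using le assms by (intro mult_left_mono) auto
  finally show ?thesis .
qed

lemma dyadic_round_tendsto:
  assumes "a < b" "x \<in> {a..b}"
  shows "(\<lambda>N. dyadic_round a b N x) \<longlonglongrightarrow> x"
proof (rule LIM_zero_cancel, rule Lim_null_comparison)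
  show "\<forall>\<^sub>F N in sequentially. norm (dyadic_round a b N x - x) \<le> (b - a) * (1 / 2 ^ N)"
    using dyadic_round_close[OF assms] by simp
  have "(\<lambda>N. (b - a) * (1 / 2) ^ N) \<longlonglongrightarrow> (b - a) * 0"
    by (intro tendsto_mult tendsto_const LIMSEQ_realpow_zero) auto
  then show "(\<lambda>N. (b - a) * (1 / 2 ^ N)) \<longlonglongrightarrow> 0" by (simp add: power_divide)
qed

lemma continuous_at_dyadic_round:
  fixes f :: "real \<Rightarrow> real"
  assumes "a < b" "x \<in> {a..b}" "continuous_on {a..b} f"
  shows "(\<lambda>N. f (dyadic_round a b N x)) \<longlonglongrightarrow> f x"
proof (rule continuous_on_tendsto_compose[OF assms(3) dyadic_round_tendsto[OF assms(1,2)] assms(2)])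
  show "\<forall>\<^sub>F N in sequentially. dyadic_round a b N x \<in> {a..b}"
    using subsetD[OF dyadic_grid_subset dyadic_round_in_grid[OF assms(1,2)]] assms(1)
    by (intro always_eventually allI) auto
qed

text \<open>Rounding the points of a dissection down to the grid keeps the end points, keeps the order once the mesh is finer
than the gaps, and changes the sum little by continuity.\<close>
lemma grid_variation_approx:
  assumes ab: "a < b" and f: "continuous_on {a..b} f" and p: "p \<ge> 1" and d: "(n, t) \<in> dissections a b"
  obtains X where "X \<longlonglongrightarrow> var_sum p f (n, t) powr (1 / p)"
    and "\<forall>\<^sub>F N in sequentially. X N \<le> grid_variation p a b (dyadic_grid a b N) f"
proof -
  define r where "r N = (\<lambda>i\<in>{..n}. dyadic_round a b N (t i))" for N
  define X where "X N = var_sum p f (n, r N) powr (1 / p)" for N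
  have mem: "t i \<in> {a..b}" if "i \<le> n" for i
    using dissection_mem[OF d that] by auto
  have ends: "t 0 = a" "t n = b" using d by (auto simp: dissections_def)
  have "X \<longlonglongrightarrow> var_sum p f (n, t) powr (1 / p)"
    unfolding X_def
  proof (rule tendsto_powr')
    have eq: "var_sum p f (n, r N) = (\<Sum>i<n. \<bar>f (dyadic_round a b N (t (Suc i))) - f (dyadic_round a b N (t i))\<bar> powr p)" for N
      by (simp add: var_sum_def r_def)
    show "(\<lambda>N. var_sum p f (n, r N)) \<longlonglongrightarrow> var_sum p f (n, t)"
      unfolding eq unfolding var_sum_def prod.case
    proof (intro tendsto_sum tendsto_powr')
      fix i assume i: "i \<in> {..<n}"
      show "(\<lambda>N. \<bar>f (dyadic_round a b N (t (Suc i))) - f (dyadic_round a b N (t i))\<bar>)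
         \<longlonglongrightarrow> \<bar>f (t (Suc i)) - f (t i)\<bar>"
        using i by (intro tendsto_rabs tendsto_diff continuous_at_dyadic_round ab f mem) auto
    qed (use p in auto)
  qed (use p in \<open>auto simp: var_sum_nonneg\<close>)
  moreover have "\<forall>\<^sub>F N in sequentially. X N \<le> grid_variation p a b (dyadic_grid a b N) f"
  proof -
    have "\<forall>\<^sub>F N in sequentially. \<forall>i\<in>{..<n}. 0 < dyadic_round a b N (t (Suc i)) - dyadic_round a b N (t i)"
    proof (intro eventually_ball_finite ballI)
      fix i assume i: "i \<in> {..<n}"
      have "(\<lambda>N. dyadic_round a b N (t (Suc i)) - dyadic_round a b N (t i)) \<longlonglongrightarrow> t (Suc i) - t i"
        using i by (intro tendsto_diff dyadic_round_tendsto ab mem) auto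
      moreover have "0 < t (Suc i) - t i" using d i by (auto simp: dissections_def)
      ultimately show "\<forall>\<^sub>F N in sequentially. 0 < dyadic_round a b N (t (Suc i)) - dyadic_round a b N (t i)"
        by (rule order_tendstoD)
    qed simp
    then show ?thesis
    proof eventually_elim
      case (elim N)
      have "(n, r N) \<in> grid_dissections a b (dyadic_grid a b N)"
      proof -
        have "r N \<in> {..n} \<rightarrow>\<^sub>E dyadic_grid a b N"
          unfolding r_def by (intro restrict_PiE[THEN iffD2] funcsetI dyadic_round_in_grid ab mem) simp
        moreover have "(n, r N) \<in> dissections a b"
          using elim by (simp add: dissections_def r_def ends dyadic_round_ends[OF ab])
        ultimately show ?thesis by (simp add: grid_dissections_def)
      qed
      then show ?case unfolding X_def by (rule grid.variation_ge[OF grid_dyadic[OF ab]])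
    qed
  qed
  ultimately show ?thesis by (rule that)
qed

lemma p_variation_alt: "p_variation p a b f = (SUP d\<in>dissections a b. ereal (var_sum p f d powr (1 / p)))"
  unfolding p_variation_def var_sum_def by (intro SUP_cong) auto

lemma grid_variation_le_p_variation:
  assumes "grid a b D"
  shows "ereal (grid_variation p a b D f) \<le> p_variation p a b f"
proof -
  interpret grid a b D by fact
  have le: "ereal (var_sum p f d powr (1 / p)) \<le> p_variation p a b f" if "d \<in> dissections a b" for d
    unfolding p_variation_alt using that by (rule SUP_upper)
  obtain n t where nt: "(n, t) \<in> grid_dissections a b D"
    using grid_dissections_nonempty[OF ab ends] by auto
  show ?thesis
  proof (cases "p_variation p a b f")
    case (real r)
    have "grid_variation p a b D f \<le> r"
      using le grid_dissections_D(1) real by (intro variation_le) force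
    then show ?thesis using real by simp
  qed (use le[OF grid_dissections_D(1)[OF nt]] in auto)
qed

text \<open>Only countably many grids occur on the right-hand side, which makes finiteness of the \<open>p\<close>-variation a measurable
condition on continuous paths.\<close>
lemma p_variation_finite_iff:
  assumes ab: "a < b" and f: "continuous_on {a..b} f" and p: "p \<ge> 1"
  shows "p_variation p a b f < \<infinity> \<longleftrightarrow> (\<exists>K::nat. \<forall>N. grid_variation p a b (dyadic_grid a b N) f \<le> real K)"
proof
  assume fin: "p_variation p a b f < \<infinity>"
  have "0 \<le> p_variation p a b f"
    using grid_variation_le_p_variation[OF grid_dyadic[OF ab], of p 0 f] grid.variation_nonneg[OF grid_dyadic[OF ab], of p 0 f]
    by (meson ereal_less_eq(5) order_trans)
  with fin obtain r where r: "p_variation p a b f = ereal r"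
    by (cases "p_variation p a b f") auto
  have "grid_variation p a b (dyadic_grid a b N) f \<le> real (nat \<lceil>r\<rceil>)" for N
    using grid_variation_le_p_variation[OF grid_dyadic[OF ab], of p N f] r
    by simp (meson order_trans real_nat_ceiling_ge)
  then show "\<exists>K::nat. \<forall>N. grid_variation p a b (dyadic_grid a b N) f \<le> real K" by blast
next
  assume "\<exists>K::nat. \<forall>N. grid_variation p a b (dyadic_grid a b N) f \<le> real K"
  then obtain K :: nat where K: "\<And>N. grid_variation p a b (dyadic_grid a b N) f \<le> real K" by blast
  have "p_variation p a b f \<le> ereal (real K)"
    unfolding p_variation_alt
  proof (rule SUP_least)
    fix d assume "d \<in> dissections a b"
    then obtain n t where d: "d = (n, t)" "(n, t) \<in> dissections a b" by (cases d) auto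
    obtain X where X: "X \<longlonglongrightarrow> var_sum p f (n, t) powr (1 / p)"
      "\<forall>\<^sub>F N in sequentially. X N \<le> grid_variation p a b (dyadic_grid a b N) f"
      using grid_variation_approx[OF ab f p d(2)] by blast
    have "var_sum p f (n, t) powr (1 / p) \<le> real K"
    proof (rule tendsto_upperbound[OF X(1)])
      show "\<forall>\<^sub>F N in sequentially. X N \<le> real K"
        using X(2) by eventually_elim (use K order_trans in blast)
    qed simp
    then show "ereal (var_sum p f d powr (1 / p)) \<le> ereal (real K)" using d by simp
  qed
  then show "p_variation p a b f < \<infinity>" by auto
qed

lemma grid_variation_mono:
  assumes "grid a b D" "grid a b D'" "D \<subseteq> D'"
  shows "grid_variation p a b D f \<le> grid_variation p a b D' f"
proof (rule grid.variation_le[OF assms(1)])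
  fix n t assume "(n, t) \<in> grid_dissections a b D"
  then have "(n, t) \<in> grid_dissections a b D'"
    using assms(3) by (auto simp: grid_dissections_def PiE_def Pi_def)
  then show "var_sum p f (n, t) powr (1 / p) \<le> grid_variation p a b D' f"
    by (rule grid.variation_ge[OF assms(2)])
qed

lemma grid_norm_mono:
  assumes "grid a b D" "grid a b D'" "D \<subseteq> D'"
  shows "grid_norm p a b D f \<le> grid_norm p a b D' f"
proof -
  have "(SUP u\<in>D. \<bar>f u\<bar>) \<le> (SUP u\<in>D'. \<bar>f u\<bar>)"
    using assms grid.fin[OF assms(2)] grid.ends[OF assms(1)] by (intro cSUP_subset_mono) auto
  then show ?thesis unfolding grid_norm_def using grid_variation_mono[OF assms] by (intro add_mono)
qed

lemma grid_norm_tendsto_p_norm: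
  assumes ab: "a < b" and f: "continuous_on {a..b} f" and p: "p \<ge> 1" and fin: "p_variation p a b f < \<infinity>"
  shows "(\<lambda>N. grid_norm p a b (dyadic_grid a b N) f) \<longlonglongrightarrow> p_norm p a b f"
  unfolding grid_norm_def p_norm_def
proof (rule tendsto_add)
  have sub: "dyadic_grid a b N \<subseteq> dyadic_grid a b (Suc N)" for N by (rule dyadic_grid_mono) simp
  note le_V = grid_variation_le_p_variation[OF grid_dyadic[OF ab], of p _ f]
  have "0 \<le> p_variation p a b f"
    using le_V[of 0] grid.variation_nonneg[OF grid_dyadic[OF ab], of p 0 f]
    by (meson ereal_less_eq(5) order_trans)
  with fin obtain r where r: "p_variation p a b f = ereal r"
    by (cases "p_variation p a b f") auto
  have "(\<lambda>N. grid_variation p a b (dyadic_grid a b N) f) \<longlonglongrightarrow> r"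
  proof (rule increasing_LIMSEQ)
    show "grid_variation p a b (dyadic_grid a b N) f \<le> grid_variation p a b (dyadic_grid a b (Suc N)) f" for N
      by (intro grid_variation_mono grid_dyadic ab sub)
    show "grid_variation p a b (dyadic_grid a b N) f \<le> r" for N using le_V[of N] r by simp
    fix e :: real assume e: "0 < e"
    have "ereal (r - e / 2) < p_variation p a b f" using e r by simp
    then obtain n t where nt: "(n, t) \<in> dissections a b" "r - e / 2 < var_sum p f (n, t) powr (1 / p)"
      unfolding p_variation_alt less_SUP_iff by auto
    obtain X where X: "X \<longlonglongrightarrow> var_sum p f (n, t) powr (1 / p)"
      "\<forall>\<^sub>F N in sequentially. X N \<le> grid_variation p a b (dyadic_grid a b N) f"
      using grid_variation_approx[OF ab f p nt(1)] by blast
    have "\<forall>\<^sub>F N in sequentially. r - e / 2 < X N" using order_tendstoD(1)[OF X(1) nt(2)] .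
    with X(2) have "\<forall>\<^sub>F N in sequentially. r \<le> grid_variation p a b (dyadic_grid a b N) f + e"
      by eventually_elim (use e in linarith)
    then show "\<exists>N. r \<le> grid_variation p a b (dyadic_grid a b N) f + e"
      by (rule eventually_happens'[rotated]) simp
  qed
  then show "(\<lambda>N. grid_variation p a b (dyadic_grid a b N) f) \<longlonglongrightarrow> real_of_ereal (p_variation p a b f)"
    by (simp add: r)
  have "compact ((\<lambda>t. \<bar>f t\<bar>) ` {a..b})"
    by (intro compact_continuous_image continuous_intros f) auto
  then have bdd: "bdd_above ((\<lambda>t. \<bar>f t\<bar>) ` {a..b})"
    by (intro bounded_imp_bdd_above compact_imp_bounded)
  obtain u0 where u0: "u0 \<in> {a..b}" "\<And>u. u \<in> {a..b} \<Longrightarrow> \<bar>f u\<bar> \<le> \<bar>f u0\<bar>"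
    using continuous_attains_sup[of "{a..b}" "\<lambda>t. \<bar>f t\<bar>"] continuous_on_rabs[OF f] ab by auto
  have sup: "(SUP t\<in>{a..b}. \<bar>f t\<bar>) = \<bar>f u0\<bar>"
    using u0 bdd ab by (intro antisym cSUP_least cSUP_upper) auto
  show "(\<lambda>N. SUP u\<in>dyadic_grid a b N. \<bar>f u\<bar>) \<longlonglongrightarrow> (SUP t\<in>{a..b}. \<bar>f t\<bar>)"
    unfolding sup
  proof (rule increasing_LIMSEQ)
    fix N
    show "(SUP u\<in>dyadic_grid a b N. \<bar>f u\<bar>) \<le> (SUP u\<in>dyadic_grid a b (Suc N). \<bar>f u\<bar>)"
      using grid.fin[OF grid_dyadic[OF ab]] grid.ends(1)[OF grid_dyadic[OF ab], of N] sub
      by (intro cSUP_subset_mono) auto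
    show "(SUP u\<in>dyadic_grid a b N. \<bar>f u\<bar>) \<le> \<bar>f u0\<bar>"
      using grid.ends(1)[OF grid_dyadic[OF ab], of N] u0(2) dyadic_grid_subset[of a b N] ab
      by (intro cSUP_least) auto
  next
    fix e :: real assume e: "0 < e"
    have "(\<lambda>N. \<bar>f (dyadic_round a b N u0)\<bar>) \<longlonglongrightarrow> \<bar>f u0\<bar>"
      by (intro tendsto_rabs continuous_at_dyadic_round ab f u0)
    then have "\<forall>\<^sub>F N in sequentially. \<bar>f u0\<bar> - e < \<bar>f (dyadic_round a b N u0)\<bar>"
      by (rule order_tendstoD) (use e in simp)
    then have "\<exists>N. \<bar>f u0\<bar> - e < \<bar>f (dyadic_round a b N u0)\<bar>"
      by (rule eventually_happens'[rotated]) simp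
    then obtain N where "\<bar>f u0\<bar> - e < \<bar>f (dyadic_round a b N u0)\<bar>" by blast
    then show "\<exists>N. \<bar>f u0\<bar> \<le> (SUP u\<in>dyadic_grid a b N. \<bar>f u\<bar>) + e"
      using grid.abs_le_Sup[OF grid_dyadic[OF ab] dyadic_round_in_grid[OF ab u0(1), of N], of f]
      by (intro exI[of _ N]) linarith
  qed
qed

text \<open>Rounding down to level \<open>N\<close> is the identity on the grid, so \<open>g\<close> is its rounding to level \<open>m\<close> plus the differences
between consecutive levels. The difference between levels \<open>n\<close> and \<open>n - 1\<close> is a step function on the cells of
level \<open>n\<close>: it vanishes on even cells, and on odd cells it is a single increment over a dyadic interval of
length \<open>1 / 2 ^ n\<close>.\<close>
lemma grid_norm_chaining:
  fixes g :: "real \<Rightarrow> real"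
  assumes p: "p \<ge> 1" and mN: "m \<le> N"
  shows "grid_norm p 0 1 (dyadic_grid 0 1 N) g
    \<le> 3 * (\<Sum>k\<le>2 ^ m. \<bar>g (real k / 2 ^ m)\<bar> powr p) powr (1 / p)
      + (\<Sum>n\<in>{m<..N}. 3 * (\<Sum>k<2 ^ n. \<bar>g (real (Suc k) / 2 ^ n) - g (real k / 2 ^ n)\<bar> powr p) powr (1 / p))"
proof -
  interpret grid 0 1 "dyadic_grid 0 1 N" by (rule grid_dyadic) simp
  let ?D = "dyadic_grid 0 1 N"
  have D01: "u \<in> ?D \<Longrightarrow> 0 \<le> u \<and> u \<le> 1" for u using dyadic_grid_subset[of 0 1 N] by auto
  let ?g = "\<lambda>n u. g (real (dyadic_floor n u) / 2 ^ n)"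
  let ?R = "\<lambda>n. 3 * (\<Sum>k<2 ^ n. \<bar>g (real (Suc k) / 2 ^ n) - g (real k / 2 ^ n)\<bar> powr p) powr (1 / p)"
  have "grid_norm p 0 1 ?D (?g n)
     \<le> 3 * (\<Sum>k\<le>2 ^ m. \<bar>g (real k / 2 ^ m)\<bar> powr p) powr (1 / p) + (\<Sum>n\<in>{m<..n}. ?R n)"
    if "m \<le> n" for n
    using that
  proof (induction n rule: dec_induct)
    case base
    show ?case
      using norm_step_function[OF p, of "dyadic_floor m" "2 ^ m" "\<lambda>k. g (real k / 2 ^ m)"]
        dyadic_floor_mono dyadic_floor_le D01 by simp
  next
    case (step n)
    define v where "v k = g (real k / 2 ^ Suc n) - g (real (k div 2) / 2 ^ n)" for k
    have dec: "?g (Suc n) u = ?g n u + v (dyadic_floor (Suc n) u)" if "u \<in> ?D" for u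
      using dyadic_floor_div2[of u n] D01[OF that] by (simp add: v_def del: power_Suc)
    have v_even: "v (2 * j) = 0" for j by (simp add: v_def)
    have v_le: "\<bar>v (Suc k)\<bar> powr p \<le> \<bar>g (real (Suc k) / 2 ^ Suc n) - g (real k / 2 ^ Suc n)\<bar> powr p" for k
    proof (cases "even k")
      case True
      then obtain j where "k = 2 * j" by blast
      then show ?thesis by (simp add: v_def)
    next
      case False
      then obtain j where "Suc k = 2 * j" by (metis even_Suc evenE)
      then show ?thesis using v_even[of j] by simp
    qed
    have "(\<Sum>k\<le>2 ^ Suc n. \<bar>v k\<bar> powr p) = (\<Sum>k<Suc (2 ^ Suc n). \<bar>v k\<bar> powr p)"
      by (simp only: lessThan_Suc_atMost)
    also have "\<dots> = \<bar>v 0\<bar> powr p + (\<Sum>k<2 ^ Suc n. \<bar>v (Suc k)\<bar> powr p)"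
      by (rule sum.lessThan_Suc_shift)
    also have "\<dots> \<le> 0 + (\<Sum>k<2 ^ Suc n. \<bar>g (real (Suc k) / 2 ^ Suc n) - g (real k / 2 ^ Suc n)\<bar> powr p)"
      using v_even[of 0] v_le by (intro add_mono sum_mono) auto
    finally have v_sum: "(\<Sum>k\<le>2 ^ Suc n. \<bar>v k\<bar> powr p)
      \<le> (\<Sum>k<2 ^ Suc n. \<bar>g (real (Suc k) / 2 ^ Suc n) - g (real k / 2 ^ Suc n)\<bar> powr p)" by simp
    have "grid_norm p 0 1 ?D (\<lambda>u. v (dyadic_floor (Suc n) u)) \<le> 3 * (\<Sum>k\<le>2 ^ Suc n. \<bar>v k\<bar> powr p) powr (1 / p)"
      using D01 by (intro norm_step_function p dyadic_floor_mono dyadic_floor_le) auto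
    also have "\<dots> \<le> ?R (Suc n)"
      using v_sum p by (intro mult_left_mono powr_mono2) (auto intro: sum_nonneg)
    finally have inc: "grid_norm p 0 1 ?D (\<lambda>u. v (dyadic_floor (Suc n) u)) \<le> ?R (Suc n)" .
    have "grid_norm p 0 1 ?D (?g (Suc n)) = grid_norm p 0 1 ?D (\<lambda>u. ?g n u + v (dyadic_floor (Suc n) u))"
      by (rule norm_cong) (rule dec)
    also have "\<dots> \<le> grid_norm p 0 1 ?D (?g n) + grid_norm p 0 1 ?D (\<lambda>u. v (dyadic_floor (Suc n) u))"
      by (rule norm_triangle[OF p])
    also have "\<dots> \<le> 3 * (\<Sum>k\<le>2 ^ m. \<bar>g (real k / 2 ^ m)\<bar> powr p) powr (1 / p) + ((\<Sum>n\<in>{m<..n}. ?R n) + ?R (Suc n))"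
      using add_mono[OF step.IH inc] by (simp only: add.assoc)
    also have "(\<Sum>n\<in>{m<..n}. ?R n) + ?R (Suc n) = (\<Sum>n\<in>{m<..Suc n}. ?R n)"
    proof -
      have "{m<..Suc n} = insert (Suc n) {m<..n}" using step.hyps by auto
      then show ?thesis by (simp add: add.commute)
    qed
    finally show ?case .
  qed
  from this[OF mN] show ?thesis
  proof (rule ord_eq_le_trans[rotated])
    show "grid_norm p 0 1 ?D g = grid_norm p 0 1 ?D (?g N)"
      by (rule norm_cong) (auto simp: dyadic_grid_def dyadic_floor_def)
  qed
qed

section \<open>Gaussian moments and the geometric series\<close>

text \<open>The \<open>p\<close>-th absolute moment of a standard normal variable, in the form in which it occurs in \<open>d_const\<close>.\<close>
definition gauss_abs_moment :: "real \<Rightarrow> real" where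
  "gauss_abs_moment p = sqrt (2 powr p / pi) * Gamma ((p + 1) / 2)"

text \<open>The substitution \<open>t = x\<^sup>2 / 2\<close> turns this integral into a Gamma integral. It is carried out on \<open>{0..n}\<close>, and
\<open>n\<close> then tends to infinity.\<close>
lemma nn_integral_half_gauss_powr:
  assumes p: "p \<ge> 1"
  shows "(\<integral>\<^sup>+x. ennreal (x powr p * exp (- x\<^sup>2 / 2) * indicator {0..} x) \<partial>lborel)
    = ennreal (2 powr ((p - 1) / 2) * Gamma ((p + 1) / 2))"
proof -
  define s where "s = (p + 1) / 2"
  have s: "s \<ge> 1" "s > 0" using p by (auto simp: s_def)
  define f where "f t = t powr (s - 1) / exp t" for t :: real
  define c :: real where "c = 2 powr ((p - 1) / 2)"
  define h where "h x = x powr p * exp (- x\<^sup>2 / 2)" for x :: real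
  have [measurable]: "f \<in> borel_measurable borel" "h \<in> borel_measurable borel"
    unfolding f_def h_def by measurable
  have subst: "ennreal c * (\<integral>\<^sup>+t. ennreal (f t * indicator {0..(real n)\<^sup>2 / 2} t) \<partial>lborel)
      = (\<integral>\<^sup>+x. ennreal (h x * indicator {0..real n} x) \<partial>lborel)" for n
  proof -
    have "(\<integral>\<^sup>+t. ennreal (f t * indicator {0\<^sup>2 / 2..(real n)\<^sup>2 / 2} t) \<partial>lborel)
      = (\<integral>\<^sup>+x. ennreal (f (x\<^sup>2 / 2) * x * indicator {0..real n} x) \<partial>lborel)"
    proof (rule nn_integral_substitution)
      show "set_borel_measurable borel {0\<^sup>2 / 2..(real n)\<^sup>2 / 2} f"
        by (simp add: set_borel_measurable_def)
      show "((\<lambda>x. x\<^sup>2 / 2) has_real_derivative x) (at x)" if "x \<in> {0..real n}" for x :: real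
        by (auto intro!: derivative_eq_intros)
    qed (auto intro!: continuous_intros)
    then have "ennreal c * (\<integral>\<^sup>+t. ennreal (f t * indicator {0..(real n)\<^sup>2 / 2} t) \<partial>lborel)
      = ennreal c * (\<integral>\<^sup>+x. ennreal (f (x\<^sup>2 / 2) * x * indicator {0..real n} x) \<partial>lborel)" by simp
    also have "\<dots> = (\<integral>\<^sup>+x. ennreal c * ennreal (f (x\<^sup>2 / 2) * x * indicator {0..real n} x) \<partial>lborel)"
      by (rule nn_integral_cmult[symmetric]) measurable
    also have "\<dots> = (\<integral>\<^sup>+x. ennreal (h x * indicator {0..real n} x) \<partial>lborel)"
    proof (rule nn_integral_cong)
      fix x :: real
      have "c * (f (x\<^sup>2 / 2) * x) = h x" if "x \<ge> 0"
      proof (cases "x = 0")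
        case False
        then have x: "x > 0" using that by simp
        have "(x\<^sup>2 / 2) powr (s - 1) = (x powr 2) powr (s - 1) / 2 powr (s - 1)"
          using x by (simp add: powr_divide)
        also have "\<dots> = x powr (p - 1) / c"
        proof -
          have "2 * (s - 1) = p - 1" "s - 1 = (p - 1) / 2" by (simp_all add: s_def field_simps)
          then show ?thesis by (simp only: powr_powr c_def)
        qed
        finally have "c * (f (x\<^sup>2 / 2) * x) = x powr (p - 1) * x / exp (x\<^sup>2 / 2)"
          by (simp add: f_def c_def)
        also have "x powr (p - 1) * x = x powr p" using x by (simp add: powr_diff)
        finally show ?thesis by (simp add: h_def exp_minus field_simps)
      qed (simp add: h_def)
      then show "ennreal c * ennreal (f (x\<^sup>2 / 2) * x * indicator {0..real n} x) = ennreal (h x * indicator {0..real n} x)"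
        by (auto simp: indicator_def ennreal_mult'[symmetric] c_def)
    qed
    finally show ?thesis .
  qed
  have "(\<lambda>n. ennreal c * (\<integral>\<^sup>+t. ennreal (f t * indicator {0..(real n)\<^sup>2 / 2} t) \<partial>lborel))
     \<longlonglongrightarrow> ennreal c * (\<integral>\<^sup>+t. ennreal (f t * indicator {0..} t) \<partial>lborel)"
  proof (intro ennreal_tendsto_cmult nn_integral_LIMSEQ)
    show "incseq (\<lambda>n t. ennreal (f t * indicator {0..(real n)\<^sup>2 / 2} t))"
    proof (intro incseq_SucI le_funI ennreal_leI mult_left_mono)
      fix n :: nat and t :: real
      have "(real n)\<^sup>2 \<le> (real (Suc n))\<^sup>2" by (intro power_mono) auto
      then have "t \<le> (real (Suc n))\<^sup>2 / 2" if "t \<le> (real n)\<^sup>2 / 2" using that by linarith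
      then show "indicator {0..(real n)\<^sup>2 / 2} t \<le> (indicator {0..(real (Suc n))\<^sup>2 / 2} t :: real)"
        unfolding indicator_def by fastforce
    qed (simp add: f_def)
    fix t :: real
    show "(\<lambda>n. ennreal (f t * indicator {0..(real n)\<^sup>2 / 2} t)) \<longlonglongrightarrow> ennreal (f t * indicator {0..} t)"
    proof (rule tendsto_eventually)
      have "\<forall>\<^sub>F n in sequentially. t \<le> (real n)\<^sup>2 / 2" by real_asymp
      then show "\<forall>\<^sub>F n in sequentially. ennreal (f t * indicator {0..(real n)\<^sup>2 / 2} t) = ennreal (f t * indicator {0..} t)"
        by eventually_elim (auto simp: indicator_def)
    qed
  qed auto
  moreover have "(\<lambda>n. \<integral>\<^sup>+x. ennreal (h x * indicator {0..real n} x) \<partial>lborel) \<longlonglongrightarrow> (\<integral>\<^sup>+x. ennreal (h x * indicator {0..} x) \<partial>lborel)"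
  proof (intro nn_integral_LIMSEQ)
    show "incseq (\<lambda>n t. ennreal (h t * indicator {0..real n} t))"
      by (intro incseq_SucI le_funI ennreal_leI mult_left_mono) (auto simp: indicator_def h_def)
    fix t :: real
    show "(\<lambda>n. ennreal (h t * indicator {0..real n} t)) \<longlonglongrightarrow> ennreal (h t * indicator {0..} t)"
    proof (rule tendsto_eventually)
      have "\<forall>\<^sub>F n in sequentially. t \<le> real n" by real_asymp
      then show "\<forall>\<^sub>F n in sequentially. ennreal (h t * indicator {0..real n} t) = ennreal (h t * indicator {0..} t)"
        by eventually_elim (auto simp: indicator_def)
    qed
  qed auto
  ultimately have "(\<integral>\<^sup>+x. ennreal (h x * indicator {0..} x) \<partial>lborel) = ennreal c * (\<integral>\<^sup>+t. ennreal (f t * indicator {0..} t) \<partial>lborel)"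
    unfolding subst by (rule LIMSEQ_unique[symmetric])
  also have "(\<integral>\<^sup>+t. ennreal (f t * indicator {0..} t) \<partial>lborel) = ennreal (Gamma s)"
    using Gamma_conv_nn_integral_real[OF s(2)] by (simp add: f_def mult_ac)
  also have "ennreal c * ennreal (Gamma s) = ennreal (c * Gamma s)"
    by (rule ennreal_mult'[symmetric]) (simp add: c_def)
  finally show ?thesis by (simp add: h_def c_def s_def)
qed

lemma std_normal_abs_powr:
  assumes p: "p \<ge> 1"
  shows "has_bochner_integral lborel (\<lambda>x. std_normal_density x * \<bar>x\<bar> powr p) (gauss_abs_moment p)"
proof -
  let ?h = "\<lambda>x::real. std_normal_density x * \<bar>x\<bar> powr p"
  have G: "Gamma ((p + 1) / 2) \<ge> 0" using p by (intro less_imp_le Gamma_real_pos) auto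
  let ?I = "1 / sqrt (2 * pi) * (2 powr ((p - 1) / 2) * Gamma ((p + 1) / 2))"
  have half: "has_bochner_integral lborel (\<lambda>x. indicator {0..} x *\<^sub>R ?h x) ?I"
  proof (rule has_bochner_integral_nn_integral)
    have "(\<integral>\<^sup>+x. ennreal (indicator {0..} x *\<^sub>R ?h x) \<partial>lborel)
      = (\<integral>\<^sup>+x. ennreal (1 / sqrt (2 * pi)) * ennreal (x powr p * exp (- x\<^sup>2 / 2) * indicator {0..} x) \<partial>lborel)"
      by (intro nn_integral_cong)
        (auto simp: indicator_def std_normal_density_def ennreal_mult'[symmetric] mult_ac)
    also have "\<dots> = ennreal (1 / sqrt (2 * pi)) * ennreal (2 powr ((p - 1) / 2) * Gamma ((p + 1) / 2))"
      using nn_integral_half_gauss_powr[OF p] by (subst nn_integral_cmult) simp_all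
    finally show "(\<integral>\<^sup>+x. ennreal (indicator {0..} x *\<^sub>R ?h x) \<partial>lborel) = ennreal ?I"
      by (simp only: ennreal_mult'[symmetric] divide_nonneg_nonneg real_sqrt_ge_zero zero_le_one mult_nonneg_nonneg pi_ge_zero zero_le_numeral)
  qed (use G in auto)
  have "has_bochner_integral lborel ?h (2 *\<^sub>R ?I)"
    by (rule has_bochner_integral_even_function[OF half]) (simp add: std_normal_density_def)
  moreover have "2 *\<^sub>R ?I = gauss_abs_moment p"
  proof -
    have "2 * (1 / sqrt (2 * pi)) * 2 powr ((p - 1) / 2) = sqrt (2 powr p / pi)"
    proof -
      have "2 powr ((p - 1) / 2) = sqrt (2 powr (p - 1))"
        by (simp add: powr_half_sqrt[symmetric] powr_powr)
      then have "2 * (1 / sqrt (2 * pi)) * 2 powr ((p - 1) / 2) = sqrt (2\<^sup>2) * sqrt (1 / (2 * pi)) * sqrt (2 powr (p - 1))"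
        by (simp add: real_sqrt_divide)
      also have "\<dots> = sqrt (2\<^sup>2 * (1 / (2 * pi)) * 2 powr (p - 1))"
        by (simp only: real_sqrt_mult)
      also have "2\<^sup>2 * (1 / (2 * pi)) * 2 powr (p - 1) = 2 powr p / pi"
        by (simp add: powr_diff field_simps)
      finally show ?thesis .
    qed
    note eq = this
    have "2 *\<^sub>R ?I = 2 * (1 / sqrt (2 * pi)) * 2 powr ((p - 1) / 2) * Gamma ((p + 1) / 2)" by simp
    then show ?thesis by (simp only: eq gauss_abs_moment_def)
  qed
  ultimately show ?thesis by simp
qed

text \<open>The power \<open>y powr (p / 2)\<close> lies above its tangent at \<open>y = 1\<close>; with \<open>y = x\<^sup>2\<close> the integral of the tangent is
\<open>1\<close>, since the variance is \<open>1\<close>.\<close>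
lemma gauss_abs_moment_ge_1:
  assumes p: "p \<ge> 2"
  shows "gauss_abs_moment p \<ge> 1"
proof -
  have lower: "1 + (p / 2) * (x\<^sup>2 - 1) \<le> \<bar>x\<bar> powr p" for x :: real
  proof (cases "x = 0")
    case False
    define y where "y = (\<bar>x\<bar> powr p) powr (2 / p)"
    have y: "y = x\<^sup>2" using False p by (simp add: y_def powr_powr)
    have "(\<bar>x\<bar> powr p) powr (2 / p) * 1 powr (1 - 2 / p) \<le> 2 / p * \<bar>x\<bar> powr p + (1 - 2 / p) * 1"
      using p False by (intro Youngs_inequality_0) auto
    then have "x\<^sup>2 \<le> 2 / p * \<bar>x\<bar> powr p + (1 - 2 / p)" using y by (simp add: y_def)
    then have "p / 2 * x\<^sup>2 \<le> p / 2 * (2 / p * \<bar>x\<bar> powr p + (1 - 2 / p))"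
      using p by (intro mult_left_mono) auto
    also have "\<dots> = \<bar>x\<bar> powr p + p / 2 - 1" using p by (simp add: field_simps)
    finally show ?thesis by (simp add: algebra_simps)
  qed (use p in simp)
  have m2: "has_bochner_integral lborel (\<lambda>x. std_normal_density x * x\<^sup>2) 1"
    using std_normal_moment_even[of 1] by simp
  have m0: "has_bochner_integral lborel std_normal_density 1"
    using std_normal_moment_even[of 0] by simp
  have "has_bochner_integral lborel (\<lambda>x. (1 - p / 2) * std_normal_density x + (p / 2) * (std_normal_density x * x\<^sup>2)) ((1 - p / 2) * 1 + (p / 2) * 1)"
    by (intro has_bochner_integral_add has_bochner_integral_mult_right m2 m0)
  moreover have "(1 - p / 2) * std_normal_density x + (p / 2) * (std_normal_density x * x\<^sup>2)
      \<le> std_normal_density x * \<bar>x\<bar> powr p" for x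
  proof -
    have "std_normal_density x * (1 + (p / 2) * (x\<^sup>2 - 1)) \<le> std_normal_density x * \<bar>x\<bar> powr p"
      by (intro mult_left_mono lower) auto
    then show ?thesis by (simp add: algebra_simps)
  qed
  ultimately have "(1 - p / 2) * 1 + (p / 2) * 1 \<le> gauss_abs_moment p"
  proof -
    assume *: "has_bochner_integral lborel (\<lambda>x. (1 - p / 2) * std_normal_density x + (p / 2) * (std_normal_density x * x\<^sup>2)) ((1 - p / 2) * 1 + (p / 2) * 1)"
      and le: "\<And>x. (1 - p / 2) * std_normal_density x + (p / 2) * (std_normal_density x * x\<^sup>2)
        \<le> std_normal_density x * \<bar>x\<bar> powr p"
    have **: "has_bochner_integral lborel (\<lambda>x. std_normal_density x * \<bar>x\<bar> powr p) (gauss_abs_moment p)"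
      using p by (intro std_normal_abs_powr) simp
    show ?thesis
      unfolding has_bochner_integral_integral_eq[OF *, symmetric] has_bochner_integral_integral_eq[OF **, symmetric]
      by (rule integral_mono[OF integrable.intros[OF *] integrable.intros[OF **] le])
  qed
  then show ?thesis by simp
qed

lemma (in prob_space) normal_abs_powr:
  assumes X: "distributed M lborel X (normal_density 0 \<sigma>)" and \<sigma>: "0 < \<sigma>" and p: "p \<ge> 1"
  shows "integrable M (\<lambda>x. \<bar>X x\<bar> powr p)"
    and "expectation (\<lambda>x. \<bar>X x\<bar> powr p) = \<sigma> powr p * gauss_abs_moment p"
proof -
  have Z: "distributed M lborel (\<lambda>x. (X x - 0) / \<sigma>) std_normal_density"
    using X normal_standard_normal_convert[OF \<sigma>, of X 0] by simp
  have int: "integrable M (\<lambda>x. \<bar>(X x - 0) / \<sigma>\<bar> powr p)"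
    using distributed_integrable[OF Z, of "\<lambda>x. \<bar>x\<bar> powr p"] std_normal_abs_powr[OF p]
    by (auto simp: has_bochner_integral_iff)
  have ex: "expectation (\<lambda>x. \<bar>(X x - 0) / \<sigma>\<bar> powr p) = gauss_abs_moment p"
    using distributed_integral[OF Z, of "\<lambda>x. \<bar>x\<bar> powr p"] std_normal_abs_powr[OF p]
    by (auto simp: has_bochner_integral_iff)
  have eq: "\<bar>X x\<bar> powr p = \<sigma> powr p * \<bar>(X x - 0) / \<sigma>\<bar> powr p" for x
    using \<sigma> by (simp add: abs_divide powr_divide)
  show "integrable M (\<lambda>x. \<bar>X x\<bar> powr p)" unfolding eq using int by simp
  show "expectation (\<lambda>x. \<bar>X x\<bar> powr p) = \<sigma> powr p * gauss_abs_moment p"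
    unfolding eq using ex by simp
qed

text \<open>Jensen's inequality for the concave root, with an upper bound \<open>A\<close> in place of the expectation. Young's inequality
is the tangent line at \<open>A\<close> and also yields integrability.\<close>
lemma (in prob_space) expectation_root_le:
  fixes Y :: "'a \<Rightarrow> real" and A p :: real
  assumes Y: "integrable M Y" and nn: "\<And>x. 0 \<le> Y x" and A: "expectation Y \<le> A" and p: "p \<ge> 1"
  shows "integrable M (\<lambda>x. Y x powr (1 / p))" and "expectation (\<lambda>x. Y x powr (1 / p)) \<le> A powr (1 / p)"
proof -
  have [measurable]: "Y \<in> borel_measurable M" using Y by auto
  have young: "Y x powr (1 / p) * B powr (1 - 1 / p) \<le> 1 / p * Y x + (1 - 1 / p) * B" if "B > 0" for x B
    using Youngs_inequality_0[of "1 / p" "1 - 1 / p" "Y x" B] that p nn[of x] by (cases "Y x = 0") auto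
  show int: "integrable M (\<lambda>x. Y x powr (1 / p))"
  proof (rule Bochner_Integration.integrable_bound)
    show "integrable M (\<lambda>x. 1 / p * Y x + (1 - 1 / p) * 1)" using Y by simp
    show "AE x in M. norm (Y x powr (1 / p)) \<le> norm (1 / p * Y x + (1 - 1 / p) * 1)"
    proof (intro AE_I2)
      fix x
      show "norm (Y x powr (1 / p)) \<le> norm (1 / p * Y x + (1 - 1 / p) * 1)"
        using young[of 1 x] by simp
    qed
  qed simp
  have Y0: "0 \<le> expectation Y" by (rule integral_nonneg_AE) (simp add: nn)
  then have A0: "0 \<le> A" using A by simp
  show "expectation (\<lambda>x. Y x powr (1 / p)) \<le> A powr (1 / p)"
  proof (cases "A = 0")
    case True
    then have "expectation Y = 0" using A Y0 by simp
    then have "AE x in M. Y x = 0" using integral_nonneg_eq_0_iff_AE[OF Y] nn by simp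
    then have "AE x in M. Y x powr (1 / p) = 0" by eventually_elim simp
    then have "expectation (\<lambda>x. Y x powr (1 / p)) = 0" by (rule integral_eq_zero_AE)
    then show ?thesis by simp
  next
    case False
    then have A: "A > 0" "expectation Y \<le> A" using A A0 by auto
    have "expectation (\<lambda>x. Y x powr (1 / p)) * A powr (1 - 1 / p) = expectation (\<lambda>x. Y x powr (1 / p) * A powr (1 - 1 / p))"
      by simp
    also have "\<dots> \<le> expectation (\<lambda>x. 1 / p * Y x + (1 - 1 / p) * A)"
      using int Y by (intro integral_mono young A) auto
    also have "\<dots> = 1 / p * expectation Y + (1 - 1 / p) * A" using Y by (simp add: prob_space)
    also have "\<dots> \<le> 1 / p * A + (1 - 1 / p) * A" using A p by (intro add_mono mult_left_mono) auto
    also have "\<dots> = A powr (1 / p + (1 - 1 / p))" using A by (simp add: algebra_simps)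
    also have "\<dots> = A powr (1 / p) * A powr (1 - 1 / p)" by (rule powr_add)
    finally show ?thesis using A by simp
  qed
qed

lemma summable_geometric_powr:
  assumes "\<theta> > 0"
  shows "summable (\<lambda>k. 2 powr (- real k * \<theta>))"
proof -
  have "(2::real) powr (- real k * \<theta>) = (2 powr (- \<theta>)) ^ k" for k
    by (simp add: powr_realpow[symmetric] powr_powr mult.commute)
  moreover have "summable (\<lambda>k. (2 powr (- \<theta>)) ^ k :: real)"
    using assms by (intro summable_geometric) (simp add: powr_less_one)
  ultimately show ?thesis by simp
qed

lemma suminf_holder:
  fixes x y :: "nat \<Rightarrow> real"
  assumes pq: "p > 1" "q > 1" "1 / p + 1 / q = 1"
    and x: "\<And>k. 0 < x k" and y: "\<And>k. 0 < y k"
    and sx: "summable (\<lambda>k. x k powr p)" and sy: "summable (\<lambda>k. y k powr q)" and sxy: "summable (\<lambda>k. x k * y k)"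
  shows "(\<Sum>k. x k * y k) \<le> (\<Sum>k. x k powr p) powr (1 / p) * (\<Sum>k. y k powr q) powr (1 / q)"
proof -
  define A where "A = (\<Sum>k. x k powr p) powr (1 / p)"
  define B where "B = (\<Sum>k. y k powr q) powr (1 / q)"
  have "0 < x k powr p" "0 < y k powr q" for k
    using x[of k] y[of k] by (simp_all add: powr_gt_zero)
  then have pos: "0 < (\<Sum>k. x k powr p)" "0 < (\<Sum>k. y k powr q)"
    using suminf_pos[OF sx] suminf_pos[OF sy] by blast+
  then have AB: "A > 0" "B > 0" by (auto simp: A_def B_def)
  have Ap: "A powr p = (\<Sum>k. x k powr p)" "B powr q = (\<Sum>k. y k powr q)"
    using pos pq by (auto simp: A_def B_def powr_powr)
  have "(\<Sum>k. x k * y k) \<le> (\<Sum>k. A * B * (x k powr p * (1 / (A powr p * p)) + y k powr q * (1 / (B powr q * q))))"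
  proof (rule suminf_le[OF _ sxy])
    fix k
    have "(x k / A) * (y k / B) \<le> (x k / A) powr p / p + (y k / B) powr q / q"
      using x[of k] y[of k] AB pq by (intro Youngs_inequality) auto
    then have "A * B * ((x k / A) * (y k / B)) \<le> A * B * ((x k / A) powr p / p + (y k / B) powr q / q)"
      using AB by (intro mult_left_mono) auto
    then show "x k * y k \<le> A * B * (x k powr p * (1 / (A powr p * p)) + y k powr q * (1 / (B powr q * q)))"
      using AB x[of k] y[of k] by (simp add: powr_divide)
  qed (intro summable_mult summable_add summable_mult2 sx sy)
  also have "\<dots> = A * B * ((\<Sum>k. x k powr p) * (1 / (A powr p * p)) + (\<Sum>k. y k powr q) * (1 / (B powr q * q)))"
    by (intro sums_unique[symmetric] sums_mult sums_add sums_mult2 summable_sums sx sy)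
  also have "\<dots> = A * B * (1 / p + 1 / q)" using pos by (simp add: Ap)
  also have "\<dots> = A * B" using pq by simp
  finally show ?thesis by (simp add: A_def B_def)
qed

text \<open>The series that occurs as the last factor of \<open>d_const\<close>.\<close>
definition weight_series :: "real \<Rightarrow> real \<Rightarrow> real" where
  "weight_series \<alpha> p = (\<Sum>n. real (n + 1) powr (\<alpha> * p) * 2 powr (real n * (1 - p / 2)))"

text \<open>Hoelder's inequality for the factorization \<open>2 powr (- k \<theta>) = (k + 1) powr (- \<alpha>) * ((k + 1) powr \<alpha> * 2 powr (- k \<theta>))\<close>
with exponents \<open>p / (p - 1)\<close> and \<open>p\<close>. The condition on \<open>\<alpha>\<close> makes the series in \<open>c_const\<close> converge.\<close>
lemma geometric_sum_le_constants:
  assumes p: "p > 2" and \<alpha>: "\<alpha> > 1 - 1 / p"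
  shows "(\<Sum>k. 2 powr (- real k * (1 / 2 - 1 / p))) \<le> c_const \<alpha> p * weight_series \<alpha> p powr (1 / p)"
proof -
  define \<theta> where "\<theta> = 1 / 2 - 1 / p"
  define q where "q = p / (p - 1)"
  have \<theta>: "\<theta> > 0" "\<theta> * p = p / 2 - 1" using p by (auto simp: \<theta>_def field_simps)
  have q: "q > 1" "1 / q + 1 / p = 1" "1 / q = (p - 1) / p" using p by (auto simp: q_def field_simps)
  define x where "x k = real (Suc k) powr (- \<alpha>)" for k
  define y where "y k = real (Suc k) powr \<alpha> * 2 powr (- real k * \<theta>)" for k
  have xy: "x k * y k = 2 powr (- real k * \<theta>)" for k by (simp add: x_def y_def powr_minus)
  have xq: "x k powr q = real (Suc k) powr (- \<alpha> * (p / (p - 1)))" for k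
    by (simp add: x_def powr_powr q_def)
  have yp: "y k powr p = real (k + 1) powr (\<alpha> * p) * 2 powr (real k * (1 - p / 2))" for k
  proof -
    have "y k powr p = real (Suc k) powr (\<alpha> * p) * 2 powr (- real k * \<theta> * p)"
      by (simp add: y_def powr_mult powr_powr)
    also have "- real k * \<theta> * p = real k * (1 - p / 2)"
      using \<theta>(2) by (simp add: mult.assoc right_diff_distrib)
    finally show ?thesis by simp
  qed
  have "\<alpha> * q > 1"
  proof -
    have "\<alpha> * q > (1 - 1 / p) * q" using \<alpha> q by (intro mult_strict_right_mono) auto
    also have "(1 - 1 / p) * q = 1" using p by (simp add: q_def field_simps)
    finally show ?thesis .
  qed
  then have sx: "summable (\<lambda>k. x k powr q)"
    unfolding xq using summable_Suc_iff[of "\<lambda>n. real n powr (- \<alpha> * (p / (p - 1)))"]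
    by (simp add: summable_real_powr_iff q_def)
  have sy: "summable (\<lambda>k. y k powr p)"
  proof (rule summable_comparison_test_bigo)
    \<comment> \<open>The geometric factor beats the power, so any summable power of \<open>n\<close> can serve as a majorant.\<close>
    show "summable (\<lambda>n. norm (real n powr (- 2)))" by (simp add: summable_real_powr_iff)
    define r where "r = \<alpha> * p"
    define b where "b = p / 2 - 1"
    have b: "b > 0" using p by (simp add: b_def)
    have "(\<lambda>k. real (k + 1) powr r * 2 powr (- real k * b)) \<in> O(\<lambda>n. real n powr (- 2))"
      using b by real_asymp
    then show "(\<lambda>k. y k powr p) \<in> O(\<lambda>n. real n powr (- 2))"
      unfolding yp r_def b_def by (simp add: algebra_simps)
  qed
  have "(\<Sum>k. x k * y k) \<le> (\<Sum>k. x k powr q) powr (1 / q) * (\<Sum>k. y k powr p) powr (1 / p)"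
  proof (rule suminf_holder[OF q(1) _ q(2) _ _ sx sy])
    show "summable (\<lambda>k. x k * y k)" unfolding xy by (rule summable_geometric_powr[OF \<theta>(1)])
  qed (use p in \<open>auto simp: x_def y_def\<close>)
  then show ?thesis
    unfolding xy xq yp q(3) c_const_def weight_series_def \<theta>_def by simp
qed

lemma geometric_sum_ge_1:
  assumes "\<theta> > 0"
  shows "1 \<le> (\<Sum>k. 2 powr (- real k * \<theta>))"
  using sum_le_suminf[OF summable_geometric_powr[OF assms], of "{0}"] by simp

section \<open>The mean of the grid norm\<close>

lemma grid_norm_measurable:
  assumes "grid a b D" and G: "\<And>u. u \<in> D \<Longrightarrow> G u \<in> borel_measurable M"
  shows "(\<lambda>\<omega>. grid_norm p a b D (\<lambda>u. G u \<omega>)) \<in> borel_measurable M"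
    and "(\<lambda>\<omega>. grid_variation p a b D (\<lambda>u. G u \<omega>)) \<in> borel_measurable M"
proof -
  interpret grid a b D by fact
  have fin_d: "finite (grid_dissections a b D)" by (rule finite_grid_dissections[OF fin])
  show 1: "(\<lambda>\<omega>. grid_variation p a b D (\<lambda>u. G u \<omega>)) \<in> borel_measurable M"
    unfolding grid_variation_def
  proof (rule borel_measurable_cSUP)
    fix d assume "d \<in> grid_dissections a b D"
    then obtain n t where d: "d = (n, t)" "(n, t) \<in> grid_dissections a b D" by (cases d) auto
    have [measurable]: "G (t i) \<in> borel_measurable M" if "i \<le> n" for i
      using grid_dissections_D(2)[OF d(2) that] by (rule G)
    show "(\<lambda>\<omega>. var_sum p (\<lambda>u. G u \<omega>) d powr (1 / p)) \<in> borel_measurable M"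
      unfolding var_sum_def d(1) prod.case
      by (intro powr_real_measurable borel_measurable_sum borel_measurable_abs borel_measurable_diff) auto
  qed (use fin_d in \<open>auto intro: countable_finite\<close>)
  have "(\<lambda>\<omega>. SUP u\<in>D. \<bar>G u \<omega>\<bar>) \<in> borel_measurable M"
    by (rule borel_measurable_cSUP) (use fin G in \<open>auto intro: countable_finite\<close>)
  with 1 show "(\<lambda>\<omega>. grid_norm p a b D (\<lambda>u. G u \<omega>)) \<in> borel_measurable M"
    unfolding grid_norm_def by (rule borel_measurable_add)
qed

lemma ex_dyadic_scale:
  fixes \<delta> :: real
  assumes "0 < \<delta>" "\<delta> \<le> 1"
  shows "\<exists>m. \<delta> * 2 ^ m \<le> 1 \<and> 1 < \<delta> * 2 ^ Suc m"
proof -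
  define k where "k = nat \<lfloor>1 / \<delta>\<rfloor>"
  have "1 \<le> 1 / \<delta>" using assms by simp
  then have "1 \<le> \<lfloor>1 / \<delta>\<rfloor>" by simp
  then have k: "1 \<le> k" "real k \<le> 1 / \<delta>" "1 / \<delta> < real k + 1" unfolding k_def by linarith+
  obtain m where m: "2 ^ m \<le> k" "k < 2 ^ (m + 1)"
    using ex_power_ivl1[of 2 k] k(1) by auto
  have "2 ^ m \<le> real k" "real k + 1 \<le> 2 ^ Suc m"
  proof -
    show "2 ^ m \<le> real k" using m(1) by (metis of_nat_le_iff of_nat_numeral of_nat_power)
    have "k + 1 \<le> 2 ^ Suc m" using m(2) by simp
    then have "real (k + 1) \<le> real (2 ^ Suc m)" by (simp only: of_nat_le_iff)
    then show "real k + 1 \<le> 2 ^ Suc m" by simp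
  qed
  with k have "2 ^ m \<le> 1 / \<delta>" "1 / \<delta> < 2 ^ Suc m" by linarith+
  then show ?thesis using assms(1) by (intro exI[of _ m]) (simp add: field_simps)
qed

text \<open>Chaining starts at the level \<open>m\<close> with \<open>1 / 2 ^ (m + 1) < \<delta> \<le> 1 / 2 ^ m\<close>. The \<open>2 ^ m + 1 \<le> 2 / \<delta>\<close> values at that
level have \<open>p\<close>-th moment of order \<open>\<delta> powr (p / 2)\<close>, and the \<open>2 ^ n\<close> increments at a finer level \<open>n\<close> contribute a
geometric term of ratio \<open>2 powr (- \<theta>)\<close> that is already below \<open>\<delta> powr \<theta>\<close> at \<open>n = m + 1\<close>. Both
parts therefore scale like \<open>\<delta> powr \<theta>\<close>.\<close>
lemma (in prob_space) expectation_grid_norm_le: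
  fixes G :: "real \<Rightarrow> 'a \<Rightarrow> real"
  assumes p: "p > 2" and \<delta>: "0 < \<delta>" "\<delta> \<le> 1" and C: "0 \<le> C"
    and meas: "\<And>u. u \<in> {0..1} \<Longrightarrow> G u \<in> borel_measurable M"
    and size: "\<And>u. u \<in> {0..1} \<Longrightarrow> integrable M (\<lambda>\<omega>. \<bar>G u \<omega>\<bar> powr p)"
      "\<And>u. u \<in> {0..1} \<Longrightarrow> expectation (\<lambda>\<omega>. \<bar>G u \<omega>\<bar> powr p) \<le> \<delta> powr (p / 2) * C"
    and incr: "\<And>u v. 0 \<le> u \<Longrightarrow> u < v \<Longrightarrow> v \<le> 1 \<Longrightarrow> integrable M (\<lambda>\<omega>. \<bar>G v \<omega> - G u \<omega>\<bar> powr p)"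
      "\<And>u v. 0 \<le> u \<Longrightarrow> u < v \<Longrightarrow> v \<le> 1 \<Longrightarrow>
        expectation (\<lambda>\<omega>. \<bar>G v \<omega> - G u \<omega>\<bar> powr p) \<le> 2 powr p * (v - u) powr (p / 2) * C"
  defines "\<theta> \<equiv> 1 / 2 - 1 / p"
  shows "integrable M (\<lambda>\<omega>. grid_norm p 0 1 (dyadic_grid 0 1 N) (\<lambda>u. G u \<omega>))"
    and "expectation (\<lambda>\<omega>. grid_norm p 0 1 (dyadic_grid 0 1 N) (\<lambda>u. G u \<omega>))
      \<le> 3 * C powr (1 / p) * \<delta> powr \<theta> * (\<Sum>k. 2 powr (- real k * \<theta>)) * (2 powr (1 / p) + 2)"
proof -
  have \<theta>: "\<theta> > 0" using p by (simp add: \<theta>_def field_simps)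
  define R where "R = (\<Sum>k. 2 powr (- real k * \<theta>))"
  have R1: "1 \<le> R" unfolding R_def by (rule geometric_sum_ge_1[OF \<theta>])
  obtain m where m: "\<delta> * 2 ^ m \<le> 1" "1 < \<delta> * 2 ^ Suc m"
    using ex_dyadic_scale[OF \<delta>] by blast
  \<comment> \<open>Coarse grids are contained in finer ones, so it suffices to treat a grid of level at least \<open>m\<close>.\<close>
  define L where "L = max N m"
  define A where "A \<omega> = (\<Sum>k\<le>2 ^ m. \<bar>G (real k / 2 ^ m) \<omega>\<bar> powr p)" for \<omega>
  define B where "B n \<omega> = (\<Sum>k<2 ^ n. \<bar>G (real (Suc k) / 2 ^ n) \<omega> - G (real k / 2 ^ n) \<omega>\<bar> powr p)" for n \<omega>
  \<comment> \<open>The chaining bound for the grid of level \<open>L\<close>.\<close>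
  define H where "H \<omega> = 3 * A \<omega> powr (1 / p) + (\<Sum>n\<in>{m<..L}. 3 * B n \<omega> powr (1 / p))" for \<omega>
  have unit: "real k / 2 ^ n \<in> {0..1}" if "k \<le> 2 ^ n" for k n :: nat
  proof -
    have "real k \<le> 2 ^ n" using that by (metis of_nat_le_iff of_nat_numeral of_nat_power)
    then show ?thesis by simp
  qed
  have A: "integrable M A" "expectation A \<le> 2 * \<delta> powr (p / 2 - 1) * C"
  proof -
    show "integrable M A" unfolding A_def using unit by (intro Bochner_Integration.integrable_sum size) auto
    have "expectation A = (\<Sum>k\<le>2 ^ m. expectation (\<lambda>\<omega>. \<bar>G (real k / 2 ^ m) \<omega>\<bar> powr p))"
      unfolding A_def using unit by (intro Bochner_Integration.integral_sum size) auto
    also have "\<dots> \<le> (\<Sum>k\<le>(2::nat) ^ m. \<delta> powr (p / 2) * C)"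
      using unit by (intro sum_mono size) auto
    also have "\<dots> = (2 ^ m + 1) * (\<delta> powr (p / 2) * C)" by simp
    also have "\<dots> \<le> (2 / \<delta>) * (\<delta> powr (p / 2) * C)"
    proof (intro mult_right_mono)
      have "(1::real) \<le> 2 ^ m" by simp
      then show "2 ^ m + 1 \<le> 2 / \<delta>" using m(1) \<delta> by (simp add: field_simps)
    qed (use C in simp)
    also have "\<dots> = 2 * \<delta> powr (p / 2 - 1) * C" using \<delta> by (simp add: powr_diff)
    finally show "expectation A \<le> 2 * \<delta> powr (p / 2 - 1) * C" .
  qed
  have B: "integrable M (B n)" "expectation (B n) \<le> 2 powr p * 2 powr (real n * (1 - p / 2)) * C" for n
  proof -
    have inc: "0 \<le> real k / 2 ^ n" "real k / 2 ^ n < real (Suc k) / 2 ^ n" "real (Suc k) / 2 ^ n \<le> 1"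
      if "k < 2 ^ n" for k
      using unit[of "Suc k" n] that by (auto simp: divide_strict_right_mono)
    show "integrable M (B n)" unfolding B_def using inc by (intro Bochner_Integration.integrable_sum incr) auto
    have "expectation (B n) = (\<Sum>k<2 ^ n. expectation (\<lambda>\<omega>. \<bar>G (real (Suc k) / 2 ^ n) \<omega> - G (real k / 2 ^ n) \<omega>\<bar> powr p))"
      unfolding B_def using inc by (intro Bochner_Integration.integral_sum incr) auto
    also have "\<dots> \<le> (\<Sum>k<(2::nat) ^ n. 2 powr p * (1 / 2 ^ n) powr (p / 2) * C)"
    proof (rule sum_mono)
      fix k assume "k \<in> {..<(2::nat) ^ n}"
      then have k: "k < 2 ^ n" by simp
      have "real (Suc k) / 2 ^ n - real k / 2 ^ n = 1 / 2 ^ n" by (simp add: diff_divide_distrib[symmetric])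
      then show "expectation (\<lambda>\<omega>. \<bar>G (real (Suc k) / 2 ^ n) \<omega> - G (real k / 2 ^ n) \<omega>\<bar> powr p)
         \<le> 2 powr p * (1 / 2 ^ n) powr (p / 2) * C"
        using incr(2)[OF inc[OF k]] by simp
    qed
    also have "\<dots> = 2 powr p * (2 ^ n * (1 / 2 ^ n) powr (p / 2)) * C" by simp
    also have "(2::real) ^ n * (1 / 2 ^ n) powr (p / 2) = 2 powr (real n * (1 - p / 2))"
    proof -
      have "(2::real) ^ n = 2 powr real n" by (simp add: powr_realpow)
      moreover have "(1 / 2 powr real n) powr (p / 2) = 2 powr (- (real n * (p / 2)))"
        by (simp add: powr_divide powr_powr powr_minus_divide)
      ultimately have "(2::real) ^ n * (1 / 2 ^ n) powr (p / 2) = 2 powr real n * 2 powr (- (real n * (p / 2)))"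
        by simp
      also have "\<dots> = 2 powr (real n * (1 - p / 2))"
        by (simp add: powr_add[symmetric] right_diff_distrib)
      finally show ?thesis .
    qed
    finally show "expectation (B n) \<le> 2 powr p * 2 powr (real n * (1 - p / 2)) * C" .
  qed
  have A0: "0 \<le> A \<omega>" and B0: "0 \<le> B n \<omega>" for n \<omega> by (auto simp: A_def B_def intro: sum_nonneg)
  have p1: "p \<ge> 1" using p by simp
  have rootA: "integrable M (\<lambda>\<omega>. A \<omega> powr (1 / p))"
    "expectation (\<lambda>\<omega>. A \<omega> powr (1 / p)) \<le> 2 powr (1 / p) * \<delta> powr \<theta> * C powr (1 / p)"
  proof -
    show "integrable M (\<lambda>\<omega>. A \<omega> powr (1 / p))" by (rule expectation_root_le(1)[OF A(1) A0 A(2) p1])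
    have "expectation (\<lambda>\<omega>. A \<omega> powr (1 / p)) \<le> (2 * \<delta> powr (p / 2 - 1) * C) powr (1 / p)"
      by (rule expectation_root_le(2)[OF A(1) A0 A(2) p1])
    also have "\<dots> = 2 powr (1 / p) * \<delta> powr ((p / 2 - 1) * (1 / p)) * C powr (1 / p)"
      by (simp add: powr_mult powr_powr)
    also have "(p / 2 - 1) * (1 / p) = \<theta>" using p by (simp add: \<theta>_def field_simps)
    finally show "expectation (\<lambda>\<omega>. A \<omega> powr (1 / p)) \<le> 2 powr (1 / p) * \<delta> powr \<theta> * C powr (1 / p)" .
  qed
  have rootB: "integrable M (\<lambda>\<omega>. B n \<omega> powr (1 / p))"
    "expectation (\<lambda>\<omega>. B n \<omega> powr (1 / p)) \<le> 2 * 2 powr (- real n * \<theta>) * C powr (1 / p)" for n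
  proof -
    show "integrable M (\<lambda>\<omega>. B n \<omega> powr (1 / p))" by (rule expectation_root_le(1)[OF B(1) B0 B(2) p1])
    have "expectation (\<lambda>\<omega>. B n \<omega> powr (1 / p)) \<le> (2 powr p * 2 powr (real n * (1 - p / 2)) * C) powr (1 / p)"
      by (rule expectation_root_le(2)[OF B(1) B0 B(2) p1])
    also have "\<dots> = 2 * 2 powr (real n * (1 - p / 2) * (1 / p)) * C powr (1 / p)"
      using p by (simp add: powr_mult powr_powr)
    also have "real n * (1 - p / 2) * (1 / p) = - real n * \<theta>" using p by (simp add: \<theta>_def field_simps)
    finally show "expectation (\<lambda>\<omega>. B n \<omega> powr (1 / p)) \<le> 2 * 2 powr (- real n * \<theta>) * C powr (1 / p)" .
  qed
  have H_int: "integrable M H"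
    unfolding H_def by (intro Bochner_Integration.integrable_add Bochner_Integration.integrable_sum integrable_mult_right rootA rootB)
  have geo: "(\<Sum>n\<in>{m<..L}. 2 powr (- real n * \<theta>)) \<le> \<delta> powr \<theta> * R"
  proof -
    have "(\<Sum>n\<in>{m<..L}. 2 powr (- real n * \<theta>)) = (\<Sum>k<L - m. 2 powr (- real (Suc m + k) * \<theta>))"
      by (rule sum.reindex_bij_witness[of _ "\<lambda>k. Suc m + k" "\<lambda>n. n - Suc m"]) auto
    also have "\<dots> = 2 powr (- real (Suc m) * \<theta>) * (\<Sum>k<L - m. 2 powr (- real k * \<theta>))"
      by (simp add: sum_distrib_left powr_add[symmetric] algebra_simps)
    also have "\<dots> \<le> \<delta> powr \<theta> * R"
    proof (intro mult_mono)
      have "2 powr (- real (Suc m) * \<theta>) = (1 / 2 ^ Suc m) powr \<theta>"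
        by (simp add: powr_divide powr_minus_divide powr_powr powr_realpow[symmetric] del: power_Suc of_nat_Suc)
      also have "\<dots> \<le> \<delta> powr \<theta>"
        using m(2) \<theta> by (intro powr_mono2) (auto simp: field_simps)
      finally show "2 powr (- real (Suc m) * \<theta>) \<le> \<delta> powr \<theta>" .
      show "(\<Sum>k<L - m. 2 powr (- real k * \<theta>)) \<le> R"
        unfolding R_def by (intro sum_le_suminf summable_geometric_powr \<theta>) auto
    qed (auto intro: sum_nonneg)
    finally show ?thesis .
  qed
  have H_mean: "expectation H \<le> 3 * C powr (1 / p) * \<delta> powr \<theta> * R * (2 powr (1 / p) + 2)"
  proof -
    have "expectation H = 3 * expectation (\<lambda>\<omega>. A \<omega> powr (1 / p)) + (\<Sum>n\<in>{m<..L}. 3 * expectation (\<lambda>\<omega>. B n \<omega> powr (1 / p)))"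
      unfolding H_def using rootA rootB by simp
    also have "\<dots> \<le> 3 * (2 powr (1 / p) * \<delta> powr \<theta> * C powr (1 / p))
        + (\<Sum>n\<in>{m<..L}. 3 * (2 * 2 powr (- real n * \<theta>) * C powr (1 / p)))"
      by (intro add_mono sum_mono mult_left_mono rootA rootB) auto
    also have "\<dots> = 3 * C powr (1 / p) * (2 powr (1 / p) * \<delta> powr \<theta> * 1 + 2 * (\<Sum>n\<in>{m<..L}. 2 powr (- real n * \<theta>)))"
      by (simp add: sum_distrib_left distrib_left mult_ac)
    also have "\<dots> \<le> 3 * C powr (1 / p) * (2 powr (1 / p) * \<delta> powr \<theta> * R + 2 * (\<delta> powr \<theta> * R))"
      using R1 geo by (intro mult_left_mono add_mono) auto
    finally show ?thesis by (simp add: algebra_simps)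
  qed
  have grid01: "grid 0 1 (dyadic_grid 0 1 n)" for n by (rule grid_dyadic) simp
  have le_H: "grid_norm p 0 1 (dyadic_grid 0 1 N) (\<lambda>u. G u \<omega>) \<le> H \<omega>" for \<omega>
  proof -
    have "grid_norm p 0 1 (dyadic_grid 0 1 N) (\<lambda>u. G u \<omega>) \<le> grid_norm p 0 1 (dyadic_grid 0 1 L) (\<lambda>u. G u \<omega>)"
      by (intro grid_norm_mono grid01 dyadic_grid_mono) (simp add: L_def)
    also have "\<dots> \<le> H \<omega>"
      unfolding H_def A_def B_def by (rule grid_norm_chaining[OF p1]) (simp add: L_def)
    finally show ?thesis .
  qed
  have [measurable]: "(\<lambda>\<omega>. grid_norm p 0 1 (dyadic_grid 0 1 N) (\<lambda>u. G u \<omega>)) \<in> borel_measurable M"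
    using dyadic_grid_subset[of 0 1 N] by (intro grid_norm_measurable grid01 meas) auto
  show int: "integrable M (\<lambda>\<omega>. grid_norm p 0 1 (dyadic_grid 0 1 N) (\<lambda>u. G u \<omega>))"
  proof (rule Bochner_Integration.integrable_bound[OF H_int])
    show "AE \<omega> in M. norm (grid_norm p 0 1 (dyadic_grid 0 1 N) (\<lambda>u. G u \<omega>)) \<le> norm (H \<omega>)"
      using le_H grid.norm_nonneg[OF grid01] by (intro AE_I2) (smt (verit) real_norm_def)
  qed measurable
  show "expectation (\<lambda>\<omega>. grid_norm p 0 1 (dyadic_grid 0 1 N) (\<lambda>u. G u \<omega>))
      \<le> 3 * C powr (1 / p) * \<delta> powr \<theta> * (\<Sum>k. 2 powr (- real k * \<theta>)) * (2 powr (1 / p) + 2)"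
    using integral_mono[OF int H_int le_H] H_mean unfolding R_def by simp
qed

section \<open>Brownian motion on a finite grid\<close>

lemma finite_set_increasing_enumeration:
  fixes T :: "real set"
  assumes "finite T" "card T \<ge> 2"
  shows "\<exists>(n::nat) \<tau>. n \<ge> 1 \<and> strict_mono_on {..n} \<tau> \<and> \<tau> ` {..n} = T"
proof -
  define xs where "xs = sorted_list_of_set T"
  have len: "length xs = card T" and set: "set xs = T" and sorted: "sorted_wrt (<) xs"
    using assms(1) by (simp_all add: xs_def)
  have "strict_mono_on {..card T - 1} (\<lambda>i. xs ! i)"
    using assms(2) len by (intro strict_mono_onI sorted_wrt_nth_less[OF sorted]) auto
  moreover have "(\<lambda>i. xs ! i) ` {..card T - 1} = T"
  proof -
    have "{..card T - 1} = {..<length xs}" using assms(2) len by auto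
    then show ?thesis using set nth_image[of "length xs" xs] by (simp add: lessThan_atLeast0)
  qed
  ultimately show ?thesis using assms(2) by (intro exI[of _ "card T - 1"] exI[of _ "\<lambda>i. xs ! i"]) auto
qed

text \<open>A path that jumps by \<open>w i\<close> at time \<open>\<tau> (Suc i)\<close>; at the grid points it agrees with any path started from \<open>0\<close> at
\<open>\<tau> 0\<close> that has increments \<open>w\<close>.\<close>
definition step_path :: "nat \<Rightarrow> (nat \<Rightarrow> real) \<Rightarrow> (nat \<Rightarrow> real) \<Rightarrow> real \<Rightarrow> real" where
  "step_path n \<tau> w t = (\<Sum>i\<in>{i. i < n \<and> \<tau> (Suc i) \<le> t}. w i)"

lemma step_path_at:
  assumes \<tau>: "strict_mono_on {..n} \<tau>" and j: "j \<le> n"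
  shows "step_path n \<tau> w (\<tau> j) = (\<Sum>i<j. w i)"
proof -
  have less: "\<tau> i < \<tau> j" if "i < j" "j \<le> n" for i j
    using strict_mono_onD[OF \<tau>, of i j] that by simp
  have "\<tau> (Suc i) \<le> \<tau> j \<longleftrightarrow> i < j" if "i < n" for i
  proof
    show "i < j" if "\<tau> (Suc i) \<le> \<tau> j"
    proof (rule ccontr)
      assume "\<not> i < j"
      then have "\<tau> j < \<tau> (Suc i)" using \<open>i < n\<close> by (intro less) auto
      then show False using that by simp
    qed
    show "\<tau> (Suc i) \<le> \<tau> j" if "i < j"
      using less[of "Suc i" j] that j by (cases "Suc i = j") auto
  qed
  then have "{i. i < n \<and> \<tau> (Suc i) \<le> \<tau> j} = {..<j}" using j by auto
  then show ?thesis by (simp add: step_path_def)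
qed

lemma step_path_energy:
  fixes z :: "nat \<Rightarrow> real"
  assumes \<tau>: "strict_mono_on {..n} \<tau>"
    and st: "s \<in> \<tau> ` {..n}" "t \<in> \<tau> ` {..n}" "s \<le> t"
  defines "f \<equiv> step_path n \<tau> (\<lambda>i. sqrt (\<tau> (Suc i) - \<tau> i) * z i)" and "V \<equiv> step_path n \<tau> (\<lambda>i. (z i)\<^sup>2)"
  shows "V s \<le> V t" and "(f t - f s)\<^sup>2 \<le> (t - s) * (V t - V s)"
proof -
  have less: "\<tau> i < \<tau> j" if "i < j" "j \<le> n" for i j
    using strict_mono_onD[OF \<tau>, of i j] that by simp
  obtain j k where j: "j \<le> n" "s = \<tau> j" and k: "k \<le> n" "t = \<tau> k" using st by auto
  have jk: "j \<le> k"
  proof (rule ccontr)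
    assume "\<not> j \<le> k"
    then have "\<tau> k < \<tau> j" using j by (intro less) auto
    then show False using st(3) j k by simp
  qed
  have diff: "step_path n \<tau> w t - step_path n \<tau> w s = (\<Sum>i=j..<k. w i)" for w
  proof -
    have "{..<k} = {..<j} \<union> {j..<k}" "{..<j} \<inter> {j..<k} = {}" using jk by auto
    then have "(\<Sum>i<k. w i) = (\<Sum>i<j. w i) + (\<Sum>i=j..<k. w i)"
      by (simp add: sum.union_disjoint)
    then show ?thesis unfolding j(2) k(2) using step_path_at[OF \<tau>] j(1) k(1) by simp
  qed
  have "0 \<le> V t - V s" unfolding V_def diff by (intro sum_nonneg) auto
  then show "V s \<le> V t" by simp
  have "(f t - f s)\<^sup>2 \<le> (\<Sum>i=j..<k. (sqrt (\<tau> (Suc i) - \<tau> i))\<^sup>2) * (\<Sum>i=j..<k. (z i)\<^sup>2)"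
    unfolding f_def diff by (rule Cauchy_Schwarz_ineq_sum)
  also have "(\<Sum>i=j..<k. (sqrt (\<tau> (Suc i) - \<tau> i))\<^sup>2) = (\<Sum>i=j..<k. \<tau> (Suc i) - \<tau> i)"
    using less[of _ "Suc _"] k(1) by (intro sum.cong real_sqrt_pow2) (auto simp: less_imp_le)
  also have "\<dots> = t - s" using sum_Suc_diff'[OF jk, of \<tau>] j k by simp
  also have "(\<Sum>i=j..<k. (z i)\<^sup>2) = V t - V s" unfolding V_def diff ..
  finally show "(f t - f s)\<^sup>2 \<le> (t - s) * (V t - V s)" .
qed

lemma brownian_increment_measurable:
  assumes "brownian_motion_on M a b X" "a \<le> s" "s < t" "t \<le> b"
  shows "(\<lambda>\<omega>. X t \<omega> - X s \<omega>) \<in> borel_measurable M"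
proof -
  have "distributed M lborel (\<lambda>\<omega>. X t \<omega> - X s \<omega>) (normal_density 0 (sqrt (t - s)))"
    using assms by (simp add: brownian_motion_on_def)
  then show ?thesis by (auto dest: distributed_measurable)
qed

lemma brownian_measurable:
  assumes B: "brownian_motion_on M a b X" and t: "a \<le> t" "t \<le> b"
  shows "X t \<in> borel_measurable M"
proof -
  have X0: "X a \<omega> = 0" if "\<omega> \<in> space M" for \<omega> using B that by (auto simp: brownian_motion_on_def)
  show ?thesis
  proof (cases "t = a")
    case True
    then show ?thesis using X0 by (subst measurable_cong[where g = "\<lambda>_. 0"]) auto
  next
    case False
    then have "(\<lambda>\<omega>. X t \<omega> - X a \<omega>) \<in> borel_measurable M"
      using t by (intro brownian_increment_measurable[OF B]) auto
    then show ?thesis using X0 by (subst measurable_cong[where g = "\<lambda>\<omega>. X t \<omega> - X a \<omega>"]) auto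
  qed
qed

lemma (in prob_space) brownian_abs_moment:
  assumes B: "brownian_motion_on M a b X" and st: "a \<le> s" "s < t" "t \<le> b" and p: "p \<ge> 1"
  shows "integrable M (\<lambda>\<omega>. \<bar>X t \<omega> - X s \<omega>\<bar> powr p)"
    and "expectation (\<lambda>\<omega>. \<bar>X t \<omega> - X s \<omega>\<bar> powr p) = (t - s) powr (p / 2) * gauss_abs_moment p"
proof -
  have d: "distributed M lborel (\<lambda>\<omega>. X t \<omega> - X s \<omega>) (normal_density 0 (sqrt (t - s)))"
    using B st by (simp add: brownian_motion_on_def)
  have pos: "0 < sqrt (t - s)" using st by simp
  show "integrable M (\<lambda>\<omega>. \<bar>X t \<omega> - X s \<omega>\<bar> powr p)"
    by (rule normal_abs_powr(1)[OF d pos p])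
  have "sqrt (t - s) powr p = (t - s) powr (p / 2)"
    using st by (simp add: powr_half_sqrt[symmetric] powr_powr)
  then show "expectation (\<lambda>\<omega>. \<bar>X t \<omega> - X s \<omega>\<bar> powr p) = (t - s) powr (p / 2) * gauss_abs_moment p"
    using normal_abs_powr(2)[OF d pos p] by simp
qed

lemma (in prob_space) brownian_increments_distr:
  assumes B: "brownian_motion_on M a b X" and n: "n \<ge> 1"
    and \<tau>: "strict_mono_on {..n} \<tau>" and ends: "a \<le> \<tau> 0" "\<tau> n \<le> b"
  defines "Z \<equiv> \<lambda>i \<omega>. (X (\<tau> (Suc i)) \<omega> - X (\<tau> i) \<omega>) / sqrt (\<tau> (Suc i) - \<tau> i)"
  shows "(\<lambda>\<omega>. \<lambda>i\<in>{..<n}. Z i \<omega>) \<in> measurable M (gauss {..<n})"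
    and "distr M (gauss {..<n}) (\<lambda>\<omega>. \<lambda>i\<in>{..<n}. Z i \<omega>) = gauss {..<n}"
proof -
  have less: "\<tau> i < \<tau> j" if "i < j" "j \<le> n" for i j
    using strict_mono_onD[OF \<tau>, of i j] that by simp
  have mem: "a \<le> \<tau> i" "\<tau> i \<le> b" if "i \<le> n" for i
    using less[of 0 i] less[of i n] ends that by (cases "i = 0"; cases "i = n"; force)+
  have std: "distributed M lborel (Z i) std_normal_density" if "i < n" for i
  proof -
    have lt: "\<tau> i < \<tau> (Suc i)" using less that by simp
    have "distributed M lborel (\<lambda>\<omega>. X (\<tau> (Suc i)) \<omega> - X (\<tau> i) \<omega>) (normal_density 0 (sqrt (\<tau> (Suc i) - \<tau> i)))"
      using B lt mem[of i] mem[of "Suc i"] that by (simp add: brownian_motion_on_def)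
    then show ?thesis
      using lt normal_standard_normal_convert[of "sqrt (\<tau> (Suc i) - \<tau> i)" _ 0] by (simp add: Z_def)
  qed
  have rv: "random_variable borel (Z i)" if "i < n" for i
    using distributed_measurable[OF std[OF that]] by simp
  have dist1: "distr M borel (Z i) = std_gauss" if "i < n" for i
  proof -
    have "distr M borel (Z i) = distr M lborel (Z i)" by (rule distr_cong) auto
    also have "\<dots> = std_gauss"
      using distributed_distr_eq_density[OF std[OF that]] by (simp add: std_gauss_def)
    finally show ?thesis .
  qed
  have "indep_vars (\<lambda>_. borel) (\<lambda>i \<omega>. X (\<tau> (Suc i)) \<omega> - X (\<tau> i) \<omega>) {..<n}"
    using B ends less by (simp add: brownian_motion_on_def)
  then have "indep_vars (\<lambda>_. borel) Z {..<n}"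
    unfolding Z_def by (rule indep_vars_compose2) measurable
  then have eq: "distr M (PiM {..<n} (\<lambda>_. borel)) (\<lambda>\<omega>. \<lambda>i\<in>{..<n}. Z i \<omega>) = PiM {..<n} (\<lambda>i. distr M borel (Z i))"
    using n rv by (subst (asm) indep_vars_iff_distr_eq_PiM') (auto simp: lessThan_empty_iff)
  have sets: "sets (gauss {..<n}) = sets (PiM {..<n} (\<lambda>_. borel))"
    by (intro sets_PiM_cong) (auto simp: sets_std_gauss)
  show "(\<lambda>\<omega>. \<lambda>i\<in>{..<n}. Z i \<omega>) \<in> measurable M (gauss {..<n})"
    using rv by (intro measurable_restrict) (auto cong: measurable_cong_sets simp: sets_std_gauss)
  have "distr M (gauss {..<n}) (\<lambda>\<omega>. \<lambda>i\<in>{..<n}. Z i \<omega>) = distr M (PiM {..<n} (\<lambda>_. borel)) (\<lambda>\<omega>. \<lambda>i\<in>{..<n}. Z i \<omega>)"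
    by (intro distr_cong sets) auto
  also have "\<dots> = gauss {..<n}" unfolding eq by (intro PiM_cong) (auto simp: dist1)
  finally show "distr M (gauss {..<n}) (\<lambda>\<omega>. \<lambda>i\<in>{..<n}. Z i \<omega>) = gauss {..<n}" .
qed

text \<open>The grid norm depends on the path only at the finitely many times \<open>c + u\<close> and \<open>c + \<delta> + u\<close>, hence only on
the increments between consecutive such times. Scaled by the square roots of the time gaps these are independent
standard normals, and in terms of them the energy is the squared Euclidean norm. So \<open>norm_le_energy\<close> says that
the grid norm is \<open>3 sqrt \<delta>\<close>-Lipschitz.\<close>
lemma (in prob_space) brownian_grid_concentration:
  assumes B: "brownian_motion_on M a b X" and p: "p \<ge> 2" and \<delta>: "0 < \<delta>"
    and D: "grid 0 1 D" "D \<subseteq> {0..1}" and c: "a \<le> c" "c + \<delta> + 1 \<le> b"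
  defines "F \<equiv> \<lambda>\<omega>. grid_norm p 0 1 D (\<lambda>u. X (c + \<delta> + u) \<omega> - X (c + u) \<omega>)"
  assumes int: "integrable M F" and mean: "expectation F \<le> \<mu>" and t: "0 < t"
  shows "prob {\<omega> \<in> space M. \<mu> + t \<le> F \<omega>} \<le> exp (- (t\<^sup>2 / (18 * \<delta>)))"
proof -
  interpret D: grid 0 1 D by fact
  define T where "T = (\<lambda>u. c + u) ` D \<union> (\<lambda>u. c + \<delta> + u) ` D"
  have T_fin: "finite T" using D.fin by (simp add: T_def)
  have "{c + 0, c + 1} \<subseteq> T" using D.ends unfolding T_def by blast
  then have "card {c + 0, c + 1} \<le> card T" using T_fin by (intro card_mono)
  then have T_card: "card T \<ge> 2" by simp
  obtain n :: nat and \<tau> :: "nat \<Rightarrow> real" where n: "n \<ge> 1" and \<tau>: "strict_mono_on {..n} \<tau>" and T: "\<tau> ` {..n} = T"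
    using finite_set_increasing_enumeration[OF T_fin T_card] by blast
  have T_sub: "T \<subseteq> {a..b}" using D(2) c \<delta> by (force simp: T_def)
  have ends: "a \<le> \<tau> 0" "\<tau> n \<le> b" using T T_sub by auto
  define Z where "Z i \<omega> = (X (\<tau> (Suc i)) \<omega> - X (\<tau> i) \<omega>) / sqrt (\<tau> (Suc i) - \<tau> i)" for i \<omega>
  note Z = brownian_increments_distr[OF B n \<tau> ends, folded Z_def]
  define path where "path w = step_path n \<tau> (\<lambda>i. sqrt (\<tau> (Suc i) - \<tau> i) * w i)" for w :: "nat \<Rightarrow> real"
  define \<Phi> where "\<Phi> w = grid_norm p 0 1 D (\<lambda>u. path w (c + \<delta> + u) - path w (c + u))" for w
  have mem: "c + u \<in> T" "c + \<delta> + u \<in> T" if "u \<in> D" for u using that by (auto simp: T_def)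
  have path_meas[measurable]: "(\<lambda>w. path w s) \<in> borel_measurable (gauss {..<n})" for s
  proof -
    have [measurable]: "(\<lambda>w. w i) \<in> borel_measurable (gauss {..<n})" if "i < n" for i
    proof -
      have "(\<lambda>w. w i) \<in> measurable (gauss {..<n}) std_gauss" using that by simp
      then show ?thesis by (simp add: sets_std_gauss cong: measurable_cong_sets)
    qed
    show ?thesis unfolding path_def step_path_def
      by (intro borel_measurable_sum borel_measurable_times) auto
  qed
  have \<Phi>_meas: "\<Phi> \<in> borel_measurable (gauss {..<n})"
    unfolding \<Phi>_def by (intro grid_norm_measurable D borel_measurable_diff path_meas)
  have p1: "p \<ge> 1" using p by simp
  have lip: "\<bar>\<Phi> x - \<Phi> y\<bar> \<le> 3 * sqrt \<delta> * sqrt (\<Sum>i<n. (x i - y i)\<^sup>2)" for x y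
  proof -
    define z where "z i = x i - y i" for i
    define V where "V = step_path n \<tau> (\<lambda>i. (z i)\<^sup>2)"
    have lin: "path x s - path y s = path z s" for s
      unfolding path_def step_path_def z_def by (simp add: sum_subtractf right_diff_distrib)
    have "\<bar>\<Phi> x - \<Phi> y\<bar> \<le> grid_norm p 0 1 D (\<lambda>u. (path x (c + \<delta> + u) - path x (c + u)) - (path y (c + \<delta> + u) - path y (c + u)))"
      unfolding \<Phi>_def by (rule D.norm_diff_le[OF p1])
    also have "\<dots> = grid_norm p 0 1 D (\<lambda>u. path z (c + \<delta> + u) - path z (c + u))"
      unfolding lin[symmetric] by (simp add: algebra_simps)
    also have "\<dots> \<le> 3 * (sqrt \<delta> * sqrt (\<Sum>i<n. (z i)\<^sup>2))"
    proof (rule D.norm_le_energy[OF p \<delta>, where T = T and W = V])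
      fix s t assume "s \<in> T" "t \<in> T" "s \<le> t"
      then show "V s \<le> V t \<and> (path z t - path z s)\<^sup>2 \<le> (t - s) * (V t - V s)"
        using step_path_energy[OF \<tau>, of s t z] unfolding T V_def path_def by blast
    next
      fix t
      show "0 \<le> V t \<and> V t \<le> (\<Sum>i<n. (z i)\<^sup>2)"
        unfolding V_def step_path_def by (auto intro!: sum_nonneg sum_mono2)
    next
      fix u assume "u \<in> D"
      then show "c + u \<in> T \<and> c + \<delta> + u \<in> T" using mem by blast
    qed
    finally show ?thesis by (simp add: z_def mult.assoc)
  qed
  have F_eq: "\<Phi> (\<lambda>i\<in>{..<n}. Z i \<omega>) = F \<omega>" for \<omega>
  proof -
    have path_Z: "path (\<lambda>i\<in>{..<n}. Z i \<omega>) s = X s \<omega> - X (\<tau> 0) \<omega>" if s: "s \<in> T" for s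
    proof -
      obtain j where j: "j \<le> n" "s = \<tau> j" using s T by auto
      have "path (\<lambda>i\<in>{..<n}. Z i \<omega>) s = (\<Sum>i<j. sqrt (\<tau> (Suc i) - \<tau> i) * (\<lambda>i\<in>{..<n}. Z i \<omega>) i)"
        unfolding path_def j(2) by (rule step_path_at[OF \<tau> j(1)])
      also have "\<dots> = (\<Sum>i<j. X (\<tau> (Suc i)) \<omega> - X (\<tau> i) \<omega>)"
      proof (rule sum.cong)
        fix i assume "i \<in> {..<j}"
        then have "i < n" "\<tau> i < \<tau> (Suc i)" using j(1) strict_mono_onD[OF \<tau>, of i "Suc i"] by auto
        then show "sqrt (\<tau> (Suc i) - \<tau> i) * (\<lambda>i\<in>{..<n}. Z i \<omega>) i = X (\<tau> (Suc i)) \<omega> - X (\<tau> i) \<omega>"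
          by (simp add: Z_def)
      qed simp
      also have "\<dots> = X s \<omega> - X (\<tau> 0) \<omega>" using sum_lessThan_telescope[of "\<lambda>i. X (\<tau> i) \<omega>" j] j(2) by simp
      finally show ?thesis .
    qed
    show ?thesis unfolding \<Phi>_def F_def by (rule D.norm_cong) (simp add: path_Z mem)
  qed
  have "measure (gauss {..<n}) {w \<in> space (gauss {..<n}). \<mu> + t \<le> \<Phi> w} \<le> exp (- (t\<^sup>2 / (2 * (3 * sqrt \<delta>)\<^sup>2)))"
  proof (rule gauss_concentration[OF _ \<Phi>_meas])
    show "0 \<le> \<Phi> w" for w unfolding \<Phi>_def by (rule D.norm_nonneg)
    have "integrable (distr M (gauss {..<n}) (\<lambda>\<omega>. \<lambda>i\<in>{..<n}. Z i \<omega>)) \<Phi>"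
      using int by (subst integrable_distr_eq[OF Z(1) \<Phi>_meas]) (simp add: F_eq)
    then show "integrable (gauss {..<n}) \<Phi>" unfolding Z(2) .
    have "(\<integral>w. \<Phi> w \<partial>distr M (gauss {..<n}) (\<lambda>\<omega>. \<lambda>i\<in>{..<n}. Z i \<omega>)) = expectation F"
      by (subst integral_distr[OF Z(1) \<Phi>_meas]) (simp add: F_eq)
    then show "(\<integral>w. \<Phi> w \<partial>gauss {..<n}) \<le> \<mu>" unfolding Z(2) using mean by simp
  qed (use lip \<delta> t in auto)
  also have "measure (gauss {..<n}) {w \<in> space (gauss {..<n}). \<mu> + t \<le> \<Phi> w}
    = measure (distr M (gauss {..<n}) (\<lambda>\<omega>. \<lambda>i\<in>{..<n}. Z i \<omega>)) {w \<in> space (gauss {..<n}). \<mu> + t \<le> \<Phi> w}"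
    unfolding Z(2) ..
  also have "\<dots> = prob {\<omega> \<in> space M. \<mu> + t \<le> F \<omega>}"
  proof (subst measure_distr[OF Z(1)])
    show "{w \<in> space (gauss {..<n}). \<mu> + t \<le> \<Phi> w} \<in> sets (gauss {..<n})"
      using \<Phi>_meas by measurable
    show "prob ((\<lambda>\<omega>. \<lambda>i\<in>{..<n}. Z i \<omega>) -` {w \<in> space (gauss {..<n}). \<mu> + t \<le> \<Phi> w} \<inter> space M) = prob {\<omega> \<in> space M. \<mu> + t \<le> F \<omega>}"
      using measurable_space[OF Z(1)] by (intro arg_cong[where f = prob]) (auto simp: F_eq)
  qed
  finally show ?thesis using \<delta> by (simp add: power_mult_distrib)
qed

section \<open>Comparison of constants and the tail bound\<close>

text \<open>After cancellation of \<open>exp (- r\<^sup>2 / 2)\<close> this says \<open>r * exp (- r) \<le> exp (1 / 2) / sqrt (2 * pi)\<close>. The left-hand side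
is at most \<open>exp (- 1)\<close>, and \<open>2 * pi \<le> 8 \<le> exp 3\<close>.\<close>
lemma gaussian_tail_comparison:
  fixes r :: real
  assumes r: "r > 0"
  shows "exp (- ((r + 1)\<^sup>2 / 2)) \<le> 1 / sqrt (2 * pi) * (1 / r) * exp (- (r\<^sup>2 / 2))"
proof -
  have "2 \<le> exp (1 :: real)" using exp_ge_add_one_self[of 1] by simp
  then have "2 ^ 3 \<le> exp (1 :: real) ^ 3" by (intro power_mono) auto
  also have "exp (1 :: real) ^ 3 = exp (3 / 2) ^ 2" by (simp add: exp_of_nat_mult[symmetric])
  finally have "2 * pi \<le> exp (3 / 2) ^ 2" using pi_less_4 by simp
  then have "sqrt (2 * pi) \<le> exp (3 / 2)" by (intro real_le_lsqrt) auto
  then have le1: "exp (- (3 / 2)) \<le> 1 / sqrt (2 * pi)"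
    by (simp add: exp_minus inverse_eq_divide frac_le)
  have "r \<le> exp (r - 1)" using exp_ge_add_one_self[of "r - 1"] by simp
  then have "r * exp (- (r + 1 / 2)) \<le> exp (r - 1) * exp (- (r + 1 / 2))" by (intro mult_right_mono) auto
  also have "\<dots> = exp (- (3 / 2))" by (simp add: exp_add[symmetric])
  finally have "r * exp (- (r + 1 / 2)) \<le> 1 / sqrt (2 * pi)" using le1 by simp
  then have "exp (- (r + 1 / 2)) \<le> 1 / sqrt (2 * pi) * (1 / r)" using r by (simp add: field_simps)
  then have "exp (- (r + 1 / 2)) * exp (- (r\<^sup>2 / 2)) \<le> 1 / sqrt (2 * pi) * (1 / r) * exp (- (r\<^sup>2 / 2))"
    by (intro mult_right_mono) auto
  moreover have "exp (- (r + 1 / 2)) * exp (- (r\<^sup>2 / 2)) = exp (- ((r + 1)\<^sup>2 / 2))"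
    by (simp add: exp_add[symmetric] power2_eq_square field_simps)
  ultimately show ?thesis by simp
qed

lemma d_const_root:
  assumes p: "p > 2"
  shows "d_const \<alpha> p powr (1 / p)
    = sqrt 2 * (4 + 2 powr ((p - 1) / p)) * gauss_abs_moment p powr (1 / p) * (c_const \<alpha> p * weight_series \<alpha> p powr (1 / p))"
proof -
  have c: "c_const \<alpha> p \<ge> 0" by (simp add: c_const_def)
  have "d_const \<alpha> p = 2 powr (p / 2) * (4 + 2 powr ((p - 1) / p)) powr p * c_const \<alpha> p powr p
     * gauss_abs_moment p * weight_series \<alpha> p"
    by (simp add: d_const_def gauss_abs_moment_def weight_series_def mult.assoc)
  then have "d_const \<alpha> p powr (1 / p) = 2 powr (1 / 2) * (4 + 2 powr ((p - 1) / p)) * c_const \<alpha> p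
     * gauss_abs_moment p powr (1 / p) * weight_series \<alpha> p powr (1 / p)"
    using p c by (simp add: powr_mult powr_powr add_nonneg_nonneg)
  then show ?thesis by (simp add: powr_half_sqrt mult_ac)
qed

lemma dp_const_ge_2:
  assumes p: "p > 0"
  shows "2 \<le> dp_const p"
proof -
  have "2 powr (1 / 2) * (2 powr (p / 2)) powr (1 / p) \<le> dp_const p"
    unfolding dp_const_def using p by (intro mult_mono powr_mono powr_mono2) auto
  moreover have "(2::real) powr (1 / 2) * (2 powr (p / 2)) powr (1 / p) = 2"
    using p by (simp add: powr_powr powr_add[symmetric])
  ultimately show ?thesis by simp
qed

text \<open>The left-hand side is the bound for the mean plus \<open>r + 1\<close> Lipschitz constants. Relative to \<open>\<delta> powr \<theta>\<close> it is at
most \<open>10.5 m Q + 3 (r + 1)\<close>, whereas the threshold is at least \<open>14 m Q + 4 r\<close>; the difference is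
positive because \<open>m Q \<ge> 1\<close>. The Lipschitz constant is of order \<open>sqrt \<delta>\<close>, which for \<open>\<delta> \<le> 1\<close> is at most
\<open>\<delta> powr \<theta>\<close>.\<close>
lemma mean_plus_deviation_less_threshold:
  assumes p: "p > 2" and \<alpha>: "\<alpha> > 1 - 1 / p" and \<delta>: "0 < \<delta>" "\<delta> \<le> 1" and r: "r > 0"
  defines "\<theta> \<equiv> 1 / 2 - 1 / p"
  shows "3 * gauss_abs_moment p powr (1 / p) * \<delta> powr \<theta> * (\<Sum>k. 2 powr (- real k * \<theta>)) * (2 powr (1 / p) + 2)
      + 3 * sqrt \<delta> * (r + 1) < (d1_const \<alpha> p + r) * (d2_const p * \<delta> powr \<theta>)"
proof -
  have \<theta>: "0 < \<theta>" "\<theta> \<le> 1 / 2" using p by (auto simp: \<theta>_def field_simps)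
  define m where "m = gauss_abs_moment p powr (1 / p)"
  define R where "R = (\<Sum>k. 2 powr (- real k * \<theta>))"
  define Q where "Q = c_const \<alpha> p * weight_series \<alpha> p powr (1 / p)"
  have m: "1 \<le> m" using gauss_abs_moment_ge_1[of p] p by (simp add: m_def ge_one_powr_ge_zero)
  have R: "1 \<le> R" "R \<le> Q"
    using geometric_sum_ge_1[OF \<theta>(1)] geometric_sum_le_constants[OF p \<alpha>] by (auto simp: R_def Q_def \<theta>_def)
  have mQ: "1 \<le> m * Q" using mult_mono[of 1 m 1 Q] m R by simp
  have sqrt2: "1.4 \<le> sqrt 2" "sqrt 2 \<le> 1.5"
    by (rule real_le_rsqrt, simp add: power2_eq_square) (rule real_le_lsqrt, simp_all add: power2_eq_square)
  have root2: "2 powr (1 / p) \<le> 1.5"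
  proof -
    have "2 powr (1 / p) \<le> 2 powr (1 / 2 :: real)" using p by (intro powr_mono) (auto simp: field_simps)
    then show ?thesis using sqrt2 by (simp add: powr_half_sqrt)
  qed
  have dp: "2 \<le> dp_const p" using p by (intro dp_const_ge_2) simp
  have d12: "(d1_const \<alpha> p + r) * d2_const p = 2 * d_const \<alpha> p powr (1 / p) + 2 * dp_const p * r"
    using dp by (simp add: d1_const_def d2_const_def field_simps)
  have d: "14 * (m * Q) \<le> 2 * d_const \<alpha> p powr (1 / p)"
  proof -
    have "1 \<le> 2 powr ((p - 1) / p)" using p by (simp add: ge_one_powr_ge_zero)
    then have "1.4 * 5 \<le> sqrt 2 * (4 + 2 powr ((p - 1) / p))" using sqrt2 by (intro mult_mono) auto
    then have "7 * (m * Q) \<le> sqrt 2 * (4 + 2 powr ((p - 1) / p)) * (m * Q)" using mQ by (intro mult_right_mono) auto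
    also have "\<dots> = d_const \<alpha> p powr (1 / p)" using d_const_root[OF p] by (simp add: m_def Q_def mult.assoc)
    finally show ?thesis by linarith
  qed
  have sq: "sqrt \<delta> \<le> \<delta> powr \<theta>"
    using powr_mono'[of \<theta> "1 / 2" \<delta>] \<theta> \<delta> by (simp add: powr_half_sqrt)
  have pos: "0 < \<delta> powr \<theta>" using \<delta> by simp
  have "3 * m * \<delta> powr \<theta> * R * (2 powr (1 / p) + 2) + 3 * sqrt \<delta> * (r + 1)
     \<le> 3 * m * \<delta> powr \<theta> * Q * (1.5 + 2) + 3 * \<delta> powr \<theta> * (r + 1)"
    using m R root2 r sq \<delta> by (intro add_mono mult_mono mult_nonneg_nonneg) auto
  also have "\<dots> = \<delta> powr \<theta> * (10.5 * (m * Q) + 3 * (r + 1))" by (simp add: algebra_simps)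
  also have "\<dots> < \<delta> powr \<theta> * (14 * (m * Q) + 4 * r)"
    using pos mQ r by (intro mult_strict_left_mono) auto
  also have "\<dots> \<le> \<delta> powr \<theta> * (2 * d_const \<alpha> p powr (1 / p) + 2 * dp_const p * r)"
    using d dp r pos by (intro mult_left_mono add_mono mult_right_mono) auto
  also have "\<dots> = (d1_const \<alpha> p + r) * (d2_const p * \<delta> powr \<theta>)"
    unfolding d12[symmetric] by (simp add: mult_ac)
  finally show ?thesis by (simp add: m_def R_def)
qed

lemma p_variation_diff_finite:
  assumes ab: "a < b" and p: "p \<ge> 1" and f: "continuous_on {a..b} f" and g: "continuous_on {a..b} g"
    and fin: "p_variation p a b f < \<infinity>" "p_variation p a b g < \<infinity>"
  shows "p_variation p a b (\<lambda>u. f u - g u) < \<infinity>"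
proof -
  obtain K :: nat where K: "\<And>N. grid_variation p a b (dyadic_grid a b N) f \<le> real K"
    using fin(1) p_variation_finite_iff[OF ab f p] by blast
  obtain L :: nat where L: "\<And>N. grid_variation p a b (dyadic_grid a b N) g \<le> real L"
    using fin(2) p_variation_finite_iff[OF ab g p] by blast
  have "grid_variation p a b (dyadic_grid a b N) (\<lambda>u. f u - g u) \<le> real (K + L)" for N
    using grid.variation_triangle[OF grid_dyadic[OF ab] p, of N f "\<lambda>u. - g u"]
      grid.variation_minus[OF grid_dyadic[OF ab], of p N g] K[of N] L[of N] by simp
  then show ?thesis using p_variation_finite_iff[OF ab continuous_on_diff[OF f g] p] by blast
qed

lemma p_norm_zero:
  assumes "a < b"
  shows "p_norm p a b (\<lambda>_. 0) = 0"
proof -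
  have "dissections a b \<noteq> {}"
    using grid_dissections_nonempty[OF assms, of "{a, b}"] grid_dissections_D(1) by fastforce
  moreover have "var_sum p (\<lambda>_. 0) d = 0" for d by (cases d) (simp add: var_sum_def)
  ultimately have "p_variation p a b (\<lambda>_. 0) = 0"
    by (simp add: p_variation_alt zero_ereal_def[symmetric])
  then show ?thesis using assms by (simp add: p_norm_def)
qed

theorem theorem37:
  fixes p \<alpha> h1 h2 r :: real
    and W :: "(real \<Rightarrow> real) measure"
    and S :: "real \<Rightarrow> (real \<Rightarrow> real) \<Rightarrow> (real \<Rightarrow> real)"
  assumes "p > 2" and "\<alpha> > 1 - 1 / p"
    and "0 \<le> h1" and "h1 < h2" and "h2 \<le> 1"
    and "wiener_measure W"
    and "continuous_modification (completion W) p (shift_B p) S"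
    and "r > 0"
  shows "let E = {f \<in> space (completion W).
      p_norm p 0 1 (\<lambda>u. S h2 f u - S h1 f u) / (d2_const p * (h2 - h1) powr (1 / 2 - 1 / p))
        - d1_const \<alpha> p \<ge> r}
    in E \<in> sets (completion W) \<and>
      measure (completion W) E \<le> 1 / sqrt (2 * pi) * (1 / r) * exp (- (r ^ 2 / 2))"
proof -
  note p = assms(1) and S = assms(7)[unfolded continuous_modification_def]
  have p1: "p \<ge> 1" "p \<ge> 2" using p by auto
  interpret W: prob_space W using assms(6) by (simp add: wiener_measure_def)
  have B: "brownian_motion_on W (-1) 1 (\<lambda>t f. f t)"
    and space_W: "space W = {f \<in> cpaths (-1) 1. f (-1) = 0}"
    using assms(6) by (auto simp: wiener_measure_def C0_borel_def space_measure_of_conv mspace_C0_metric)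
  define \<delta> where "\<delta> = h2 - h1"
  define \<theta> where "\<theta> = 1 / 2 - 1 / p"
  have \<delta>: "0 < \<delta>" "\<delta> \<le> 1" using assms by (auto simp: \<delta>_def)
  define c where "c = h1 - 1"
  have c: "- 1 \<le> c" "c + \<delta> + 1 \<le> 1" "c + \<delta> = h2 - 1" using assms by (auto simp: c_def \<delta>_def)
  define G where "G u f = f (c + \<delta> + u) - f (c + u)" for u :: real and f :: "real \<Rightarrow> real"
  define F where "F N f = grid_norm p 0 1 (dyadic_grid 0 1 N) (\<lambda>u. G u f)" for N f
  define C where "C = gauss_abs_moment p"
  have C: "0 \<le> C" using gauss_abs_moment_ge_1[of p] p by (simp add: C_def)
  define \<mu> where "\<mu> = 3 * C powr (1 / p) * \<delta> powr \<theta> * (\<Sum>k. 2 powr (- real k * \<theta>)) * (2 powr (1 / p) + 2)"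
  define t where "t = 3 * sqrt \<delta> * (r + 1)"
  have t: "0 < t" using \<delta> assms(8) by (simp add: t_def)
  define K where "K = (d1_const \<alpha> p + r) * (d2_const p * \<delta> powr \<theta>)"
  have K: "\<mu> + t < K"
    unfolding \<mu>_def t_def K_def C_def \<theta>_def by (rule mean_plus_deviation_less_threshold) (use assms \<delta> in auto)
  note coord = brownian_measurable[OF B]
  note moment = W.brownian_abs_moment[OF B _ _ _ p1(1)]
  have G_meas: "G u \<in> borel_measurable W" if "u \<in> {0..1}" for u
    unfolding G_def using that c \<delta> by (intro borel_measurable_diff coord) auto
  have G_size: "integrable W (\<lambda>f. \<bar>G u f\<bar> powr p)" "W.expectation (\<lambda>f. \<bar>G u f\<bar> powr p) \<le> \<delta> powr (p / 2) * C"
    if "u \<in> {0..1}" for u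
    using moment[of "c + u" "c + \<delta> + u"] that c(1,2) \<delta> by (auto simp: G_def C_def)
  have G_incr: "integrable W (\<lambda>f. \<bar>G v f - G u f\<bar> powr p)"
    "W.expectation (\<lambda>f. \<bar>G v f - G u f\<bar> powr p) \<le> 2 powr p * (v - u) powr (p / 2) * C"
    if uv: "0 \<le> u" "u < v" "v \<le> 1" for u v
  proof -
    let ?I = "\<lambda>s f. \<bar>f (s + v) - f (s + u)\<bar> powr p :: real"
    have m: "integrable W (?I s)" "W.expectation (?I s) = (v - u) powr (p / 2) * C" if "-1 \<le> s" "s \<le> 0" for s
      using moment[of "s + u" "s + v"] that uv by (auto simp: C_def)
    have s: "-1 \<le> c" "c \<le> 0" "-1 \<le> c + \<delta>" "c + \<delta> \<le> 0" using c \<delta> by auto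
    \<comment> \<open>The two increments need not be treated as independent: convexity of the power loses only a constant.\<close>
    let ?H = "\<lambda>f. 2 powr (p - 1) * (?I (c + \<delta>) f + ?I c f)"
    have le: "\<bar>G v f - G u f\<bar> powr p \<le> ?H f" for f
      using powr_diff_le[OF p1(1), of "f (c + \<delta> + v) - f (c + \<delta> + u)" "f (c + v) - f (c + u)"]
      by (simp add: G_def algebra_simps)
    have int: "integrable W ?H" by (intro integrable_mult_right Bochner_Integration.integrable_add m s)
    have [measurable]: "G u \<in> borel_measurable W" "G v \<in> borel_measurable W" using uv by (auto intro: G_meas)
    show 1: "integrable W (\<lambda>f. \<bar>G v f - G u f\<bar> powr p)"
    proof (rule Bochner_Integration.integrable_bound[OF int])
      show "AE f in W. norm (\<bar>G v f - G u f\<bar> powr p) \<le> norm (?H f)"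
        using le by (intro AE_I2) (simp add: order_trans[OF le abs_ge_self])
    qed measurable
    have "W.expectation (\<lambda>f. \<bar>G v f - G u f\<bar> powr p) \<le> W.expectation ?H"
      by (rule integral_mono[OF 1 int le])
    also have "\<dots> = 2 powr (p - 1) * ((v - u) powr (p / 2) * C + (v - u) powr (p / 2) * C)"
      using m[OF s(1,2)] m[OF s(3,4)] by simp
    also have "\<dots> = 2 powr p * (v - u) powr (p / 2) * C" by (simp add: powr_diff)
    finally show "W.expectation (\<lambda>f. \<bar>G v f - G u f\<bar> powr p) \<le> 2 powr p * (v - u) powr (p / 2) * C" .
  qed
  note mean = W.expectation_grid_norm_le[OF p \<delta> C G_meas G_size G_incr, folded F_def \<theta>_def, folded \<mu>_def]
  have grid01: "grid 0 1 (dyadic_grid 0 1 N)" for N by (rule grid_dyadic) simp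
  have tail: "measure W {f \<in> space W. \<mu> + t \<le> F N f} \<le> exp (- ((r + 1)\<^sup>2 / 2))" for N
  proof -
    have "measure W {f \<in> space W. \<mu> + t \<le> F N f} \<le> exp (- (t\<^sup>2 / (18 * \<delta>)))"
      unfolding F_def G_def
      by (rule W.brownian_grid_concentration[OF B p1(2) \<delta>(1) grid01 _ c(1,2) _ _ t])
        (use mean[unfolded F_def G_def] dyadic_grid_subset[of 0 1 N] in auto)
    moreover have "t\<^sup>2 / (18 * \<delta>) = (r + 1)\<^sup>2 / 2" using \<delta> by (simp add: t_def power_mult_distrib)
    ultimately show ?thesis by simp
  qed
  have F_meas[measurable]: "F N \<in> borel_measurable W" for N
    unfolding F_def using dyadic_grid_subset[of 0 1 N] by (intro grid_norm_measurable grid01 G_meas) auto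
  have F_mono: "F N f \<le> F M f" if "N \<le> M" for N M f
    unfolding F_def using that by (intro grid_norm_mono grid01 dyadic_grid_mono)
  define A where "A = {f \<in> space W. p_variation p (-1) 1 f < \<infinity>}"
  have A[measurable]: "A \<in> sets W"
  proof -
    have [measurable]: "(\<lambda>f. grid_variation p (-1) 1 (dyadic_grid (-1) 1 N) (\<lambda>u. f u)) \<in> borel_measurable W" for N
      using dyadic_grid_subset[of "-1" 1 N] by (intro grid_norm_measurable(2) grid_dyadic coord) auto
    have "A = {f \<in> space W. \<exists>k::nat. \<forall>N. grid_variation p (-1) 1 (dyadic_grid (-1) 1 N) (\<lambda>u. f u) \<le> real k}"
      unfolding A_def using p_variation_finite_iff[of "-1" 1 _ p] p1 by (auto simp: space_W cpaths_def)
    also have "\<dots> \<in> sets W" by measurable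
    finally show ?thesis .
  qed
  have A_iff: "f \<in> A \<longleftrightarrow> f \<in> cpaths0_p p (-1) 1" if "f \<in> space W" for f
    using that by (auto simp: A_def space_W cpaths0_p_def cpaths_p_def)
  \<comment> \<open>A measurable version of the event. On \<open>A\<close> the modification coincides almost surely with the shifted paths and
    the limit is the norm of their difference; off \<open>A\<close> both shifts are the zero path and the norm is \<open>0 < K\<close>.\<close>
  define E' where "E' = {f \<in> A. K \<le> lim (\<lambda>N. F N f)}"
  have E': "E' \<in> sets W"
  proof -
    have "E' = A \<inter> {f \<in> space W. K \<le> lim (\<lambda>N. F N f)}" by (auto simp: E'_def A_def)
    also have "\<dots> \<in> sets W" by measurable
    finally show ?thesis .
  qed
  have E'_le: "measure W E' \<le> exp (- ((r + 1)\<^sup>2 / 2))"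
  proof -
    let ?T = "\<lambda>N. {f \<in> space W. \<mu> + t \<le> F N f}"
    \<comment> \<open>The strict inequality \<open>\<mu> + t < K\<close> lets some finite grid witness the event.\<close>
    have "E' \<subseteq> (\<Union>N. ?T N)"
    proof
      fix f assume f: "f \<in> E'"
      show "f \<in> (\<Union>N. ?T N)"
      proof (rule ccontr)
        assume "f \<notin> (\<Union>N. ?T N)"
        then have bd: "F N f \<le> \<mu> + t" for N using f by (auto simp: E'_def A_def not_le intro: less_imp_le)
        have inc: "incseq (\<lambda>N. F N f)" using F_mono by (simp add: incseq_def)
        obtain L where L: "(\<lambda>N. F N f) \<longlonglongrightarrow> L"
          by (rule incseq_convergent[OF inc, of "\<mu> + t"]) (use bd in auto)
        have "L \<le> \<mu> + t" using L bd by (intro LIMSEQ_le_const2[OF L]) auto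
        moreover have "K \<le> L" using f limI[OF L] by (simp add: E'_def)
        ultimately show False using K by simp
      qed
    qed
    then have "measure W E' \<le> measure W (\<Union>N. ?T N)" by (intro W.finite_measure_mono) auto
    also have "\<dots> \<le> exp (- ((r + 1)\<^sup>2 / 2))"
    proof (rule LIMSEQ_le_const2)
      show "(\<lambda>N. measure W (?T N)) \<longlonglongrightarrow> measure W (\<Union>N. ?T N)"
        by (rule W.finite_Lim_measure_incseq) (use F_mono in \<open>auto simp: incseq_def intro: order_trans\<close>)
    qed (use tail in auto)
    finally show ?thesis .
  qed
  define E where "E = {f \<in> space (completion W).
      p_norm p 0 1 (\<lambda>u. S h2 f u - S h1 f u) / (d2_const p * (h2 - h1) powr (1 / 2 - 1 / p)) - d1_const \<alpha> p \<ge> r}"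
  have d2: "0 < d2_const p * \<delta> powr \<theta>"
    using \<delta> dp_const_ge_2[of p] p by (simp add: d2_const_def)
  have E_iff: "f \<in> E \<longleftrightarrow> f \<in> space W \<and> K \<le> p_norm p 0 1 (\<lambda>u. S h2 f u - S h1 f u)" for f
  proof -
    have "r \<le> x / (d2_const p * \<delta> powr \<theta>) - d1_const \<alpha> p \<longleftrightarrow> K \<le> x" for x
      using d2 by (simp add: K_def le_diff_eq pos_le_divide_eq add.commute)
    then show ?thesis by (simp add: E_def \<delta>_def \<theta>_def)
  qed
  have K_pos: "0 < K"
  proof -
    have "0 \<le> \<mu>" unfolding \<mu>_def using C by (intro mult_nonneg_nonneg suminf_nonneg summable_geometric_powr)
       (use p in \<open>auto simp: \<theta>_def field_simps\<close>)
    then show ?thesis using K t by simp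
  qed
  have h: "h1 \<in> {0..1}" "h2 \<in> {0..1}" using assms by auto
  have "AE f in completion W. S h1 f = shift_B p h1 f" "AE f in completion W. S h2 f = shift_B p h2 f"
    using S h by blast+
  then have ae: "AE f in completion W. f \<in> E' \<longleftrightarrow> f \<in> E"
    using AE_space
  proof eventually_elim
    case (elim f)
    then have f: "f \<in> space W" by simp
    show ?case
    proof (cases "f \<in> A")
      case False
      then have "S h1 f = S h2 f" using elim A_iff[OF f] by (simp add: shift_B_def)
      then have "p_norm p 0 1 (\<lambda>u. S h2 f u - S h1 f u) = 0" by (simp add: p_norm_zero)
      then show ?thesis using False K_pos by (simp add: E_iff E'_def)
    next
      case True
      then have eq: "S h1 f = shift_path h1 f" "S h2 f = shift_path h2 f"
        using elim A_iff[OF f] by (simp_all add: shift_B_def)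
      let ?g = "\<lambda>u. S h2 f u - S h1 f u"
      have "S h1 f \<in> cpaths_p p 0 1" "S h2 f \<in> cpaths_p p 0 1" using S h elim(3) by blast+
      then have "continuous_on {0..1} (S h1 f)" "continuous_on {0..1} (S h2 f)"
        "p_variation p 0 1 (S h1 f) < \<infinity>" "p_variation p 0 1 (S h2 f) < \<infinity>"
        by (auto simp: cpaths_p_def cpaths_def)
      then have g: "continuous_on {0..1} ?g" "p_variation p 0 1 ?g < \<infinity>"
        using p1 by (intro continuous_on_diff p_variation_diff_finite; simp)+
      have F_eq: "F N f = grid_norm p 0 1 (dyadic_grid 0 1 N) ?g" for N
        unfolding F_def
      proof (rule grid.norm_cong[OF grid01])
        fix u assume "u \<in> dyadic_grid 0 1 N"
        then have "u \<in> {0..1}" using dyadic_grid_subset[of 0 1 N] by auto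
        then show "G u f = ?g u" unfolding eq G_def c(3) by (simp add: shift_path_def c_def)
      qed
      have "(\<lambda>N. F N f) \<longlonglongrightarrow> p_norm p 0 1 ?g"
        unfolding F_eq by (rule grid_norm_tendsto_p_norm) (use g p1 in auto)
      then have "lim (\<lambda>N. F N f) = p_norm p 0 1 ?g" by (rule limI)
      then show ?thesis using True f by (simp add: E_iff E'_def)
    qed
  qed
  have E'_c: "E' \<in> sets (completion W)" using E' by (rule sets_completionI_sets)
  have E_sets: "E \<in> sets (completion W)"
    by (rule completion.in_sets_AE[OF ae E'_c]) (auto simp: E_def)
  have "measure (completion W) E = measure (completion W) E'"
    by (rule measure_eq_AE) (use ae E'_c E_sets in auto)
  also have "\<dots> = measure W E'" using E' by (rule measure_completion)
  also have "\<dots> \<le> 1 / sqrt (2 * pi) * (1 / r) * exp (- (r ^ 2 / 2))"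
    using E'_le gaussian_tail_comparison[OF assms(8)] by (rule order_trans)
  finally have "measure (completion W) E \<le> 1 / sqrt (2 * pi) * (1 / r) * exp (- (r ^ 2 / 2))" .
  with E_sets show ?thesis unfolding Let_def E_def[symmetric] by blast
qed

end
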